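(* Let $n\ge2$, $p\in(1,2)\cup(2,\infty)$, $R_2>R_1>0$, and $\Omega=\mathbb{B}(O,R_2)\setminus\mathbb{B}(O,R_1)\subset\mathbb{R}^n$ with boundary $\Gamma$. Assume that $f\in C(\overline\Omega)$ is radially symmetric (about $O$) and that ${\rm Sgn}(f)=1$ or ${\rm Sgn}(f)=-1$ on $\overline\Omega$. Then for every $\epsilon>0$ there exists a global minimizer $\bar u_\epsilon\in\mathscr{N}$ of $I^{(\epsilon)}$ over $\mathscr{N}$, which is at the same time a solution of the Euler–Lagrange problem $${\rm div}\Big(\big(|\nabla u|^2+\chi(p)\epsilon^2\big)^{(p-2)/2}\nabla u\Big)+f=0\ \text{ in }\Omega,\qquad u=0\ \text{ on }\Gamma,$$ and which is given explicitly, as a function of $r=|x-O|$, by $$\bar u_\epsilon(r)=\int_{R_1}^{r}\frac{F_\epsilon(\rho)\,\rho}{E_{\epsilon,p}^{-1}\big(F_\epsilon^2(\rho)\rho^2\big)}\,d\rho,\qquad r\in[R_1,R_2],$$ where $$F_\epsilon(r)={\rm Sgn}(f)\,\frac{R_1^nC_\epsilon}{r^n}+\frac1{r^n}\int_r^{R_1}f(\rho)\rho^{n-1}\,d\rho,\qquad r\in[R_1,R_2],$$ and $C_\epsilon=M_\epsilon^{-1}(0)$ is the unique positive number with $M_\epsilon(C_\epsilon)=0$.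
   Context: $\mathbb{B}(O,R)$ is the open ball of center $O$ and radius $R$ in $\mathbb{R}^n$. ${\rm Sgn}(f)=1$ means $f>0$ everywhere on $\overline\Omega$; ${\rm Sgn}(f)=-1$ means $f<0$ everywhere on $\overline\Omega$. Radial functions are written either as functions of $x$ or of $r=|x-O|$. Set $\chi(p)=1$ for $p\in(1,2)$ and $\chi(p)=0$ for $p\in(2,\infty)$. The feasible space is $\mathscr{N}=\{u\in W_0^{1,p}(\Omega)\cap C(\overline\Omega): u\text{ is radially symmetric}\}$, and $$I^{(\epsilon)}[u]=\frac1p\int_\Omega\big(|\nabla u|^2+\chi(p)\epsilon^2\big)^{p/2}dx-\int_\Omega fu\,dx .$$ Define $E_{\epsilon,p}(r)=r^{(2p-2)/(p-2)}-\chi(p)\epsilon^2r^2$. For $p\in(1,2)$ it is strictly decreasing on $(0,\epsilon^{p-2}]$ (with range $[0,\infty)$), and for $p\in(2,\infty)$ it is strictly increasing on $[0,\infty)$ (with range $[0,\infty)$); $E_{\epsilon,p}^{-1}$ denotes the inverse of $E_{\epsilon,p}$ on that interval. For $y>0$ and $r\in[R_1,R_2]$ put $$G(r,y)={\rm Sgn}(f)\,y\,R_1^n+\int_r^{R_1}f(\rho)\rho^{n-1}d\rho,\qquad \lambda_\epsilon(r,y)=E_{\epsilon,p}^{-1}\!\left(\frac{G(r,y)^2}{r^{2n-2}}\right),$$ $$\mu_\epsilon(r,y)=\frac{G(r,y)}{r^{n-1}\lambda_\epsilon(r,y)},\qquad M_\epsilon(y)=\int_{R_1}^{R_2}\mu_\epsilon(\rho,y)\,d\rho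 .$$ For $p>2$, quotients of the form $0/E_{\epsilon,p}^{-1}(0)=0/0$ are read as $0$. *)

theory Defs
  imports "HOL-Analysis.Analysis"
begin

text \<open>Meant for open \<open>S\<close> only, since two-sided derivatives \<open>at x\<close> are used.\<close>

primrec Ck_on :: "nat \<Rightarrow> 'a::euclidean_space set \<Rightarrow> ('a \<Rightarrow> 'b::real_normed_vector) \<Rightarrow> bool" where
  "Ck_on 0 S f \<longleftrightarrow> continuous_on S f"
| "Ck_on (Suc k) S f \<longleftrightarrow>
     (\<forall>x\<in>S. f differentiable (at x)) \<and>
     (\<forall>b\<in>Basis. Ck_on k S (\<lambda>x. frechet_derivative f (at x) b))"

definition grad :: "('a::euclidean_space \<Rightarrow> real) \<Rightarrow> 'a \<Rightarrow> 'a" where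
  "grad u x = (\<Sum>b\<in>Basis. frechet_derivative u (at x) b *\<^sub>R b)"

definition divergence :: "('a::euclidean_space \<Rightarrow> 'a) \<Rightarrow> 'a \<Rightarrow> real" where
  "divergence V x = (\<Sum>b\<in>Basis. frechet_derivative V (at x) b \<bullet> b)"

definition test_functions :: "'a::euclidean_space set \<Rightarrow> ('a \<Rightarrow> real) set" where
  "test_functions \<Omega> =
     {\<phi>. (\<forall>k. Ck_on k UNIV \<phi>) \<and>
         compact (closure {x. \<phi> x \<noteq> 0}) \<and> closure {x. \<phi> x \<noteq> 0} \<subseteq> \<Omega>}"

text \<open>Elements are honest functions rather than classes modulo null sets, and only their
  values on \<open>\<Omega>\<close> matter.\<close>

definition in_Lp :: "real \<Rightarrow> 'a::euclidean_space set \<Rightarrow> ('a \<Rightarrow> 'b::euclidean_space) \<Rightarrow> bool" where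
  "in_Lp p \<Omega> u \<longleftrightarrow>
     u \<in> borel_measurable (lebesgue_on \<Omega>) \<and>
     integrable (lebesgue_on \<Omega>) (\<lambda>x. norm (u x) powr p)"

definition locally_integrable :: "'a::euclidean_space set \<Rightarrow> ('a \<Rightarrow> 'b::euclidean_space) \<Rightarrow> bool" where
  "locally_integrable \<Omega> u \<longleftrightarrow> (\<forall>K. compact K \<and> K \<subseteq> \<Omega> \<longrightarrow> u absolutely_integrable_on K)"

definition has_weak_gradient ::
  "'a::euclidean_space set \<Rightarrow> ('a \<Rightarrow> real) \<Rightarrow> ('a \<Rightarrow> 'a) \<Rightarrow> bool" where
  "has_weak_gradient \<Omega> u g \<longleftrightarrow>
     locally_integrable \<Omega> u \<and> locally_integrable \<Omega> g \<and>
     (\<forall>\<phi>\<in>test_functions \<Omega>. \<forall>b\<in>Basis.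
        (LINT x|lebesgue_on \<Omega>. u x * (grad \<phi> x \<bullet> b)) =
        - (LINT x|lebesgue_on \<Omega>. (g x \<bullet> b) * \<phi> x))"

text \<open>A weak gradient is unique up to a null set, so integrals do not depend on the choice.\<close>

definition weak_grad :: "'a::euclidean_space set \<Rightarrow> ('a \<Rightarrow> real) \<Rightarrow> 'a \<Rightarrow> 'a" where
  "weak_grad \<Omega> u = (SOME g. has_weak_gradient \<Omega> u g)"

definition W1p :: "real \<Rightarrow> 'a::euclidean_space set \<Rightarrow> ('a \<Rightarrow> real) set" where
  "W1p p \<Omega> = {u. in_Lp p \<Omega> u \<and> (\<exists>g. has_weak_gradient \<Omega> u g \<and> in_Lp p \<Omega> g)}"

text \<open>The closure of \<open>C\<^sub>c\<^sup>\<infinity>(\<Omega>)\<close> in \<open>W\<^sup>1\<^sup>,\<^sup>p(\<Omega>)\<close>.\<close>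

definition W1p_0 :: "real \<Rightarrow> 'a::euclidean_space set \<Rightarrow> ('a \<Rightarrow> real) set" where
  "W1p_0 p \<Omega> =
     {u \<in> W1p p \<Omega>. \<exists>\<phi>. (\<forall>k::nat. \<phi> k \<in> test_functions \<Omega>) \<and>
        (\<lambda>k. (LINT x|lebesgue_on \<Omega>. \<bar>\<phi> k x - u x\<bar> powr p) +
             (LINT x|lebesgue_on \<Omega>. norm (grad (\<phi> k) x - weak_grad \<Omega> u x) powr p))
          \<longlonglongrightarrow> 0}"

text \<open>The annulus is taken open, so that it is a domain; its closure is the closed annulus and
  its frontier consists of the two spheres.\<close>

definition annulus :: "'a::euclidean_space \<Rightarrow> real \<Rightarrow> real \<Rightarrow> 'a set" where
  "annulus c R1 R2 = ball c R2 - cball c R1"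

definition radially_symmetric_on ::
  "'a::euclidean_space set \<Rightarrow> 'a \<Rightarrow> ('a \<Rightarrow> real) \<Rightarrow> bool" where
  "radially_symmetric_on S c u \<longleftrightarrow> (\<exists>g. \<forall>x\<in>S. u x = g (dist x c))"

text \<open>A radially symmetric function of \<open>x\<close>, written as a function of \<open>r = |x - c|\<close>.\<close>

definition radial_profile ::
  "'a::euclidean_space set \<Rightarrow> 'a \<Rightarrow> ('a \<Rightarrow> real) \<Rightarrow> real \<Rightarrow> real" where
  "radial_profile S c u r = u (SOME x. x \<in> S \<and> dist x c = r)"

definition Sgn_on :: "'a set \<Rightarrow> ('a \<Rightarrow> real) \<Rightarrow> real" where
  "Sgn_on S f =
     (if \<forall>x\<in>S. f x > 0 then 1 else if \<forall>x\<in>S. f x < 0 then - 1 else 0)"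

definition chi :: "real \<Rightarrow> real" where
  "chi p = (if 1 < p \<and> p < 2 then 1 else 0)"

definition feasible_space ::
  "real \<Rightarrow> 'a::euclidean_space \<Rightarrow> real \<Rightarrow> real \<Rightarrow> ('a \<Rightarrow> real) set" where
  "feasible_space p c R1 R2 =
     {u \<in> W1p_0 p (annulus c R1 R2).
        continuous_on (closure (annulus c R1 R2)) u \<and>
        radially_symmetric_on (closure (annulus c R1 R2)) c u}"

definition energy ::
  "real \<Rightarrow> real \<Rightarrow> 'a::euclidean_space set \<Rightarrow> ('a \<Rightarrow> real) \<Rightarrow> ('a \<Rightarrow> real) \<Rightarrow> real" where
  "energy p \<epsilon> \<Omega> f u =
     1 / p * (LINT x|lebesgue_on \<Omega>. ((norm (weak_grad \<Omega> u x))\<^sup>2 + chi p * \<epsilon>\<^sup>2) powr (p / 2)) -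
     (LINT x|lebesgue_on \<Omega>. f x * u x)"

definition global_minimizer :: "('u \<Rightarrow> real) \<Rightarrow> 'u set \<Rightarrow> 'u \<Rightarrow> bool" where
  "global_minimizer J A u \<longleftrightarrow> u \<in> A \<and> (\<forall>v\<in>A. J u \<le> J v)"

definition flux :: "real \<Rightarrow> real \<Rightarrow> ('a::euclidean_space \<Rightarrow> real) \<Rightarrow> 'a \<Rightarrow> 'a" where
  "flux p \<epsilon> u x =
     ((norm (grad u x))\<^sup>2 + chi p * \<epsilon>\<^sup>2) powr ((p - 2) / 2) *\<^sub>R grad u x"

text \<open>Classical solutions. For \<open>p > 2\<close> the flux can be \<open>C\<^sup>1\<close> although \<open>u\<close> is not \<open>C\<^sup>2\<close> at
  critical points, so only \<open>u \<in> C\<^sup>1\<close> is asked for besides the regularity of the flux.\<close>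

definition solves_Euler_Lagrange ::
  "real \<Rightarrow> real \<Rightarrow> 'a::euclidean_space set \<Rightarrow> ('a \<Rightarrow> real) \<Rightarrow> ('a \<Rightarrow> real) \<Rightarrow> bool" where
  "solves_Euler_Lagrange p \<epsilon> \<Omega> f u \<longleftrightarrow>
     continuous_on (closure \<Omega>) u \<and> Ck_on 1 \<Omega> u \<and> Ck_on 1 \<Omega> (flux p \<epsilon> u) \<and>
     (\<forall>x\<in>\<Omega>. divergence (flux p \<epsilon> u) x + f x = 0) \<and>
     (\<forall>x\<in>frontier \<Omega>. u x = 0)"

definition E_fun :: "real \<Rightarrow> real \<Rightarrow> real \<Rightarrow> real" where
  "E_fun \<epsilon> p r = r powr ((2 * p - 2) / (p - 2)) - chi p * \<epsilon>\<^sup>2 * r\<^sup>2"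

definition E_dom :: "real \<Rightarrow> real \<Rightarrow> real set" where
  "E_dom \<epsilon> p = (if p < 2 then {0 <.. \<epsilon> powr (p - 2)} else {0..})"

definition E_inv :: "real \<Rightarrow> real \<Rightarrow> real \<Rightarrow> real" where
  "E_inv \<epsilon> p = the_inv_into (E_dom \<epsilon> p) (E_fun \<epsilon> p)"

text \<open>In the following definitions \<open>n = DIM('a)\<close>. The interval integrals are oriented: the one
  from \<open>r\<close> to \<open>R1\<close> with \<open>r \<ge> R1\<close> is minus the integral over \<open>[R1, r]\<close>. Quotients \<open>0 / 0\<close> are \<open>0\<close>,
  as required for \<open>p > 2\<close> at the zeros of \<open>G\<close>.\<close>

definition weighted_integral ::
  "'a::euclidean_space \<Rightarrow> real \<Rightarrow> real \<Rightarrow> ('a \<Rightarrow> real) \<Rightarrow> real \<Rightarrow> real" where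
  "weighted_integral c R1 R2 f r =
     (LBINT \<rho>=r..R1. radial_profile (closure (annulus c R1 R2)) c f \<rho> * \<rho> ^ (DIM('a) - 1))"

definition G_fun ::
  "'a::euclidean_space \<Rightarrow> real \<Rightarrow> real \<Rightarrow> ('a \<Rightarrow> real) \<Rightarrow> real \<Rightarrow> real \<Rightarrow> real" where
  "G_fun c R1 R2 f r y =
     Sgn_on (closure (annulus c R1 R2)) f * y * R1 ^ DIM('a) + weighted_integral c R1 R2 f r"

definition lambda_fun ::
  "real \<Rightarrow> real \<Rightarrow> 'a::euclidean_space \<Rightarrow> real \<Rightarrow> real \<Rightarrow> ('a \<Rightarrow> real) \<Rightarrow> real \<Rightarrow> real \<Rightarrow> real" where
  "lambda_fun p \<epsilon> c R1 R2 f r y =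
     E_inv \<epsilon> p ((G_fun c R1 R2 f r y)\<^sup>2 / r ^ (2 * DIM('a) - 2))"

definition mu_fun ::
  "real \<Rightarrow> real \<Rightarrow> 'a::euclidean_space \<Rightarrow> real \<Rightarrow> real \<Rightarrow> ('a \<Rightarrow> real) \<Rightarrow> real \<Rightarrow> real \<Rightarrow> real" where
  "mu_fun p \<epsilon> c R1 R2 f r y =
     G_fun c R1 R2 f r y / (r ^ (DIM('a) - 1) * lambda_fun p \<epsilon> c R1 R2 f r y)"

definition M_fun ::
  "real \<Rightarrow> real \<Rightarrow> 'a::euclidean_space \<Rightarrow> real \<Rightarrow> real \<Rightarrow> ('a \<Rightarrow> real) \<Rightarrow> real \<Rightarrow> real" where
  "M_fun p \<epsilon> c R1 R2 f y = (LBINT \<rho>=R1..R2. mu_fun p \<epsilon> c R1 R2 f \<rho> y)"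

definition C_const ::
  "real \<Rightarrow> real \<Rightarrow> 'a::euclidean_space \<Rightarrow> real \<Rightarrow> real \<Rightarrow> ('a \<Rightarrow> real) \<Rightarrow> real" where
  "C_const p \<epsilon> c R1 R2 f = (THE C. C > 0 \<and> M_fun p \<epsilon> c R1 R2 f C = 0)"

definition F_fun ::
  "real \<Rightarrow> real \<Rightarrow> 'a::euclidean_space \<Rightarrow> real \<Rightarrow> real \<Rightarrow> ('a \<Rightarrow> real) \<Rightarrow> real \<Rightarrow> real" where
  "F_fun p \<epsilon> c R1 R2 f r =
     Sgn_on (closure (annulus c R1 R2)) f *
       (R1 ^ DIM('a) * C_const p \<epsilon> c R1 R2 f / r ^ DIM('a)) +
     1 / r ^ DIM('a) * weighted_integral c R1 R2 f r"

definition u_bar ::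
  "real \<Rightarrow> real \<Rightarrow> 'a::euclidean_space \<Rightarrow> real \<Rightarrow> real \<Rightarrow> ('a \<Rightarrow> real) \<Rightarrow> real \<Rightarrow> real" where
  "u_bar p \<epsilon> c R1 R2 f r =
     (LBINT \<rho>=R1..r. F_fun p \<epsilon> c R1 R2 f \<rho> * \<rho> /
                       E_inv \<epsilon> p ((F_fun p \<epsilon> c R1 R2 f \<rho>)\<^sup>2 * \<rho>\<^sup>2))"

end

theory Submission
  imports Defs
begin

text \<open>
  Write \<open>\<sigma> \<mapsto> \<sigma> / E\<^sup>-\<^sup>1(\<sigma>\<^sup>2)\<close> for the inverse of the increasing homeomorphism
  \<open>t \<mapsto> (t\<^sup>2 + \<chi> \<epsilon>\<^sup>2)\<^bsup>(p - 2) / 2\<^esup> t\<close> of the real line. It is continuous and strictly increasing, hence so is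
  \<open>Sgn(f) M\<close>, which changes sign on the positive half-line: this gives \<open>C\<close>. The flux of \<open>u\<close> is
  \<open>G(r, C) r\<^sup>-\<^sup>n (x - c)\<close>, whose divergence is \<open>- f\<close>. Since \<open>W\<^sub>0\<^sup>1\<^sup>,\<^sup>p\<close> is by definition the closure of
  the test functions, the weak equation extends to it, and convexity of the energy density in the
  gradient makes \<open>u\<close> minimal. That \<open>u\<close> itself lies in \<open>W\<^sub>0\<^sup>1\<^sup>,\<^sup>p\<close> follows by approximating its
  derivative in the variable \<open>|x - c|\<^sup>2\<close> by smooth functions of mean zero with compact support.
\<close>

section \<open>Smooth functions\<close>

text \<open>\<open>weak_grad\<close> is an arbitrary choice among weak gradients, so the energy of
  \<open>u\<close> can be computed only after weak gradients are known to be unique up to null sets;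
  the fundamental lemma of the calculus of variations is proved for that purpose. Likewise
  \<open>W1p_0\<close> is met only by exhibiting test functions, which is why smoothness of every
  order is built up from polynomials and exp(-1/t). The variable |x - c|^2 keeps these compositions
  smooth. \<open>E_inv\<close> sees only squares, yet it inverts the flux: if \<lambda> = (t^2 +
  \<chi> \<epsilon>^2)^((p - 2) / 2), then E(\<lambda>) = (\<lambda> t)^2. So \<open>E_inv\<close>
  at the squared scalar flux returns the factor \<lambda>, and dividing the flux by it gives back t
  with its sign. Oddness of this inverse reduces Sgn(f) = -1 to the case Sgn(f) = 1 through the
  factor \<open>s\<close>. No compactness argument enters: the candidate is explicit, and it is
  compared with all of \<open>W1p_0\<close>, radial or not.\<close>

lemma Ck_on_SucI:
  assumes "\<And>x. (f has_derivative f' x) (at x)"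
    and "\<And>b. b \<in> Basis \<Longrightarrow> Ck_on k UNIV (\<lambda>x. f' x b)"
  shows "Ck_on (Suc k) UNIV f"
proof -
  have "frechet_derivative f (at x) = f' x" for x
    using frechet_derivative_at[OF assms(1)] by simp
  then show ?thesis
    using assms by (auto simp: differentiable_def)
qed

lemma Ck_on_Suc_has_derivative:
  "Ck_on (Suc k) S f \<Longrightarrow> x \<in> S \<Longrightarrow> (f has_derivative frechet_derivative f (at x)) (at x)"
  by (simp add: frechet_derivative_works)

lemma Ck_on_imp_continuous_on: "Ck_on k S f \<Longrightarrow> continuous_on S f"
  by (cases k)
    (auto intro: continuous_at_imp_continuous_on differentiable_imp_continuous_within)

lemma Ck_on_SucD: "Ck_on (Suc k) S f \<Longrightarrow> Ck_on k S f"
proof (induction k arbitrary: f)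
  case 0
  then show ?case using Ck_on_imp_continuous_on[of "Suc 0"] by auto
next
  case (Suc k)
  have "Ck_on (Suc k) S (\<lambda>x. frechet_derivative f (at x) b)" if "b \<in> Basis" for b
    using Suc.prems that by (subst (asm) Ck_on.simps) blast
  with Suc show ?case by auto
qed

lemma Ck_on_const: "Ck_on k UNIV (\<lambda>x. c)"
proof (induction k arbitrary: c)
  case (Suc k)
  show ?case by (rule Ck_on_SucI[where f' = "\<lambda>x y. 0"]) (auto intro: Suc)
qed simp

lemma Ck_on_bounded_linear:
  assumes "bounded_linear f"
  shows "Ck_on k UNIV f"
proof (cases k)
  case 0
  then show ?thesis using assms by (simp add: linear_continuous_on)
next
  case (Suc k')
  show ?thesis unfolding Suc
    by (rule Ck_on_SucI[where f' = "\<lambda>x. f"])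
      (auto intro: Ck_on_const bounded_linear_imp_has_derivative assms)
qed

lemma Ck_on_add:
  "Ck_on k UNIV f \<Longrightarrow> Ck_on k UNIV g \<Longrightarrow> Ck_on k UNIV (\<lambda>x. f x + g x)"
proof (induction k arbitrary: f g)
  case 0
  then show ?case by (auto intro: continuous_intros)
next
  case (Suc k)
  show ?case
    by (rule Ck_on_SucI[OF has_derivative_add[OF
          Ck_on_Suc_has_derivative[OF Suc.prems(1)] Ck_on_Suc_has_derivative[OF Suc.prems(2)]]])
      (use Suc in auto)
qed

text \<open>The product rule leaves one factor undifferentiated in each term, so the factors must
  first be lowered by one order with \<open>Ck_on_SucD\<close> before the induction hypothesis
  applies.\<close>

lemma Ck_on_mult:
  fixes f g :: "'a::euclidean_space \<Rightarrow> real"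
  shows "Ck_on k UNIV f \<Longrightarrow> Ck_on k UNIV g \<Longrightarrow> Ck_on k UNIV (\<lambda>x. f x * g x)"
proof (induction k arbitrary: f g)
  case 0
  then show ?case by (auto intro: continuous_intros)
next
  case (Suc k)
  show ?case
    by (rule Ck_on_SucI[OF has_derivative_mult[OF
          Ck_on_Suc_has_derivative[OF Suc.prems(1)] Ck_on_Suc_has_derivative[OF Suc.prems(2)]]])
      (use Suc.prems Ck_on_SucD[OF Suc.prems(1)] Ck_on_SucD[OF Suc.prems(2)] 
        in \<open>auto intro!: Ck_on_add Suc.IH\<close>)
qed

lemma Ck_on_cmult:
  fixes f :: "'a::euclidean_space \<Rightarrow> real"
  shows "Ck_on k UNIV f \<Longrightarrow> Ck_on k UNIV (\<lambda>x. c * f x)"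
  by (intro Ck_on_mult Ck_on_const)

lemma Ck_on_diff:
  fixes f :: "'a::euclidean_space \<Rightarrow> real"
  assumes "Ck_on k UNIV f" "Ck_on k UNIV g"
  shows "Ck_on k UNIV (\<lambda>x. f x - g x)"
  using Ck_on_add[OF assms(1) Ck_on_cmult[OF assms(2), of "-1"]] by simp

lemma Ck_on_sum:
  "(\<And>i. i \<in> I \<Longrightarrow> Ck_on k UNIV (f i)) \<Longrightarrow> Ck_on k UNIV (\<lambda>x. \<Sum>i\<in>I. f i x)"
  by (induction I rule: infinite_finite_induct) (auto intro: Ck_on_add Ck_on_const)

lemma Ck_on_prod:
  fixes f :: "'i \<Rightarrow> 'a::euclidean_space \<Rightarrow> real"
  shows "(\<And>i. i \<in> I \<Longrightarrow> Ck_on k UNIV (f i)) \<Longrightarrow> Ck_on k UNIV (\<lambda>x. \<Prod>i\<in>I. f i x)"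
  by (induction I rule: infinite_finite_induct) (auto intro: Ck_on_mult Ck_on_const)

lemma Ck_on_compose_real:
  fixes f :: "real \<Rightarrow> real" and g :: "'a::euclidean_space \<Rightarrow> real"
  shows "Ck_on k UNIV f \<Longrightarrow> Ck_on k UNIV g \<Longrightarrow> Ck_on k UNIV (\<lambda>x. f (g x))"
proof (induction k arbitrary: f g)
  case 0
  then show ?case by (auto intro: continuous_on_compose2)
next
  case (Suc k)
  let ?f' = "\<lambda>t. frechet_derivative f (at t) 1"
  \<comment> \<open>The derivative of a function of one real variable is multiplication by a number.
    This turns the chain rule into a product, which the induction hypothesis and
    \<open>Ck_on_mult\<close> can handle.\<close>
  have scale: "frechet_derivative f (at t) h = ?f' t * h" for t h
    using linear_scale[OF has_derivative_linear[OF Ck_on_Suc_has_derivative[OF Suc.prems(1)]], of t h 1]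
    by simp
  have "Ck_on k UNIV (\<lambda>x. frechet_derivative f (at (g x)) (frechet_derivative g (at x) b))"
    if "b \<in> Basis" for b
  proof -
    have "Ck_on k UNIV (\<lambda>x. ?f' (g x) * frechet_derivative g (at x) b)"
      using Suc.prems that
      by (intro Ck_on_mult[OF Suc.IH[OF _ Ck_on_SucD[OF Suc.prems(2)]]]) auto
    then show ?thesis by (subst scale)
  qed
  moreover have "((\<lambda>x. f (g x)) has_derivative
      (\<lambda>h. frechet_derivative f (at (g x)) (frechet_derivative g (at x) h))) (at x)" for x
    using has_derivative_compose[OF Ck_on_Suc_has_derivative[OF Suc.prems(2)]
        Ck_on_Suc_has_derivative[OF Suc.prems(1)]] by simp
  ultimately show ?case
    by (intro Ck_on_SucI[where f' = "\<lambda>x h. frechet_derivative f (at (g x)) (frechet_derivative g (at x) h)"])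
qed

lemma Ck_on_real_SucI:
  fixes f :: "real \<Rightarrow> real"
  assumes "\<And>t. (f has_real_derivative f' t) (at t)" "Ck_on k UNIV f'"
  shows "Ck_on (Suc k) UNIV f"
  by (rule Ck_on_SucI[where f' = "\<lambda>t h. f' t * h"])
    (use assms in \<open>auto simp: has_field_derivative_def\<close>)

lemma Ck_on_norm_square: "Ck_on k UNIV (\<lambda>x::'a::euclidean_space. (norm (x - c))\<^sup>2)"
proof -
  have "Ck_on k UNIV (\<lambda>x::'a. (\<Sum>b\<in>Basis. (x \<bullet> b - c \<bullet> b) * (x \<bullet> b - c \<bullet> b)))"
    by (intro Ck_on_sum Ck_on_mult Ck_on_diff Ck_on_const Ck_on_bounded_linear
        bounded_linear_inner_left)
  also have "(\<lambda>x::'a. (\<Sum>b\<in>Basis. (x \<bullet> b - c \<bullet> b) * (x \<bullet> b - c \<bullet> b))) = (\<lambda>x. (norm (x - c))\<^sup>2)"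
    by (rule ext) (subst power2_norm_eq_inner, subst euclidean_inner, simp add: inner_diff_left)
  finally show ?thesis .
qed

lemma Ck_on_real_polynomial_function:
  fixes q :: "real \<Rightarrow> real"
  assumes "real_polynomial_function q"
  shows "Ck_on k UNIV q"
  using assms
  by (induction rule: real_polynomial_function.induct)
    (auto intro: Ck_on_bounded_linear Ck_on_const Ck_on_add Ck_on_mult)

section \<open>The smooth function exp(-1/t) and its rescalings\<close>

text \<open>For \<open>m = 0\<close> this is the classical smooth function that is not analytic at
  0. The negative powers of t are included because differentiation then leads only to linear
  combinations of members of the same family.\<close>

definition flat :: "nat \<Rightarrow> real \<Rightarrow> real" where
  "flat m t = (if t > 0 then exp (- 1 / t) / t ^ m else 0)"

text \<open>The substitution s = 1/t turns the right-hand limit into s^m / exp s at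
  infinity.\<close>

lemma flat_tendsto_0: "(flat m \<longlongrightarrow> 0) (at 0)"
proof -
  have "((\<lambda>s::real. s ^ m / exp s) \<longlongrightarrow> 0) at_top"
    by (rule tendsto_power_div_exp_0)
  then have "((\<lambda>t. (1 / t) ^ m / exp (1 / t)) \<longlongrightarrow> (0::real)) (at_right 0)"
    by (rule filterlim_compose) (simp add: filterlim_inverse_at_top_right flip: inverse_eq_divide)
  then have "(flat m \<longlongrightarrow> 0) (at_right 0)"
    by (rule Lim_transform_eventually)
      (auto simp: eventually_at_filter flat_def exp_minus field_simps power_divide)
  moreover have "(flat m \<longlongrightarrow> 0) (at_left 0)"
    by (rule Lim_transform_eventually[OF tendsto_const]) (auto simp: eventually_at_filter flat_def)
  ultimately show ?thesis by (rule filterlim_split_at[rotated])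
qed

lemma flat_has_real_derivative:
  "(flat m has_real_derivative (flat (m + 2) t - m * flat (m + 1) t)) (at t)"
proof -
  consider "t > 0" | "t = 0" | "t < 0" by linarith
  then show ?thesis
  proof cases
    case 1
    have "((\<lambda>t. exp (- 1 / t) / t ^ m) has_real_derivative
        (flat (m + 2) t - m * flat (m + 1) t)) (at t)"
    proof (cases m)
      case (Suc l)
      have "((\<lambda>t. exp (- 1 / t) / t ^ m) has_real_derivative
          (exp (- 1 / t) * (1 / (t * t)) * t ^ m - exp (- 1 / t) * (m * t ^ l)) / (t ^ m * t ^ m)) (at t)"
        using 1 unfolding Suc
        by (auto intro!: derivative_eq_intros simp: field_simps power2_eq_square simp del: power_Suc)
      also have "(exp (- 1 / t) * (1 / (t * t)) * t ^ m - exp (- 1 / t) * (m * t ^ l)) / (t ^ m * t ^ m)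
          = flat (m + 2) t - m * flat (m + 1) t"
        using 1 unfolding Suc by (simp add: flat_def field_simps)
      finally show ?thesis .
    qed (use 1 in \<open>auto intro!: derivative_eq_intros simp: flat_def field_simps power2_eq_square\<close>)
    then show ?thesis
      by (rule has_field_derivative_transform_within_open[of _ _ _ "{0<..}"])
        (use 1 in \<open>auto simp: flat_def\<close>)
  next
    case 2
    \<comment> \<open>The difference quotient of \<open>flat m\<close> at 0 is
      \<open>flat (Suc m)\<close>, so its limit is already known.\<close>
    have "((\<lambda>s. (flat m (0 + s) - flat m 0) / s) \<longlongrightarrow> 0) (at 0)"
      by (rule Lim_transform_eventually[OF flat_tendsto_0[of "Suc m"]])
        (auto simp: eventually_at_filter flat_def)
    then show ?thesis using 2 by (simp add: DERIV_def) (simp add: flat_def)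
  next
    case 3
    have "((\<lambda>t. 0) has_real_derivative (flat (m + 2) t - m * flat (m + 1) t)) (at t)"
      using 3 by (simp add: flat_def)
    then show ?thesis
      by (rule has_field_derivative_transform_within_open[of _ _ _ "{..<0}"])
        (use 3 in \<open>auto simp: flat_def\<close>)
  qed
qed

lemma Ck_on_flat: "Ck_on k UNIV (flat m)"
proof (induction k arbitrary: m)
  case 0
  show ?case
    using flat_has_real_derivative DERIV_isCont continuous_at_imp_continuous_on by (metis Ck_on.simps(1))
next
  case (Suc k)
  show ?case
    by (rule Ck_on_real_SucI[OF flat_has_real_derivative]) (intro Ck_on_diff Ck_on_cmult Suc)
qed

lemma flat_0_bounds: "0 \<le> flat 0 t" "flat 0 t \<le> 1"
  by (auto simp: flat_def)

lemma flat_0_eq_0: "t \<le> 0 \<Longrightarrow> flat 0 t = 0"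
  and flat_0_pos: "t > 0 \<Longrightarrow> flat 0 t > 0"
  by (auto simp: flat_def)

text \<open>Rescaling produces smooth approximations of the indicator of the positive half-line. The
  offset \<open>d = 1\<close> will keep supports away from an endpoint, while \<open>d = 0\<close>
  serves for open boxes.\<close>

lemma flat_0_scaled_tendsto:
  assumes "t > 0"
  shows "(\<lambda>k. flat 0 (real k * t - d)) \<longlonglongrightarrow> 1"
proof -
  have lim: "filterlim (\<lambda>k. real k * t - d) at_top sequentially"
    using filterlim_tendsto_add_at_top[OF tendsto_const[of "- d"]
        filterlim_at_top_mult_tendsto_pos[OF tendsto_const assms filterlim_real_sequentially]]
    by simp
  have "((\<lambda>s. exp (- 1 / s)) \<longlongrightarrow> 1) (at_top :: real filter)"
    using tendsto_exp[OF tendsto_minus[OF tendsto_inverse_0_at_top[OF filterlim_ident]]]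
    by (simp add: inverse_eq_divide)
  from filterlim_compose[OF this lim]
  have "(\<lambda>k. exp (- 1 / (real k * t - d))) \<longlonglongrightarrow> 1" .
  moreover have "eventually (\<lambda>k. real k * t - d > 0) sequentially"
    using lim unfolding filterlim_at_top_dense by blast
  then have "eventually (\<lambda>k. exp (- 1 / (real k * t - d)) = flat 0 (real k * t - d)) sequentially"
    by (rule eventually_mono) (simp add: flat_def)
  ultimately show ?thesis
    by (rule Lim_transform_eventually)
qed

section \<open>Integration by parts\<close>

lemma grad_inner: "b \<in> Basis \<Longrightarrow> grad u x \<bullet> b = frechet_derivative u (at x) b"
  by (simp add: grad_def inner_sum_left inner_Basis if_distrib cong: if_cong)

lemma test_function_smooth: "\<phi> \<in> test_functions \<Omega> \<Longrightarrow> Ck_on k UNIV \<phi>"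
  by (simp add: test_functions_def)

lemma test_function_has_derivative:
  "\<phi> \<in> test_functions \<Omega> \<Longrightarrow> (\<phi> has_derivative frechet_derivative \<phi> (at x)) (at x)"
  using Ck_on_Suc_has_derivative test_function_smooth by blast

lemma test_function_continuous_on: "\<phi> \<in> test_functions \<Omega> \<Longrightarrow> continuous_on S \<phi>"
  using Ck_on_imp_continuous_on continuous_on_subset test_function_smooth subset_UNIV by metis

lemma test_function_grad_continuous_on:
  assumes "\<phi> \<in> test_functions \<Omega>"
  shows "continuous_on S (grad \<phi>)"
proof -
  have "continuous_on UNIV (\<lambda>x. frechet_derivative \<phi> (at x) b)" if "b \<in> Basis" for b
    using test_function_smooth[OF assms, of "Suc 0"] that by simp
  then have "continuous_on UNIV (grad \<phi>)"
    unfolding grad_def by (intro continuous_intros) auto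
  then show ?thesis using continuous_on_subset by blast
qed

lemma test_function_support:
  assumes "\<phi> \<in> test_functions \<Omega>"
  obtains K where "compact K" "K \<subseteq> \<Omega>" "\<And>x. x \<notin> K \<Longrightarrow> \<phi> x = 0" "\<And>x. x \<notin> K \<Longrightarrow> grad \<phi> x = 0"
    "\<And>x. x \<notin> K \<Longrightarrow> frechet_derivative \<phi> (at x) = (\<lambda>h. 0)"
proof
  define K where "K = closure {x. \<phi> x \<noteq> 0}"
  show K: "compact K" "K \<subseteq> \<Omega>" using assms by (auto simp: test_functions_def K_def)
  show 0: "\<phi> x = 0" if "x \<notin> K" for x
    using that closure_subset[of "{x. \<phi> x \<noteq> 0}"] unfolding K_def by blast
  show *: "frechet_derivative \<phi> (at x) = (\<lambda>h. 0)" if "x \<notin> K" for x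
  proof -
    have "(\<phi> has_derivative (\<lambda>h. 0)) (at x)"
    proof (rule has_derivative_transform_within_open[of "\<lambda>x. 0" _ _ _ "- K"])
      show "open (- K)" using K(1) compact_imp_closed by blast
    qed (use that 0 in \<open>auto\<close>)
    from frechet_derivative_at[OF this] show ?thesis by simp
  qed
  then show "grad \<phi> x = 0" if "x \<notin> K" for x
    using that by (simp add: grad_def)
qed

text \<open>The extension by zero is continuous because it is so on each of the open sets
  \<open>\<Omega>\<close> and \<open>- K\<close>, which cover the space. Passing to
  \<open>lborel\<close> makes translation invariance available.\<close>

lemma compact_support_integrable:
  fixes g :: "'a::euclidean_space \<Rightarrow> real"
  assumes "open \<Omega>" "compact K" "K \<subseteq> \<Omega>" "continuous_on \<Omega> g" "\<forall>x\<in>\<Omega> - K. g x = 0"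
  defines "g0 \<equiv> \<lambda>x. if x \<in> \<Omega> then g x else 0"
  shows "continuous_on UNIV g0" "integrable lborel g0" "integrable (lebesgue_on \<Omega>) g"
    "(LINT x|lebesgue_on \<Omega>. g x) = integral\<^sup>L lborel g0"
proof -
  have [measurable]: "\<Omega> \<in> sets lebesgue" using assms(1) by auto
  have "continuous_on \<Omega> g0" using assms(4) by (simp add: g0_def cong: continuous_on_cong)
  moreover have "continuous_on (- K) g0"
    using assms(5) by (subst continuous_on_cong[OF refl, of _ _ "\<lambda>x. 0"]) (auto simp: g0_def)
  ultimately have "continuous_on (\<Omega> \<union> - K) g0"
    using assms(1,2) by (intro continuous_on_open_Un) (auto simp: compact_imp_closed)
  moreover have "\<Omega> \<union> - K = UNIV" using assms(3) by auto
  ultimately show cont: "continuous_on UNIV g0" by simp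
  have "integrable lborel (\<lambda>x. indicator K x *\<^sub>R g0 x)"
    by (rule borel_integrable_compact[OF assms(2) continuous_on_subset[OF cont]]) simp
  also have "(\<lambda>x. indicator K x *\<^sub>R g0 x) = g0"
    using assms(5) by (auto simp: g0_def indicator_def fun_eq_iff)
  finally show int: "integrable lborel g0" .
  then have "integrable lebesgue g0"
    by (simp add: integrable_completion)
  then show "integrable (lebesgue_on \<Omega>) g"
    by (simp add: g0_def Lebesgue_Measure.integrable_restrict_UNIV)
  have "(LINT x|lebesgue_on \<Omega>. g x) = integral\<^sup>L lebesgue g0"
    unfolding g0_def using Lebesgue_Measure.integral_restrict_UNIV[of \<Omega> g] by simp
  also have "\<dots> = integral\<^sup>L lborel g0"
    using int by (simp add: integral_completion)
  finally show "(LINT x|lebesgue_on \<Omega>. g x) = integral\<^sup>L lborel g0" .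
qed

text \<open>By translation invariance every difference quotient of \<open>w\<close> has integral zero.\<close>

lemma integral_directional_derivative_eq_0:
  fixes w w' :: "'a::euclidean_space \<Rightarrow> real"
  assumes der: "\<And>x. ((\<lambda>t. w (x + t *\<^sub>R b)) has_real_derivative w' x) (at 0)"
    and cont: "continuous_on UNIV w"
    and supp: "compact K" "\<And>x. x \<notin> K \<Longrightarrow> w x = 0"
    and bound: "\<And>x. \<bar>w' x\<bar> \<le> B"
  shows "integral\<^sup>L lborel w' = 0"
proof -
  define h :: "nat \<Rightarrow> real" where "h n = 1 / real (Suc n)" for n
  have h: "0 < h n" "h n \<le> 1" for n by (auto simp: h_def)
  have h0: "h \<longlonglongrightarrow> 0" unfolding h_def using LIMSEQ_inverse_real_of_nat by (simp add: inverse_eq_divide)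
  define q where "q n x = (w (h n *\<^sub>R b + x) - w x) / h n" for n x
  obtain R where R: "\<And>x. x \<in> K \<Longrightarrow> norm x \<le> R"
    using compact_imp_bounded[OF supp(1)] by (auto simp: bounded_iff)
  have w_int: "integrable lborel w"
  proof -
    have "integrable lborel (\<lambda>x. indicator K x *\<^sub>R w x)"
      by (rule borel_integrable_compact[OF supp(1) continuous_on_subset[OF cont]]) simp
    also have "(\<lambda>x. indicator K x *\<^sub>R w x) = w"
      using supp(2) by (auto simp: indicator_def fun_eq_iff)
    finally show ?thesis .
  qed
  have [measurable]: "w \<in> borel_measurable borel" by (rule borel_measurable_continuous_onI[OF cont])
  have w_shift: "integrable lborel (\<lambda>x. w (v + x))" "(LINT x|lborel. w (v + x)) = integral\<^sup>L lborel w" for v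
  proof -
    show "integrable lborel (\<lambda>x. w (v + x))"
      using w_int by (subst (asm) lborel_distr_plus[of v, symmetric]) (simp add: integrable_distr_eq)
    show "(LINT x|lborel. w (v + x)) = integral\<^sup>L lborel w"
      by (subst (2) lborel_distr_plus[of v, symmetric]) (simp add: integral_distr)
  qed
  have q0: "integral\<^sup>L lborel (q n) = 0" for n
    unfolding q_def using w_int w_shift by (simp add: Bochner_Integration.integral_diff)
  have q_lim: "(\<lambda>n. q n x) \<longlonglongrightarrow> w' x" for x
  proof -
    have "((\<lambda>t. (w (x + (0 + t) *\<^sub>R b) - w (x + 0 *\<^sub>R b)) / t) \<longlongrightarrow> w' x) (at 0)"
      using der[of x] by (simp add: DERIV_def)
    moreover have "filterlim h (at 0) sequentially"
      using h0 h(1)[THEN less_imp_neq] by (simp add: filterlim_at)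
    ultimately have "(\<lambda>n. (w (x + (0 + h n) *\<^sub>R b) - w (x + 0 *\<^sub>R b)) / h n) \<longlonglongrightarrow> w' x"
      by (rule filterlim_compose)
    then show ?thesis by (simp add: q_def add.commute)
  qed
  \<comment> \<open>By the mean value theorem each quotient is a value of \<open>w'\<close>, so
    \<open>B\<close> bounds all of them at once.\<close>
  have q_bound: "\<bar>q n x\<bar> \<le> B" for n x
  proof -
    have der': "((\<lambda>t. w (x + t *\<^sub>R b)) has_real_derivative w' (x + t *\<^sub>R b)) (at t)" for t
    proof -
      have "((\<lambda>s. w ((x + t *\<^sub>R b) + (s - t) *\<^sub>R b)) has_real_derivative w' (x + t *\<^sub>R b) * 1) (at t)"
        using der[of "x + t *\<^sub>R b"]
        by (intro DERIV_chain2[where g = "\<lambda>s. s - t"]) (auto intro!: derivative_eq_intros)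
      then show ?thesis by (simp add: algebra_simps)
    qed
    obtain z where "w (x + h n *\<^sub>R b) - w (x + 0 *\<^sub>R b) = (h n - 0) * w' (x + z *\<^sub>R b)"
      using MVT2[of 0 "h n" "\<lambda>t. w (x + t *\<^sub>R b)" "\<lambda>t. w' (x + t *\<^sub>R b)"] h(1)[of n] der' by blast
    then have "q n x = w' (x + z *\<^sub>R b)" using h(1)[of n] by (simp add: q_def add.commute)
    then show ?thesis using bound by simp
  qed
  \<comment> \<open>Since h n \<le> 1, a shift moves points by at most \<open>norm b\<close>. All
    quotients therefore vanish off one fixed ball, and \<open>B\<close> times its indicator is an
    integrable majorant.\<close>
  have q_supp: "q n x = 0" if "x \<notin> cball 0 (R + norm b)" for n x
  proof -
    have "R + norm b < norm x" using that by simp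
    moreover have "norm x \<le> norm (h n *\<^sub>R b + x) + norm (h n *\<^sub>R b)"
      by (metis add_diff_cancel_left' norm_triangle_ineq4 add.commute)
    moreover have "norm (h n *\<^sub>R b) \<le> norm b" using h[of n] by (simp add: mult_left_le_one_le)
    ultimately have "R < norm x" "R < norm (h n *\<^sub>R b + x)"
      using norm_ge_zero[of b] by linarith+
    then have "x \<notin> K" "h n *\<^sub>R b + x \<notin> K" using R leD by blast+
    then show ?thesis using supp(2) by (simp add: q_def)
  qed
  have q_meas [measurable]: "q n \<in> borel_measurable borel" for n unfolding q_def by measurable
  have "(\<lambda>n. integral\<^sup>L lborel (q n)) \<longlonglongrightarrow> integral\<^sup>L lborel w'"
  proof (rule integral_dominated_convergence)
    show "integrable lborel (\<lambda>x. indicator (cball 0 (R + norm b)) x *\<^sub>R B)"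
      by (rule borel_integrable_compact[OF compact_cball continuous_on_const])
    show "AE x in lborel. norm (q n x) \<le> indicator (cball 0 (R + norm b)) x *\<^sub>R B" for n
      using q_bound q_supp by (auto simp: indicator_def)
    show "w' \<in> borel_measurable lborel"
      by (rule borel_measurable_LIMSEQ_real[where u = q]) (use q_lim q_meas in auto)
  qed (use q_lim in auto)
  then show ?thesis using q0 by (simp add: LIMSEQ_const_iff)
qed

text \<open>The two integrands add up to the derivative of u \<phi> in direction b. Extended by
  zero, u \<phi> has compact support, so this derivative has integral zero.\<close>

lemma integral_by_parts_test_function:
  fixes u \<phi> :: "'a::euclidean_space \<Rightarrow> real"
  assumes \<Omega>: "open \<Omega>" and \<phi>: "\<phi> \<in> test_functions \<Omega>" and b: "b \<in> Basis"
    and u: "\<And>x. x \<in> \<Omega> \<Longrightarrow> u differentiable (at x)"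
      "continuous_on \<Omega> (\<lambda>x. frechet_derivative u (at x) b)"
  shows "(LINT x|lebesgue_on \<Omega>. u x * (grad \<phi> x \<bullet> b)) =
      - (LINT x|lebesgue_on \<Omega>. frechet_derivative u (at x) b * \<phi> x)"
    and "integrable (lebesgue_on \<Omega>) (\<lambda>x. u x * (grad \<phi> x \<bullet> b))"
    and "integrable (lebesgue_on \<Omega>) (\<lambda>x. frechet_derivative u (at x) b * \<phi> x)"
proof -
  obtain K where K: "compact K" "K \<subseteq> \<Omega>" "\<And>x. x \<notin> K \<Longrightarrow> \<phi> x = 0" "\<And>x. x \<notin> K \<Longrightarrow> grad \<phi> x = 0"
    "\<And>x. x \<notin> K \<Longrightarrow> frechet_derivative \<phi> (at x) = (\<lambda>h. 0)"
    using test_function_support[OF \<phi>] by blast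
  have u_cont: "continuous_on \<Omega> u"
    using u(1) by (intro continuous_at_imp_continuous_on ballI differentiable_imp_continuous_within)
  note \<phi>_cont = test_function_continuous_on[OF \<phi>] test_function_grad_continuous_on[OF \<phi>]
  define w where "w x = (if x \<in> \<Omega> then u x * \<phi> x else 0)" for x
  define w1 where "w1 x = (if x \<in> \<Omega> then u x * (grad \<phi> x \<bullet> b) else 0)" for x
  define w2 where "w2 x = (if x \<in> \<Omega> then frechet_derivative u (at x) b * \<phi> x else 0)" for x
  have cont1: "continuous_on \<Omega> (\<lambda>x. u x * (grad \<phi> x \<bullet> b))"
    and cont2: "continuous_on \<Omega> (\<lambda>x. frechet_derivative u (at x) b * \<phi> x)"
    and cont0: "continuous_on \<Omega> (\<lambda>x. u x * \<phi> x)"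
    by (intro continuous_intros u_cont u(2) \<phi>_cont)+
  have zero: "\<forall>x\<in>\<Omega> - K. u x * (grad \<phi> x \<bullet> b) = 0"
    "\<forall>x\<in>\<Omega> - K. frechet_derivative u (at x) b * \<phi> x = 0" "\<forall>x\<in>\<Omega> - K. u x * \<phi> x = 0"
    using K(3,4) by auto
  note int1 = compact_support_integrable[OF \<Omega> K(1,2) cont1 zero(1), folded w1_def]
  note int2 = compact_support_integrable[OF \<Omega> K(1,2) cont2 zero(2), folded w2_def]
  note int0 = compact_support_integrable[OF \<Omega> K(1,2) cont0 zero(3), folded w_def]
  show "integrable (lebesgue_on \<Omega>) (\<lambda>x. u x * (grad \<phi> x \<bullet> b))" by (fact int1(3))
  show "integrable (lebesgue_on \<Omega>) (\<lambda>x. frechet_derivative u (at x) b * \<phi> x)" by (fact int2(3))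
  have cont12: "continuous_on UNIV (\<lambda>x. w1 x + w2 x)"
    by (intro continuous_intros int1(1) int2(1))
  have supp12: "w1 x + w2 x = 0" if "x \<notin> K" for x
    using that K by (simp add: w1_def w2_def)
  have "bounded ((\<lambda>x. w1 x + w2 x) ` K)"
    by (intro compact_imp_bounded compact_continuous_image K continuous_on_subset[OF cont12]) simp
  then obtain B where B: "\<And>x. x \<in> K \<Longrightarrow> \<bar>w1 x + w2 x\<bar> \<le> B" by (auto simp: bounded_iff)
  have "integral\<^sup>L lborel (\<lambda>x. w1 x + w2 x) = 0"
  \<comment> \<open>\<open>max B 0\<close> instead of \<open>B\<close>: off \<open>K\<close> the sum
    is 0, and for empty \<open>K\<close> nothing forces \<open>B\<close> to be nonnegative.\<close>
  proof (rule integral_directional_derivative_eq_0[where w = w and b = b and K = K and B = "max B 0"])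
    fix x
    have "(w has_derivative (\<lambda>h. if x \<in> \<Omega> then u x * frechet_derivative \<phi> (at x) h +
        frechet_derivative u (at x) h * \<phi> x else 0)) (at x)"
    proof (cases "x \<in> \<Omega>")
      case True
      have "((\<lambda>x. u x * \<phi> x) has_derivative (\<lambda>h. u x * frechet_derivative \<phi> (at x) h +
        frechet_derivative u (at x) h * \<phi> x)) (at x)"
        by (intro has_derivative_mult test_function_has_derivative[OF \<phi>])
          (use u(1) True in \<open>simp add: frechet_derivative_works\<close>)
      then have "(w has_derivative (\<lambda>h. u x * frechet_derivative \<phi> (at x) h +
        frechet_derivative u (at x) h * \<phi> x)) (at x)"
        by (rule has_derivative_transform_within_open[OF _ \<Omega> True]) (simp add: w_def)
      then show ?thesis using True by simp
    next
      case False
      have "(w has_derivative (\<lambda>h. 0)) (at x)"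
        by (rule has_derivative_transform_within_open[of "\<lambda>x. 0" _ _ _ "- K"])
          (use False K in \<open>auto simp: compact_imp_closed w_def\<close>)
      then show ?thesis using False by simp
    qed
    then have wd: "(w has_derivative (\<lambda>h. if x \<in> \<Omega> then u x * frechet_derivative \<phi> (at x) h +
        frechet_derivative u (at x) h * \<phi> x else 0)) (at (x + 0 *\<^sub>R b))" by simp
    have "((\<lambda>t. x + t *\<^sub>R b) has_derivative (\<lambda>t. t *\<^sub>R b)) (at 0)"
      by (auto intro!: derivative_eq_intros)
    from has_derivative_compose[OF this wd]
    have d: "((\<lambda>t. w (x + t *\<^sub>R b)) has_derivative (\<lambda>t. if x \<in> \<Omega> then u x * frechet_derivative \<phi> (at x) (t *\<^sub>R b) +
        frechet_derivative u (at x) (t *\<^sub>R b) * \<phi> x else 0)) (at 0)" .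
    have l1: "frechet_derivative \<phi> (at x) (t *\<^sub>R b) = t * (grad \<phi> x \<bullet> b)" for t
      using linear_scale[OF has_derivative_linear[OF test_function_has_derivative[OF \<phi>]]] grad_inner[OF b]
      by simp
    have l2: "frechet_derivative u (at x) (t *\<^sub>R b) = t * frechet_derivative u (at x) b" if "x \<in> \<Omega>" for t
      using linear_scale[OF linear_frechet_derivative[OF u(1)[OF that]]] by simp
    have "(\<lambda>t. if x \<in> \<Omega> then u x * frechet_derivative \<phi> (at x) (t *\<^sub>R b) +
        frechet_derivative u (at x) (t *\<^sub>R b) * \<phi> x else 0) = (*) (w1 x + w2 x)"
      by (auto simp: fun_eq_iff l1 l2 w1_def w2_def algebra_simps)
    with d show "((\<lambda>t. w (x + t *\<^sub>R b)) has_real_derivative w1 x + w2 x) (at 0)"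
      by (simp add: has_field_derivative_def)
  next
    show "continuous_on UNIV w" by (fact int0(1))
    show "\<bar>w1 x + w2 x\<bar> \<le> max B 0" for x
      using B[of x] supp12[of x] by (cases "x \<in> K") auto
  qed (use K in \<open>auto simp: w_def\<close>)
  then show "(LINT x|lebesgue_on \<Omega>. u x * (grad \<phi> x \<bullet> b)) =
      - (LINT x|lebesgue_on \<Omega>. frechet_derivative u (at x) b * \<phi> x)"
    unfolding int1(4) int2(4) Bochner_Integration.integral_add[OF int1(2) int2(2)] by simp
qed

section \<open>Uniqueness of weak gradients\<close>

text \<open>A product of one-dimensional transitions that vanishes off the open box and tends to its
  indicator as \<open>k\<close> grows.\<close>

definition box_bump :: "'a::euclidean_space \<Rightarrow> 'a \<Rightarrow> real \<Rightarrow> 'a \<Rightarrow> real" where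
  "box_bump a b k x = (\<Prod>i\<in>Basis. flat 0 (k * (x \<bullet> i - a \<bullet> i)) * flat 0 (k * (b \<bullet> i - x \<bullet> i)))"

lemma box_bump_eq_0:
  assumes "k > 0" "x \<notin> box a b"
  shows "box_bump a b k x = 0"
proof -
  obtain i where "i \<in> Basis" "x \<bullet> i \<le> a \<bullet> i \<or> b \<bullet> i \<le> x \<bullet> i"
    using assms(2) by (auto simp: mem_box not_less)
  then show ?thesis
    using assms(1) unfolding box_bump_def
    by (intro prod_zero) (auto intro!: bexI[of _ i] flat_0_eq_0 simp: mult_le_0_iff)
qed

lemma box_bump_bounds: "0 \<le> box_bump a b k x" "box_bump a b k x \<le> 1"
  unfolding box_bump_def
  by (auto intro!: prod_nonneg prod_le_1 mult_nonneg_nonneg mult_le_one flat_0_bounds)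

lemma box_bump_tendsto: "(\<lambda>k. box_bump a b (real (Suc k)) x) \<longlonglongrightarrow> indicator (box a b) x"
proof (cases "x \<in> box a b")
  case True
  have "(\<lambda>k. box_bump a b (real k) x) \<longlonglongrightarrow> (\<Prod>i\<in>(Basis::'a set). 1 * 1)"
    unfolding box_bump_def
    by (intro tendsto_prod tendsto_mult)
      (use True flat_0_scaled_tendsto[of _ 0] in \<open>auto simp: mem_box\<close>)
  then show ?thesis using True LIMSEQ_Suc by fastforce
next
  case False
  have "box_bump a b (real (Suc k)) x = 0" for k
    by (rule box_bump_eq_0[OF _ False]) simp
  then show ?thesis using False by simp
qed

lemma box_bump_test_function:
  assumes "k > 0" "cbox a b \<subseteq> \<Omega>"
  shows "box_bump a b k \<in> test_functions \<Omega>"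
proof -
  have "Ck_on m UNIV (box_bump a b k)" for m
    unfolding box_bump_def
    by (intro Ck_on_prod Ck_on_mult Ck_on_compose_real[OF Ck_on_flat] Ck_on_diff Ck_on_const
        Ck_on_bounded_linear bounded_linear_inner_left)
  moreover have sub: "closure {x. box_bump a b k x \<noteq> 0} \<subseteq> cbox a b"
  proof (rule closure_minimal)
    show "{x. box_bump a b k x \<noteq> 0} \<subseteq> cbox a b"
      using box_bump_eq_0[OF assms(1)] box_subset_cbox by blast
  qed (rule closed_cbox)
  moreover have "compact (closure {x. box_bump a b k x \<noteq> 0})"
    using sub bounded_subset[OF bounded_cbox] compact_eq_bounded_closed closed_closure by blast
  ultimately show ?thesis using assms(2) by (auto simp: test_functions_def)
qed

text \<open>Box bumps are admissible and tend to the indicator of the open box, with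
  \<open>\<bar>d x\<bar>\<close> as majorant of the products. The boundary of the box is a null
  set.\<close>

lemma integral_cbox_eq_0_if_weakly_zero:
  fixes d :: "'a::euclidean_space \<Rightarrow> real"
  assumes \<Omega>: "open \<Omega>" "cbox a b \<subseteq> \<Omega>" and d: "d absolutely_integrable_on cbox a b"
    and zero: "\<And>\<phi>. \<phi> \<in> test_functions \<Omega> \<Longrightarrow> (LINT x|lebesgue_on \<Omega>. d x * \<phi> x) = 0"
  shows "integral (cbox a b) d = 0"
proof -
  define \<phi> where "\<phi> k = box_bump a b (real (Suc k))" for k
  have test: "\<phi> k \<in> test_functions \<Omega>" for k
    unfolding \<phi>_def by (rule box_bump_test_function) (use \<Omega> in auto)
  have int: "integrable (lebesgue_on (cbox a b)) d"
    using d by (simp add: absolutely_integrable_on_def integrable_restrict_space set_integrable_def)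
  have "(LINT x|lebesgue_on (cbox a b). d x * \<phi> k x) = 0" for k
  proof -
    have "(LINT x|lebesgue_on (cbox a b). d x * \<phi> k x) =
        integral\<^sup>L lebesgue (\<lambda>x. if x \<in> cbox a b then d x * \<phi> k x else 0)"
      by (rule Lebesgue_Measure.integral_restrict_UNIV[symmetric]) auto
    also have "(\<lambda>x. if x \<in> cbox a b then d x * \<phi> k x else 0) = (\<lambda>x. if x \<in> \<Omega> then d x * \<phi> k x else 0)"
      using \<Omega>(2) box_bump_eq_0[of "real (Suc k)" _ a b] box_subset_cbox[of a b] 
      unfolding \<phi>_def by fastforce
    also have "integral\<^sup>L lebesgue \<dots> = (LINT x|lebesgue_on \<Omega>. d x * \<phi> k x)"
      by (rule Lebesgue_Measure.integral_restrict_UNIV) (use \<Omega> in auto)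
    finally show ?thesis using zero[OF test] by simp
  qed
  moreover have "(\<lambda>k. LINT x|lebesgue_on (cbox a b). d x * \<phi> k x) \<longlonglongrightarrow>
      (LINT x|lebesgue_on (cbox a b). d x * indicator (box a b) x)"
  proof (rule integral_dominated_convergence)
    have [measurable]: "\<phi> k \<in> borel_measurable (lebesgue_on (cbox a b))" for k
      by (intro continuous_imp_measurable_on_sets_lebesgue test_function_continuous_on[OF test]) auto
    note [measurable] = borel_measurable_integrable[OF int]
    show "(\<lambda>x. d x * \<phi> k x) \<in> borel_measurable (lebesgue_on (cbox a b))" for k by measurable
    have "(\<lambda>x. indicator (box a b) x :: real) \<in> borel_measurable (lebesgue_on (cbox a b))"
      by (intro borel_measurable_indicator) (auto simp: sets_restrict_space intro!: image_eqI[of _ _ "box a b"] dest: box_subset_cbox[THEN subsetD])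
    then show "(\<lambda>x. d x * indicator (box a b) x) \<in> borel_measurable (lebesgue_on (cbox a b))" by measurable
    show "integrable (lebesgue_on (cbox a b)) (\<lambda>x. \<bar>d x\<bar>)" using int by simp
    show "AE x in lebesgue_on (cbox a b). norm (d x * \<phi> k x) \<le> \<bar>d x\<bar>" for k
      using box_bump_bounds[of a b "real (Suc k)"]
      by (auto simp: \<phi>_def abs_mult intro!: mult_right_le_one_le)
    show "AE x in lebesgue_on (cbox a b). (\<lambda>k. d x * \<phi> k x) \<longlonglongrightarrow> d x * indicator (box a b) x"
      unfolding \<phi>_def by (intro AE_I2 tendsto_mult tendsto_const box_bump_tendsto)
  qed
  ultimately have "(LINT x|lebesgue_on (cbox a b). d x * indicator (box a b) x) = 0"
    by (simp add: LIMSEQ_const_iff)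
  moreover have "(LINT x|lebesgue_on (cbox a b). d x * indicator (box a b) x) = integral (box a b) d"
  proof -
    have "(LINT x|lebesgue_on (cbox a b). d x * indicator (box a b) x) =
        integral\<^sup>L lebesgue (\<lambda>x. if x \<in> cbox a b then d x * indicator (box a b) x else 0)"
      by (rule Lebesgue_Measure.integral_restrict_UNIV[symmetric]) auto
    also have "(\<lambda>x. if x \<in> cbox a b then d x * indicator (box a b) x else 0) =
        (\<lambda>x. if x \<in> box a b then d x else 0)"
      using box_subset_cbox[of a b] by (auto simp: fun_eq_iff indicator_def)
    also have "integral\<^sup>L lebesgue \<dots> = (LINT x|lebesgue_on (box a b). d x)"
      by (rule Lebesgue_Measure.integral_restrict_UNIV) auto
    also have "\<dots> = integral (box a b) d"
    proof (rule lebesgue_integral_eq_integral)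
      have "set_integrable lebesgue (box a b) d"
        by (rule set_integrable_subset[OF d]) (auto simp: box_subset_cbox)
      then show "integrable (lebesgue_on (box a b)) d"
        by (simp add: integrable_restrict_space set_integrable_def)
    qed auto
    finally show ?thesis .
  qed
  ultimately show ?thesis by (simp add: integral_open_interval)
qed

text \<open>The fundamental lemma of the calculus of variations, by Lebesgue differentiation: the
  averages of d over small cubes are all 0, and they tend to d almost everywhere.\<close>

lemma AE_zero_if_weakly_zero:
  fixes d :: "'a::euclidean_space \<Rightarrow> real"
  assumes \<Omega>: "open \<Omega>" and d: "locally_integrable \<Omega> d"
    and zero: "\<And>\<phi>. \<phi> \<in> test_functions \<Omega> \<Longrightarrow> (LINT x|lebesgue_on \<Omega>. d x * \<phi> x) = 0"
  shows "AE x in lebesgue_on \<Omega>. d x = 0"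
proof -
  have cbox: "negligible {x \<in> cbox A B. d x \<noteq> 0}" if sub: "cbox A B \<subseteq> \<Omega>" for A B
  proof -
    define f where "f x = (if x \<in> cbox A B then d x else 0)" for x
    have "d absolutely_integrable_on cbox A B" using d sub by (auto simp: locally_integrable_def)
    then have "f integrable_on UNIV"
      unfolding f_def by (simp add: Henstock_Kurzweil_Integration.integrable_restrict_UNIV set_lebesgue_integral_eq_integral(1))
    then have "f integrable_on cbox a b" for a b
      by (rule integrable_on_subcbox) simp
    \<comment> \<open>The differentiation theorem, with cubes that have x as a corner. It is applied
      to \<open>f\<close>, the extension of \<open>d\<close> by zero, which is integrable on the
      whole space.\<close>
    then obtain N where N: "negligible N"
      "\<And>x e. x \<notin> N \<Longrightarrow> 0 < e \<Longrightarrow> \<exists>t>0. \<forall>h. 0 < h \<and> h < t \<longrightarrow>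
         norm (integral (cbox x (x + h *\<^sub>R One)) f /\<^sub>R h ^ DIM('a) - f x) < e"
      using integrable_ccontinuous_explicit[of f] by metis
    have "d x = 0" if x: "x \<in> box A B" "x \<notin> N" for x
    proof (rule ccontr)
      assume "d x \<noteq> 0"
      then obtain t where t: "t > 0" "\<And>h. 0 < h \<Longrightarrow> h < t \<Longrightarrow>
          norm (integral (cbox x (x + h *\<^sub>R One)) f /\<^sub>R h ^ DIM('a) - f x) < \<bar>d x\<bar>"
        using N(2)[OF x(2), of "\<bar>d x\<bar>"] by auto
      \<comment> \<open>As x lies in the open box, a sufficiently small cube with corner x stays
        inside it; on that cube \<open>f\<close> is \<open>d\<close> and has integral 0.\<close>
      have "((\<lambda>h. x + h *\<^sub>R One) \<longlongrightarrow> x + 0 *\<^sub>R One) (at_right 0)"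
        by (intro tendsto_intros)
      then have "eventually (\<lambda>h. x + h *\<^sub>R One \<in> box A B) (at_right 0)"
        using x(1) by (intro topological_tendstoD[OF _ open_box]) auto
      moreover have "eventually (\<lambda>h. h \<in> {0<..<t}) (at_right 0)"
        using t(1) by (rule eventually_at_right_real)
      ultimately have "eventually (\<lambda>h. x + h *\<^sub>R One \<in> box A B \<and> h \<in> {0<..<t}) (at_right 0)"
        by (rule eventually_conj)
      then obtain h where h: "x + h *\<^sub>R One \<in> box A B" "0 < h" "h < t"
        using eventually_happens' [OF trivial_limit_at_right_real] by fastforce
      have sub': "cbox x (x + h *\<^sub>R One) \<subseteq> cbox A B"
        using h(1) x(1) by (force simp: mem_box)
      have "integral (cbox x (x + h *\<^sub>R One)) f = integral (cbox x (x + h *\<^sub>R One)) d"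
        using sub' by (intro Henstock_Kurzweil_Integration.integral_cong) (auto simp: f_def)
      also have "\<dots> = 0"
        using sub' sub d by (intro integral_cbox_eq_0_if_weakly_zero[OF \<Omega> _ _ zero])
          (auto simp: locally_integrable_def)
      finally show False
        using t(2)[OF h(2,3)] subsetD[OF box_subset_cbox x(1)] by (simp add: f_def)
    qed
    then have "{x \<in> cbox A B. d x \<noteq> 0} \<subseteq> N \<union> (cbox A B - box A B)" by blast
    then show ?thesis
      using negligible_subset[OF negligible_Un[OF N(1) negligible_frontier_interval]] by blast
  qed
  \<comment> \<open>Countably many closed boxes exhaust \<open>\<Omega>\<close>, so the local null
    sets add up to a null set.\<close>
  obtain D where D: "countable D" "D \<subseteq> Pow \<Omega>" "\<And>X. X \<in> D \<Longrightarrow> \<exists>a b. X = cbox a b" "\<Union>D = \<Omega>"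
    using open_countable_Union_open_cbox[OF \<Omega>] by metis
  have "negligible (\<Union>X\<in>D. {x \<in> X. d x \<noteq> 0})"
    using D(1-3) cbox by (intro negligible_countable_Union) (auto, metis PowD subsetD)
  moreover have "{x \<in> \<Omega>. d x \<noteq> 0} = (\<Union>X\<in>D. {x \<in> X. d x \<noteq> 0})" using D(4) by auto
  ultimately have "{x \<in> \<Omega>. d x \<noteq> 0} \<in> null_sets lebesgue" by (simp add: negligible_iff_null_sets)
  then have "AE x in lebesgue. x \<in> \<Omega> \<longrightarrow> d x = 0"
    by (rule AE_I') auto
  then show ?thesis
    using \<Omega> by (simp add: AE_restrict_space_iff)
qed

text \<open>Each component of the difference of two weak gradients is orthogonal to all test
  functions.\<close>

lemma weak_gradient_unique:
  fixes u :: "'a::euclidean_space \<Rightarrow> real"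
  assumes \<Omega>: "open \<Omega>" and g: "has_weak_gradient \<Omega> u g" and h: "has_weak_gradient \<Omega> u h"
  shows "AE x in lebesgue_on \<Omega>. g x = h x"
proof -
  have "AE x in lebesgue_on \<Omega>. g x \<bullet> b - h x \<bullet> b = 0" if b: "b \<in> Basis" for b
  proof (rule AE_zero_if_weakly_zero[OF \<Omega>])
    have loc: "locally_integrable \<Omega> (\<lambda>x. k x \<bullet> b)" if "locally_integrable \<Omega> k" for k :: "'a \<Rightarrow> 'a"
      using that b absolutely_integrable_component unfolding locally_integrable_def by blast
    have gh: "locally_integrable \<Omega> (\<lambda>x. g x \<bullet> b)" "locally_integrable \<Omega> (\<lambda>x. h x \<bullet> b)"
      using g h by (auto intro!: loc simp: has_weak_gradient_def)
    then show "locally_integrable \<Omega> (\<lambda>x. g x \<bullet> b - h x \<bullet> b)"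
      unfolding locally_integrable_def by (auto intro!: set_integral_diff)
    fix \<phi> assume \<phi>: "\<phi> \<in> test_functions \<Omega>"
    \<comment> \<open>Local integrability is enough, since \<phi> is bounded and lives on a compact
      set. Integrability of both products is what permits splitting the integral of the
      difference.\<close>
    have int: "integrable (lebesgue_on \<Omega>) (\<lambda>x. k x * \<phi> x)" if k: "locally_integrable \<Omega> k" for k
    proof -
      obtain K where K: "compact K" "K \<subseteq> \<Omega>" "\<And>x. x \<notin> K \<Longrightarrow> \<phi> x = 0"
        using test_function_support[OF \<phi>] by metis
      have [simp]: "K \<in> sets lebesgue" using K(1) by (simp add: lmeasurable_compact fmeasurableD)
      have "k absolutely_integrable_on K" using k K by (simp add: locally_integrable_def)
      moreover have "\<phi> \<in> borel_measurable (lebesgue_on K)"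
        by (intro continuous_imp_measurable_on_sets_lebesgue test_function_continuous_on[OF \<phi>]) simp
      moreover have "bounded (\<phi> ` K)"
        by (intro compact_imp_bounded compact_continuous_image test_function_continuous_on[OF \<phi>] K)
      ultimately have "(\<lambda>x. \<phi> x * k x) absolutely_integrable_on K"
        by (intro absolutely_integrable_bounded_measurable_product[OF bilinear_times]) simp_all
      then have "integrable lebesgue (\<lambda>x. if x \<in> K then k x * \<phi> x else 0)"
        unfolding set_integrable_def
        by (rule back_subst[of "integrable lebesgue"]) (auto simp: fun_eq_iff)
      also have "(\<lambda>x. if x \<in> K then k x * \<phi> x else 0) = (\<lambda>x. if x \<in> \<Omega> then k x * \<phi> x else 0)"
        using K(2) by (auto simp: fun_eq_iff intro!: K(3))
      finally show ?thesis
        using \<Omega> by (subst (asm) Lebesgue_Measure.integrable_restrict_UNIV) auto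
    qed
    have "(LINT x|lebesgue_on \<Omega>. u x * (grad \<phi> x \<bullet> b)) = - (LINT x|lebesgue_on \<Omega>. (k x \<bullet> b) * \<phi> x)"
      if "has_weak_gradient \<Omega> u k" for k
      using that \<phi> b unfolding has_weak_gradient_def by blast
    from this[OF g] this[OF h]
    have "(LINT x|lebesgue_on \<Omega>. (g x \<bullet> b) * \<phi> x) = (LINT x|lebesgue_on \<Omega>. (h x \<bullet> b) * \<phi> x)"
      by linarith
    then show "(LINT x|lebesgue_on \<Omega>. (g x \<bullet> b - h x \<bullet> b) * \<phi> x) = 0"
      using Bochner_Integration.integral_diff[OF int[OF gh(1)] int[OF gh(2)]]
      by (simp add: left_diff_distrib)
  qed
  then have "AE x in lebesgue_on \<Omega>. \<forall>b\<in>Basis. g x \<bullet> b - h x \<bullet> b = 0"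
    by (rule AE_finite_allI[OF finite_Basis])
  then show ?thesis by (rule eventually_mono) (simp add: euclidean_eq_iff[where 'a = 'a])
qed

text \<open>The bridge from the chosen \<open>weak_grad\<close> to a gradient that can be
  computed.\<close>

lemma weak_grad_AE_eq:
  assumes "open \<Omega>" "has_weak_gradient \<Omega> u g"
  shows "AE x in lebesgue_on \<Omega>. weak_grad \<Omega> u x = g x"
proof -
  have "has_weak_gradient \<Omega> u (weak_grad \<Omega> u)"
    unfolding weak_grad_def by (rule someI[of "has_weak_gradient \<Omega> u", OF assms(2)])
  then show ?thesis using weak_gradient_unique[OF assms(1) _ assms(2)] by simp
qed

section \<open>Smooth approximation on an interval\<close>

text \<open>Weierstrass polynomials are cut off near the endpoints, and the small mean this creates
  is removed by a multiple of a fixed bump. \<open>W\<close> need not vanish at the endpoints, so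
  convergence is only pointwise inside with a uniform bound, as dominated convergence
  requires.\<close>

lemma smooth_approximation_mean_zero:
  fixes W :: "real \<Rightarrow> real"
  assumes "a < b" and W: "continuous_on {a..b} W" and W0: "integral {a..b} W = 0"
  obtains V :: "nat \<Rightarrow> real \<Rightarrow> real" and B :: real
  where "\<And>k m. Ck_on m UNIV (V k)"
    "\<And>k. \<exists>\<delta>>0. \<forall>t. t \<notin> {a + \<delta>..b - \<delta>} \<longrightarrow> V k t = 0"
    "\<And>k. integral {a..b} (V k) = 0"
    "\<And>k t. \<bar>V k t\<bar> \<le> B"
    "\<And>t. t \<in> {a<..<b} \<Longrightarrow> (\<lambda>k. V k t) \<longlonglongrightarrow> W t"
proof -
  define L where "L = b - a"
  have L: "L > 0" using assms(1) by (simp add: L_def)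
  have "\<exists>q. real_polynomial_function q \<and> (\<forall>t\<in>{a..b}. \<bar>W t - q t\<bar> < 1 / real (Suc k))" for k
  proof -
    have "0 < 1 / real (Suc k)" by simp
    from Stone_Weierstrass_real_polynomial_function[OF compact_Icc W this] show ?thesis by metis
  qed
  then obtain q where q: "\<And>k. real_polynomial_function (q k)"
    "\<And>k t. t \<in> {a..b} \<Longrightarrow> \<bar>W t - q k t\<bar> < 1 / real (Suc k)"
    by metis
  \<comment> \<open>The offset -1 makes \<open>cut k\<close> vanish within distance 1/(k + 1) of
    either endpoint, so its support is compact in the open interval.\<close>
  define cut where "cut k t = flat 0 (real (Suc k) * (t - a) - 1) * flat 0 (real (Suc k) * (b - t) - 1)" for k t
  \<comment> \<open>A bump on the middle half of the interval, independent of k; its positive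
    integral \<open>c\<close> normalizes the correction of the mean.\<close>
  define \<beta> where "\<beta> t = flat 0 (t - (a + L / 4)) * flat 0 ((b - L / 4) - t)" for t
  have smooth_aff: "Ck_on m UNIV (\<lambda>t. c * t + d)" for m and c d :: real
    by (intro Ck_on_add Ck_on_cmult Ck_on_const Ck_on_bounded_linear[OF bounded_linear_ident])
  have smooth_flat: "Ck_on m UNIV (\<lambda>t. flat 0 (c * t + d))" for m and c d :: real
    by (rule Ck_on_compose_real[OF Ck_on_flat smooth_aff])
  have smooth_cut: "Ck_on m UNIV (cut k)" for m k
    using Ck_on_mult[OF smooth_flat[of m "real (Suc k)" "- real (Suc k) * a - 1"]
        smooth_flat[of m "- real (Suc k)" "real (Suc k) * b - 1"]]
    by (simp add: cut_def[abs_def] algebra_simps)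
  have smooth_\<beta>: "Ck_on m UNIV \<beta>" for m
    using Ck_on_mult[OF smooth_flat[of m 1 "- a - L / 4"] smooth_flat[of m "-1" "b - L / 4"]]
    by (simp add: \<beta>_def[abs_def] algebra_simps)
  have cut01: "0 \<le> cut k t" "cut k t \<le> 1" and \<beta>01: "0 \<le> \<beta> t" "\<beta> t \<le> 1" for k t
    by (auto simp: cut_def \<beta>_def intro!: mult_nonneg_nonneg mult_le_one flat_0_bounds)
  have cut0: "cut k t = 0" if "t \<notin> {a + 1 / real (Suc k)..b - 1 / real (Suc k)}" for k t
  proof -
    have "real (Suc k) * (t - a) - 1 \<le> 0 \<or> real (Suc k) * (b - t) - 1 \<le> 0"
      using that by (auto simp: field_simps)
    then show ?thesis by (auto simp: cut_def flat_0_eq_0)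
  qed
  have \<beta>0: "\<beta> t = 0" if "t \<notin> {a + L / 4..b - L / 4}" for t
    using that by (auto simp: \<beta>_def flat_0_eq_0)
  have cut_lim: "(\<lambda>k. cut k t) \<longlonglongrightarrow> 1" if "t \<in> {a<..<b}" for t
  proof -
    have "(\<lambda>k. flat 0 (real k * (t - a) - 1) * flat 0 (real k * (b - t) - 1)) \<longlonglongrightarrow> 1 * 1"
      using that by (intro tendsto_mult flat_0_scaled_tendsto) auto
    from LIMSEQ_Suc[OF this] show ?thesis by (simp add: cut_def del: of_nat_Suc)
  qed
  have \<beta>_cont: "continuous_on S \<beta>" and cut_cont: "continuous_on S (cut k)" and q_cont: "continuous_on S (q k)" for S k
    by (rule continuous_on_subset[OF Ck_on_imp_continuous_on[OF smooth_\<beta>] subset_UNIV]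
        continuous_on_subset[OF Ck_on_imp_continuous_on[OF smooth_cut] subset_UNIV]
        continuous_on_subset[OF Ck_on_imp_continuous_on[OF
            Ck_on_real_polynomial_function[OF q(1)]] subset_UNIV])+
  define c where "c = integral {a..b} \<beta>"
  have "c \<noteq> 0"
  proof
    assume "c = 0"
    then have "\<forall>t\<in>cbox a b. \<beta> t = 0"
      using integral_eq_0_iff[of a b \<beta>] \<beta>_cont \<beta>01 assms(1) by (auto simp: c_def)
    moreover have "(a + b) / 2 \<in> cbox a b" "\<beta> ((a + b) / 2) > 0"
      using L unfolding \<beta>_def by (auto simp: L_def field_simps intro!: mult_pos_pos flat_0_pos)
    ultimately show False by fastforce
  qed
  moreover have "c \<ge> 0" unfolding c_def by (intro integral_nonneg integrable_continuous_interval \<beta>_cont) (rule \<beta>01)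
  ultimately have c: "c > 0" by simp
  obtain M where M: "\<And>t. t \<in> {a..b} \<Longrightarrow> \<bar>W t\<bar> \<le> M" "M \<ge> 0"
  proof -
    have "bounded (W ` {a..b})" by (intro compact_imp_bounded compact_continuous_image W) simp
    then obtain M where "\<forall>t\<in>{a..b}. \<bar>W t\<bar> \<le> M" by (auto simp: bounded_iff)
    then show ?thesis using that[of "max M 0"] by fastforce
  qed
  define P where "P k t = q k t * cut k t" for k t
  have P_cont: "continuous_on S (P k)" for S k unfolding P_def by (intro continuous_intros q_cont cut_cont)
  have P_bound: "\<bar>P k t\<bar> \<le> M + 1" for k t
  proof (cases "t \<in> {a..b}")
    case True
    have "\<bar>q k t\<bar> \<le> \<bar>W t\<bar> + \<bar>W t - q k t\<bar>" by linarith
    also have "\<dots> \<le> M + 1"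
    proof -
      have "1 / real (Suc k) \<le> 1" by simp
      then show ?thesis using M(1)[OF True] q(2)[OF True, of k] by linarith
    qed
    finally have "\<bar>q k t\<bar> * \<bar>cut k t\<bar> \<le> (M + 1) * 1"
      using cut01[of k t] by (intro mult_mono) auto
    then show ?thesis by (simp add: P_def abs_mult)
  next
    case False
    have "t \<notin> {a + 1 / real (Suc k)..b - 1 / real (Suc k)}"
    proof
      assume "t \<in> {a + 1 / real (Suc k)..b - 1 / real (Suc k)}"
      moreover have "1 / real (Suc k) > 0" by simp
      ultimately have "t \<in> {a..b}" unfolding atLeastAtMost_iff by linarith
      with False show False ..
    qed
    then show ?thesis using cut0[of t k] M(2) by (simp add: P_def)
  qed
  have P_lim: "(\<lambda>k. P k t) \<longlonglongrightarrow> W t" if t: "t \<in> {a<..<b}" for t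
  proof -
    have "(\<lambda>k. W t - q k t) \<longlonglongrightarrow> 0"
    proof (rule Lim_null_comparison)
      show "(\<lambda>k. 1 / real (Suc k)) \<longlonglongrightarrow> 0" using LIMSEQ_inverse_real_of_nat by (simp add: inverse_eq_divide)
      show "\<forall>\<^sub>F k in sequentially. norm (W t - q k t) \<le> 1 / real (Suc k)"
        using q(2)[of t] t by (intro always_eventually allI) (auto simp: less_imp_le)
    qed
    then have "(\<lambda>k. (W t - (W t - q k t)) * cut k t) \<longlonglongrightarrow> (W t - 0) * 1"
      by (intro tendsto_intros cut_lim[OF t])
    then show ?thesis by (simp add: P_def)
  qed
  \<comment> \<open>The defect of the mean. It tends to the mean of \<open>W\<close>, which is 0, so
    that subtracting \<open>m k / c\<close> times \<beta> does not change the limit.\<close>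
  define m where "m k = integral {a..b} (P k)" for k
  have m_bound: "\<bar>m k\<bar> \<le> (M + 1) * L" for k
  proof -
    have "norm (integral {a..b} (P k)) \<le> (M + 1) * (b - a)"
      using P_bound assms(1) by (intro integral_bound P_cont) auto
    then show ?thesis by (simp add: m_def L_def)
  qed
  have m_lim: "m \<longlonglongrightarrow> 0"
  proof -
    have "(\<lambda>k. integral {a<..<b} (P k)) \<longlonglongrightarrow> integral {a<..<b} W"
    proof (rule dominated_convergence(2)[where h = "\<lambda>t. M + 1"])
      show "P k integrable_on {a<..<b}" for k
        using integrable_on_open_interval_real integrable_continuous_interval[OF P_cont] by blast
      show "(\<lambda>t. M + 1) integrable_on {a<..<b}"
        using integrable_on_open_interval_real integrable_const_ivl by blast
    qed (use P_bound P_lim in auto)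
    then show ?thesis using W0 unfolding m_def by (simp add: integral_open_interval_real)
  qed
  show ?thesis
  \<comment> \<open>The bound adds M + 1 for \<open>P k\<close> and (M + 1) L / c for the
    correction, where \<beta> \<le> 1.\<close>
  proof (rule that[of "\<lambda>k t. P k t - m k / c * \<beta> t" "(M + 1) + (M + 1) * L / c"])
    show "Ck_on l UNIV (\<lambda>t. P k t - m k / c * \<beta> t)" for k l
      unfolding P_def
      by (intro Ck_on_diff Ck_on_mult Ck_on_const smooth_\<beta> smooth_cut Ck_on_real_polynomial_function q)
    show "\<exists>\<delta>>0. \<forall>t. t \<notin> {a + \<delta>..b - \<delta>} \<longrightarrow> P k t - m k / c * \<beta> t = 0" for k
    proof (intro exI conjI allI impI)
      define \<delta> where "\<delta> = min (1 / real (Suc k)) (L / 4)"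
      show "0 < \<delta>" using L by (simp add: \<delta>_def)
      fix t assume "t \<notin> {a + \<delta>..b - \<delta>}"
      then have "t \<notin> {a + 1 / real (Suc k)..b - 1 / real (Suc k)}" "t \<notin> {a + L / 4..b - L / 4}"
        unfolding \<delta>_def by (auto simp del: of_nat_Suc simp: min_def split: if_splits)
      then show "P k t - m k / c * \<beta> t = 0" using cut0 \<beta>0 by (simp add: P_def)
    qed
    show "integral {a..b} (\<lambda>t. P k t - m k / c * \<beta> t) = 0" for k
    proof -
      have "integral {a..b} (\<lambda>t. P k t - m k / c * \<beta> t) =
          integral {a..b} (P k) - integral {a..b} (\<lambda>t. m k / c * \<beta> t)"
        by (intro Henstock_Kurzweil_Integration.integral_diff integrable_continuous_interval
            continuous_intros P_cont \<beta>_cont)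
      also have "\<dots> = m k - m k / c * c"
        by (simp only: Henstock_Kurzweil_Integration.integral_mult_right m_def[symmetric] c_def[symmetric])
      finally have "integral {a..b} (\<lambda>t. P k t - m k / c * \<beta> t) = m k - m k / c * c" .
      then show ?thesis using c by simp
    qed
    show "\<bar>P k t - m k / c * \<beta> t\<bar> \<le> (M + 1) + (M + 1) * L / c" for k t
    proof -
      have "\<bar>m k / c * \<beta> t\<bar> = \<bar>m k\<bar> * \<bar>\<beta> t\<bar> / c" using c by (simp add: abs_mult)
      also have "\<dots> \<le> (M + 1) * L * 1 / c"
        using c m_bound \<beta>01[of t] M(2) L by (intro divide_right_mono mult_mono) auto
      finally show ?thesis using P_bound[of k t] by linarith
    qed
    show "(\<lambda>k. P k t - m k / c * \<beta> t) \<longlonglongrightarrow> W t" if "t \<in> {a<..<b}" for t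
    proof -
      have "(\<lambda>k. P k t - m k / c * \<beta> t) \<longlonglongrightarrow> W t - 0 / c * \<beta> t"
        using c by (intro tendsto_intros P_lim[OF that] m_lim) auto
      then show ?thesis by simp
    qed
  qed
qed

text \<open>\<open>\<Phi> k\<close> is the primitive from \<open>a\<close> of an approximation of
  \<open>W\<close>. It vanishes near \<open>a\<close> because the integrand does, and near
  \<open>b\<close> because in addition the whole integral is zero: this is why zero mean has to hold
  for every k and not only in the limit.\<close>

lemma smooth_compactly_supported_approximation:
  fixes W :: "real \<Rightarrow> real"
  assumes "a < b" and W: "continuous_on {a..b} W" and W0: "integral {a..b} W = 0"
  obtains \<Phi> \<Phi>' :: "nat \<Rightarrow> real \<Rightarrow> real" and B :: real
  where "\<And>k m. Ck_on m UNIV (\<Phi> k)"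
    "\<And>k t. (\<Phi> k has_real_derivative \<Phi>' k t) (at t)"
    "\<And>k. \<exists>\<delta>>0. \<forall>t. t \<notin> {a + \<delta>..b - \<delta>} \<longrightarrow> \<Phi> k t = 0"
    "\<And>k t. \<bar>\<Phi> k t\<bar> \<le> B"
    "\<And>k t. \<bar>\<Phi>' k t\<bar> \<le> B"
    "\<And>t. t \<in> {a<..<b} \<Longrightarrow> (\<lambda>k. \<Phi> k t) \<longlonglongrightarrow> integral {a..t} W"
    "\<And>t. t \<in> {a<..<b} \<Longrightarrow> (\<lambda>k. \<Phi>' k t) \<longlonglongrightarrow> W t"
proof -
  obtain V B where V: "\<And>k m. Ck_on m UNIV (V k)"
    "\<And>k. \<exists>\<delta>>0. \<forall>t. t \<notin> {a + \<delta>..b - \<delta>} \<longrightarrow> V k t = 0"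
    "\<And>k. integral {a..b} (V k) = 0"
    "\<And>k t. \<bar>V k t\<bar> \<le> B"
    "\<And>t. t \<in> {a<..<b} \<Longrightarrow> (\<lambda>k. V k t) \<longlonglongrightarrow> W t"
    by (rule smooth_approximation_mean_zero[OF assms], rule that) assumption+
  have B: "B \<ge> 0" by (rule order_trans[OF abs_ge_zero V(4)])
  have V_cont: "continuous_on S (V k)" for k S
    using Ck_on_imp_continuous_on[OF V(1)] continuous_on_subset by blast
  have V_int: "V k integrable_on {s..t}" for k s t
    by (intro integrable_continuous_interval V_cont)
  define \<Phi> where "\<Phi> k t = integral {a..t} (V k)" for k t
  have supp: "\<exists>\<delta>>0. \<forall>t. t \<notin> {a + \<delta>..b - \<delta>} \<longrightarrow> \<Phi> k t = 0 \<and> V k t = 0" for k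
  proof -
    obtain \<delta> where \<delta>: "\<delta> > 0" "\<And>t. t \<notin> {a + \<delta>..b - \<delta>} \<Longrightarrow> V k t = 0" using V(2) by metis
    have "\<Phi> k t = 0" if "t \<notin> {a + \<delta>..b - \<delta>}" for t
    proof -
      have "t < a + \<delta> \<or> (b - \<delta> < t \<and> t \<le> b) \<or> b < t"
        using that unfolding atLeastAtMost_iff by linarith
      then consider "t < a + \<delta>" | "b - \<delta> < t" "t \<le> b" | "b < t" by blast
      then show ?thesis
      proof cases
        case 1
        then show ?thesis unfolding \<Phi>_def
          by (subst Henstock_Kurzweil_Integration.integral_cong[of _ _ "\<lambda>t. 0"]) (auto intro: \<delta>(2))
      next
        case 2
        show ?thesis
        proof (cases "a \<le> t")
          case True
          have "integral {a..t} (V k) + integral {t..b} (V k) = integral {a..b} (V k)"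
            using True 2 by (intro Henstock_Kurzweil_Integration.integral_combine V_int)
          moreover have "integral {t..b} (V k) = 0"
            using 2 by (subst Henstock_Kurzweil_Integration.integral_cong[of _ _ "\<lambda>t. 0"]) (auto intro: \<delta>(2))
          ultimately show ?thesis using V(3) by (simp add: \<Phi>_def)
        qed (simp add: \<Phi>_def)
      next
        case 3
        have "integral {a..b} (V k) + integral {b..t} (V k) = integral {a..t} (V k)"
          using 3 assms(1) by (intro Henstock_Kurzweil_Integration.integral_combine V_int) auto
        moreover have "integral {b..t} (V k) = 0"
          using \<delta>(1) by (subst Henstock_Kurzweil_Integration.integral_cong[of _ _ "\<lambda>t. 0"]) (auto intro: \<delta>(2))
        ultimately show ?thesis using V(3) by (simp add: \<Phi>_def)
      qed
    qed
    then show ?thesis using \<delta> by blast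
  qed
  have der: "(\<Phi> k has_real_derivative V k t) (at t)" for k t
  proof (cases "t > a")
    case True
    have "(\<Phi> k has_real_derivative V k t) (at t within {a..t + 1})"
      unfolding \<Phi>_def using True by (intro integral_has_real_derivative V_cont) auto
    moreover have "at t within {a..t + 1} = at t"
      using True by (intro at_within_interior) auto
    ultimately show ?thesis by simp
  next
    case False
    \<comment> \<open>At t \<le> a the integral over \<open>{a..t}\<close> yields no two-sided
      derivative, but primitive and integrand vanish at all arguments below a + \<delta>.\<close>
    obtain \<delta> where \<delta>: "\<delta> > 0" "\<And>t. t \<notin> {a + \<delta>..b - \<delta>} \<Longrightarrow> \<Phi> k t = 0 \<and> V k t = 0" using supp by metis
    have "((\<lambda>t. 0) has_real_derivative V k t) (at t)" using \<delta> False by auto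
    then show ?thesis
      by (rule has_field_derivative_transform_within_open[of _ _ _ "{..<a + \<delta>}"])
        (use \<delta> False in \<open>auto simp: \<delta>(2)\<close>)
  qed
  have bound: "\<bar>\<Phi> k t\<bar> \<le> B * (b - a)" for k t
  proof (cases "t \<in> {a..b}")
    case True
    have "norm (integral {a..t} (V k)) \<le> B * (t - a)"
      using V(4) True by (intro integral_bound V_cont) auto
    also have "\<dots> \<le> B * (b - a)" using True B by (auto intro!: mult_left_mono)
    finally show ?thesis by (simp add: \<Phi>_def)
  next
    case False
    obtain \<delta> where "\<delta> > 0" "\<And>t. t \<notin> {a + \<delta>..b - \<delta>} \<Longrightarrow> \<Phi> k t = 0" using supp by metis
    then have "\<Phi> k t = 0" using False by auto
    then show ?thesis using B assms(1) by simp
  qed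
  show ?thesis
  proof (rule that[of \<Phi> V "max B (B * (b - a))"])
    show "Ck_on m UNIV (\<Phi> k)" for k m
      using Ck_on_SucD[OF Ck_on_real_SucI[OF der V(1)]] .
    show "(\<lambda>k. \<Phi> k t) \<longlonglongrightarrow> integral {a..t} W" if t: "t \<in> {a<..<b}" for t
    proof -
      have "(\<lambda>k. integral {a<..<t} (V k)) \<longlonglongrightarrow> integral {a<..<t} W"
      proof (rule dominated_convergence(2)[where h = "\<lambda>t. B"])
        show "V k integrable_on {a<..<t}" for k
          using integrable_on_open_interval_real V_int by blast
        show "(\<lambda>t. B) integrable_on {a<..<t}"
          using integrable_on_open_interval_real integrable_const_ivl by blast
      qed (use V t in auto)
      then show ?thesis unfolding \<Phi>_def by (simp add: integral_open_interval_real)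
    qed
  qed (use der supp bound V in \<open>auto simp: le_max_iff_disj\<close>, metis)
qed

section \<open>The inverse of the scalar flux\<close>

text \<open>The scalar factor of \<open>flux\<close> as a function of t = |grad u|; it will turn out
  to be the value of \<open>E_inv\<close> at the squared scalar flux.\<close>

definition weight :: "real \<Rightarrow> real \<Rightarrow> real \<Rightarrow> real" where
  "weight p \<epsilon> t = (t\<^sup>2 + chi p * \<epsilon>\<^sup>2) powr ((p - 2) / 2)"

definition slope :: "real \<Rightarrow> real \<Rightarrow> real \<Rightarrow> real" where
  "slope p \<epsilon> \<sigma> = \<sigma> / E_inv \<epsilon> p (\<sigma>\<^sup>2)"

lemma slope_minus: "slope p \<epsilon> (- \<sigma>) = - slope p \<epsilon> \<sigma>"
  by (simp add: slope_def)

lemma slope_0 [simp]: "slope p \<epsilon> 0 = 0"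
  by (simp add: slope_def)

lemma weight_minus: "weight p \<epsilon> (- t) = weight p \<epsilon> t"
  by (simp add: weight_def)

lemma integral_pos_if_continuous:
  fixes f :: "real \<Rightarrow> real"
  assumes "a < b" "continuous_on {a..b} f" "\<And>t. t \<in> {a..b} \<Longrightarrow> f t \<ge> 0" "t0 \<in> {a..b}" "f t0 > 0"
  shows "integral {a..b} f > 0"
proof -
  have "integral {a..b} f \<noteq> 0"
    using integral_eq_0_iff[of a b f] assms by fastforce
  moreover have "integral {a..b} f \<ge> 0"
    by (intro integral_nonneg integrable_continuous_interval assms)
  ultimately show ?thesis by simp
qed

lemma power2_powr_half:
  fixes t :: real
  assumes "t \<ge> 0"
  shows "(t\<^sup>2) powr (a / 2) = t powr a"
proof (cases "t = 0")
  case False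
  then have "(t\<^sup>2) powr (a / 2) = (t powr 2) powr (a / 2)" using assms by simp
  also have "\<dots> = t powr a" by (subst powr_powr) simp
  finally show ?thesis .
qed simp

context
  fixes p \<epsilon> :: real
  assumes p: "p \<in> {1<..<2} \<union> {2<..}" and \<epsilon>: "\<epsilon> > 0"
begin

lemma E_fun_strict_antimono:
  assumes "p < 2" "0 < x" "x < y"
  shows "E_fun \<epsilon> p y < E_fun \<epsilon> p x"
proof -
  have "(2 * p - 2) / (p - 2) < 0" using p assms(1) by (auto simp: divide_pos_neg)
  then have "y powr ((2 * p - 2) / (p - 2)) < x powr ((2 * p - 2) / (p - 2))"
    using assms by (intro powr_less_mono2_neg) auto
  moreover have "x\<^sup>2 \<le> y\<^sup>2" using assms by (intro power_mono) auto
  ultimately show ?thesis using p assms(1) mult_left_mono[of "x\<^sup>2" "y\<^sup>2" "\<epsilon>\<^sup>2"]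
    by (simp add: E_fun_def chi_def)
qed

lemma E_fun_strict_mono:
  assumes "p > 2" "0 \<le> x" "x < y"
  shows "E_fun \<epsilon> p x < E_fun \<epsilon> p y"
  using assms by (auto simp: E_fun_def chi_def intro!: powr_less_mono2)

lemma inj_on_E_fun: "inj_on (E_fun \<epsilon> p) (E_dom \<epsilon> p)"
proof (cases "p < 2")
  case True
  then show ?thesis
    using E_fun_strict_antimono[OF True]
    by (intro linorder_inj_onI') (force simp: E_dom_def)
next
  case False
  then have "p > 2" using p by auto
  then show ?thesis
    using E_fun_strict_mono by (intro linorder_inj_onI') (force simp: E_dom_def)
qed

text \<open>For p < 2 the weight is positive and largest at t = 0, where it equals \<epsilon>^(p -
  2), the right end of \<open>E_dom\<close>.\<close>

lemma weight_in_E_dom: "weight p \<epsilon> t \<in> E_dom \<epsilon> p"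
proof (cases "p < 2")
  case True
  have "(\<epsilon>\<^sup>2) powr ((p - 2) / 2) = \<epsilon> powr (p - 2)"
    by (rule power2_powr_half[OF less_imp_le[OF \<epsilon>]])
  moreover have "(t\<^sup>2 + \<epsilon>\<^sup>2) powr ((p - 2) / 2) \<le> (\<epsilon>\<^sup>2) powr ((p - 2) / 2)"
    using True \<epsilon> by (intro powr_mono2') auto
  moreover have "0 < (t\<^sup>2 + \<epsilon>\<^sup>2) powr ((p - 2) / 2)"
    using \<epsilon> by (simp add: sum_power2_gt_zero_iff)
  ultimately show ?thesis using True p by (simp add: E_dom_def weight_def chi_def)
next
  case False
  then show ?thesis by (simp add: E_dom_def weight_def)
qed

text \<open>With A = t^2 + \<chi> \<epsilon>^2, the exponent in \<open>E_fun\<close> turns the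
  weight into A^(p - 1) = A^(p - 2) A, and the subtracted term \<chi> \<epsilon>^2 A^(p - 2) leaves
  A^(p - 2) t^2. This is where \<open>E_fun\<close> comes from.\<close>

lemma E_fun_weight: "E_fun \<epsilon> p (weight p \<epsilon> t) = (weight p \<epsilon> t * t)\<^sup>2"
proof -
  define A where "A = t\<^sup>2 + chi p * \<epsilon>\<^sup>2"
  have w: "weight p \<epsilon> t = A powr ((p - 2) / 2)" by (simp add: weight_def A_def)
  have "A \<ge> 0" by (simp add: A_def chi_def)
  have "p \<noteq> 2" using p by auto
  have sq: "(A powr ((p - 2) / 2))\<^sup>2 = A powr (p - 2)"
    by (simp add: power2_eq_square flip: powr_add)
  have exponent: "(p - 2) / 2 * ((2 * p - 2) / (p - 2)) = (p - 2) + 1"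
  proof -
    obtain x where "p = x + 2" by (metis diff_add_cancel)
    then show ?thesis using \<open>p \<noteq> 2\<close> by (simp add: field_simps)
  qed
  have "(A powr ((p - 2) / 2)) powr ((2 * p - 2) / (p - 2)) = A powr ((p - 2) + 1)"
    by (simp only: powr_powr exponent)
  also have "\<dots> = A powr (p - 2) * A"
    using \<open>A \<ge> 0\<close> by (simp only: powr_add powr_one)
  finally have "E_fun \<epsilon> p (weight p \<epsilon> t) = A powr (p - 2) * A - chi p * \<epsilon>\<^sup>2 * A powr (p - 2)"
    by (simp add: E_fun_def w sq)
  then have "E_fun \<epsilon> p (weight p \<epsilon> t) = A powr (p - 2) * t\<^sup>2"
    by (simp add: A_def algebra_simps)
  then show ?thesis by (simp add: w power_mult_distrib sq)
qed

lemma weight_eq_0_imp: "weight p \<epsilon> t = 0 \<Longrightarrow> t = 0"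
  using \<epsilon> p by (auto simp: weight_def chi_def add_nonneg_eq_0_iff split: if_splits)

lemma slope_weight: "slope p \<epsilon> (weight p \<epsilon> t * t) = t"
proof -
  have "E_inv \<epsilon> p ((weight p \<epsilon> t * t)\<^sup>2) = weight p \<epsilon> t"
    unfolding E_inv_def
    by (rule the_inv_into_f_eq[OF inj_on_E_fun E_fun_weight weight_in_E_dom])
  \<comment> \<open>If the weight is 0 then t = 0, and the quotient is 0 / 0 = 0 = t.\<close>
  then show ?thesis using weight_eq_0_imp[of t] by (auto simp: slope_def)
qed

lemma weight_unbounded: "\<exists>t\<ge>0. y \<le> weight p \<epsilon> t * t"
proof (cases "p < 2")
  case True
  \<comment> \<open>For t \<ge> \<epsilon> one has t^2 + \<epsilon>^2 \<le> 2 t^2, and since the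
    exponent is negative the scalar flux is at least 2^((p - 2) / 2) t^(p - 1). The factor in
    \<open>z\<close> cancels the power of 2, and the root in \<open>t\<close> undoes the exponent p
    - 1.\<close>
  define z where "z = max y 0 * 2 powr ((2 - p) / 2)"
  define t where "t = max \<epsilon> (z powr (1 / (p - 1)))"
  have z: "z \<ge> 0" by (simp add: z_def)
  have t: "t \<ge> \<epsilon>" "t > 0" "z powr (1 / (p - 1)) \<le> t" using \<epsilon> by (auto simp: t_def)
  have "y \<le> 2 powr ((p - 2) / 2) * z"
  proof -
    have "2 powr ((p - 2) / 2) * 2 powr ((2 - p) / 2) = 2 powr ((p - 2) / 2 + (2 - p) / 2)"
      by (rule powr_add[symmetric])
    also have "(p - 2) / 2 + (2 - p) / 2 = 0" by (simp add: field_simps)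
    finally have "2 powr ((p - 2) / 2) * 2 powr ((2 - p) / 2) = (1::real)" by simp
    then have "2 powr ((p - 2) / 2) * z = max y 0" by (simp add: z_def algebra_simps)
    then show ?thesis by simp
  qed
  also have "z = (z powr (1 / (p - 1))) powr (p - 1)"
    using z p True by (simp add: powr_powr)
  also have "\<dots> \<le> t powr (p - 1)"
    using t p by (intro powr_mono2) auto
  also have "2 powr ((p - 2) / 2) * t powr (p - 1) = (2 * t\<^sup>2) powr ((p - 2) / 2) * t"
  proof -
    have "(t\<^sup>2) powr ((p - 2) / 2) = t powr (p - 2)"
      by (rule power2_powr_half[OF less_imp_le[OF t(2)]])
    moreover have "t powr (p - 1) = t powr (p - 2) * t"
      using t(2) powr_add[of t "p - 2" 1] by simp
    ultimately show ?thesis by (simp add: powr_mult)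
  qed
  also have "\<dots> \<le> weight p \<epsilon> t * t"
  proof -
    have "\<epsilon>\<^sup>2 \<le> t\<^sup>2" using t \<epsilon> by (intro power_mono) auto
    then have "(2 * t\<^sup>2) powr ((p - 2) / 2) \<le> (t\<^sup>2 + \<epsilon>\<^sup>2) powr ((p - 2) / 2)"
      using True t \<epsilon> by (intro powr_mono2') (auto simp: sum_power2_gt_zero_iff)
    then show ?thesis using t True p by (simp add: weight_def chi_def)
  qed
  finally show ?thesis using t(2) by (intro exI[of _ t]) (auto simp: mult_left_mono)
next
  case False
  define t where "t = max 1 y"
  have "1 \<le> (t\<^sup>2) powr ((p - 2) / 2)"
    using False by (intro ge_one_powr_ge_zero) (auto simp: t_def)
  then have "1 * t \<le> weight p \<epsilon> t * t"
    using False p by (intro mult_right_mono) (auto simp: weight_def chi_def t_def)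
  then show ?thesis by (intro exI[of _ t]) (auto simp: t_def)
qed

lemma continuous_on_weight_mult: "continuous_on UNIV (\<lambda>t. weight p \<epsilon> t * t)"
proof (cases "p < 2")
  case True
  have "t\<^sup>2 + \<epsilon>\<^sup>2 \<noteq> 0" for t using \<epsilon> by (simp add: add_nonneg_eq_0_iff)
  then show ?thesis using True p
    by (auto simp: weight_def chi_def intro!: continuous_intros)
next
  case False
  then show ?thesis using p
    by (auto simp: weight_def chi_def intro!: continuous_intros continuous_on_powr')
qed

lemma ex_weight_mult_eq: "\<exists>t. weight p \<epsilon> t * t = \<sigma>"
proof -
  have pos: "\<exists>t. weight p \<epsilon> t * t = \<sigma>" if "\<sigma> \<ge> 0" for \<sigma>
  proof -
    obtain s where s: "s \<ge> 0" "\<sigma> \<le> weight p \<epsilon> s * s" using weight_unbounded by blast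
    have "\<exists>t\<ge>0. t \<le> s \<and> weight p \<epsilon> t * t = \<sigma>"
      using s that 
      by (intro IVT'[of "\<lambda>t. weight p \<epsilon> t * t" 0 \<sigma> s]
          continuous_on_subset[OF continuous_on_weight_mult]) auto
    then show ?thesis by blast
  qed
  show ?thesis
  proof (cases "\<sigma> \<ge> 0")
    case False
    then obtain t where "weight p \<epsilon> t * t = - \<sigma>" using pos[of "- \<sigma>"] by auto
    then have "weight p \<epsilon> (- t) * (- t) = \<sigma>" by (simp add: weight_minus)
    then show ?thesis by blast
  qed (rule pos)
qed

lemma weight_slope: "weight p \<epsilon> (slope p \<epsilon> \<sigma>) * slope p \<epsilon> \<sigma> = \<sigma>"
  using ex_weight_mult_eq[of \<sigma>] slope_weight by metis

text \<open>By \<open>E_fun_weight\<close> the squared scalar flux is \<open>E_fun\<close> composed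
  with the weight. Both decrease on t \<ge> 0 if p < 2 and both increase if p > 2, so the
  composition increases in either case.\<close>

lemma weight_mult_less:
  assumes "0 \<le> s" "s < t"
  shows "weight p \<epsilon> s * s < weight p \<epsilon> t * t"
proof -
  have lt: "s\<^sup>2 < t\<^sup>2" using assms by (intro power_strict_mono) auto
  have "E_fun \<epsilon> p (weight p \<epsilon> s) < E_fun \<epsilon> p (weight p \<epsilon> t)"
  proof (cases "p < 2")
    case True
    have "weight p \<epsilon> t < weight p \<epsilon> s"
      using True p \<epsilon> lt unfolding weight_def
      by (intro powr_less_mono2_neg) (auto simp: chi_def sum_power2_gt_zero_iff)
    moreover have "weight p \<epsilon> t > 0" using weight_in_E_dom[of t] True by (simp add: E_dom_def)
    ultimately show ?thesis by (intro E_fun_strict_antimono True)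
  next
    case False
    then have "p > 2" using p by auto
    moreover from this have "weight p \<epsilon> s < weight p \<epsilon> t"
      using lt unfolding weight_def by (intro powr_less_mono2) (auto simp: chi_def)
    ultimately show ?thesis by (intro E_fun_strict_mono) (auto simp: weight_def)
  qed
  then have "(weight p \<epsilon> s * s)\<^sup>2 < (weight p \<epsilon> t * t)\<^sup>2" by (simp add: E_fun_weight)
  then show ?thesis
    using assms by (intro power2_less_imp_less[of _ "weight p \<epsilon> t * t"]) (auto simp: weight_def)
qed

lemma strict_mono_slope: "strict_mono (slope p \<epsilon>)"
proof -
  let ?s = "\<lambda>t. weight p \<epsilon> t * t"
  have pos: "?s s < ?s t" if "s < t" for s t
  proof -
    have sgn: "?s t > 0" if "t > 0" for t using weight_mult_less[of 0 t] that by simp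
    have nn: "?s t \<ge> 0" if "t \<ge> 0" for t using that by (simp add: weight_def)
    consider "0 \<le> s" | "s < 0" "0 \<le> t" | "t < 0" using \<open>s < t\<close> by linarith
    then show ?thesis
    proof cases
      case 1
      then show ?thesis using weight_mult_less that by simp
    next
      case 2
      then show ?thesis using sgn[of "- s"] nn[of t] by (simp add: weight_minus)
    next
      case 3
      then show ?thesis using weight_mult_less[of "- t" "- s"] that by (simp add: weight_minus)
    qed
  qed
  show ?thesis
  proof (rule strict_monoI)
    fix x y :: real assume "x < y"
    then show "slope p \<epsilon> x < slope p \<epsilon> y"
      using pos[of "slope p \<epsilon> y" "slope p \<epsilon> x"] weight_slope[of x] weight_slope[of y]
      by (cases "slope p \<epsilon> x" "slope p \<epsilon> y" rule: linorder_cases) auto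
  qed
qed

text \<open>A monotone function onto the whole line cannot jump; \<open>slope_weight\<close>
  provides the surjectivity.\<close>

lemma continuous_on_slope: "continuous_on S (slope p \<epsilon>)"
proof -
  have "range (slope p \<epsilon>) = UNIV" by (rule surjI[of _ "\<lambda>t. weight p \<epsilon> t * t"]) (rule slope_weight)
  then have "continuous_on UNIV (slope p \<epsilon>)"
    using strict_mono_less_eq[OF strict_mono_slope] by (intro continuous_onI_mono) auto
  then show ?thesis using continuous_on_subset by blast
qed

end

section \<open>Radial profiles on the annulus\<close>

lemma annulus_eq: "annulus c R1 R2 = {x. R1 < dist x c \<and> dist x c < R2}"
  by (auto simp: annulus_def dist_commute)

lemma open_annulus: "open (annulus c R1 R2)"
  by (simp add: annulus_def open_Diff)

lemma bounded_annulus: "bounded (annulus c R1 R2)"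
  by (rule bounded_subset[OF bounded_ball[of c R2]]) (auto simp: annulus_eq dist_commute)

lemma closure_annulus:
  fixes c :: "'a::euclidean_space"
  assumes "0 < R1" "R1 < R2"
  shows "closure (annulus c R1 R2) = {x. R1 \<le> dist x c \<and> dist x c \<le> R2}"
proof
  have "closed {x. R1 \<le> dist x c \<and> dist x c \<le> R2}"
    by (intro closed_Collect_conj closed_Collect_le continuous_intros)
  then show "closure (annulus c R1 R2) \<subseteq> {x. R1 \<le> dist x c \<and> dist x c \<le> R2}"
    by (intro closure_minimal) (auto simp: annulus_eq)
  show "{x. R1 \<le> dist x c \<and> dist x c \<le> R2} \<subseteq> closure (annulus c R1 R2)"
  proof
    fix x assume "x \<in> {x. R1 \<le> dist x c \<and> dist x c \<le> R2}"
    then have x: "R1 \<le> dist x c" "dist x c \<le> R2" by auto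
    define r where "r = dist x c"
    define m where "m = (R1 + R2) / 2"
    \<comment> \<open>The point moves from x along its ray, with radius (1 - t) r + t m. For 0 < t <
      1 this is strictly between the radii, even if x lies on a boundary sphere.\<close>
    define y where "y t = c + ((r + t * (m - r)) / r) *\<^sub>R (x - c)" for t
    have r: "r > 0" "R1 \<le> r" "r \<le> R2" using x assms by (auto simp: r_def)
    have mR: "R1 < m" "m < R2" using assms by (auto simp: m_def)
    have "((\<lambda>t. y t) \<longlongrightarrow> y 0) (at_right 0)"
      unfolding y_def using r(1) by (intro tendsto_intros) auto
    moreover have "y 0 = x" using r by (simp add: y_def)
    ultimately have lim: "(y \<longlongrightarrow> x) (at_right 0)" by simp
    have "y t \<in> annulus c R1 R2" if t: "t \<in> {0<..<1}" for t
    proof -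
      have "r + t * (m - r) = (1 - t) * r + t * m" by (simp add: algebra_simps)
      moreover have "(1 - t) * R1 + t * R1 < (1 - t) * r + t * m"
        using t r mR by (intro add_le_less_mono mult_left_mono mult_strict_left_mono) auto
      moreover have "(1 - t) * r + t * m < (1 - t) * R2 + t * R2"
        using t r mR by (intro add_le_less_mono mult_left_mono mult_strict_left_mono) auto
      ultimately have *: "R1 < r + t * (m - r)" "r + t * (m - r) < R2"
        by (simp_all add: algebra_simps)
      have "dist (y t) c = \<bar>(r + t * (m - r)) / r\<bar> * norm (x - c)"
        by (simp add: y_def dist_norm)
      also have "\<dots> = r + t * (m - r)"
        using * r assms(1) by (simp add: r_def dist_norm)
      finally have "dist (y t) c = r + t * (m - r)" .
      with * show ?thesis by (simp add: annulus_eq)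
    qed
    then have "eventually (\<lambda>t. y t \<in> annulus c R1 R2) (at_right 0)"
      using eventually_at_right_real[of 0 1] by (auto elim: eventually_mono)
    then show "x \<in> closure (annulus c R1 R2)"
      using closure_subset[of "annulus c R1 R2"]
      by (intro Lim_in_closed_set[OF closed_closure _ _ lim])
        (auto simp: trivial_limit_at_right_real elim: eventually_mono)
  qed
qed

lemma frontier_annulus:
  fixes c :: "'a::euclidean_space"
  assumes "0 < R1" "R1 < R2"
  shows "frontier (annulus c R1 R2) = {x. dist x c = R1 \<or> dist x c = R2}"
  using assms unfolding frontier_def closure_annulus[OF assms] interior_open[OF open_annulus]
  by (auto simp: annulus_eq)

locale annulus_problem =
  fixes c :: "'a::euclidean_space" and f :: "'a \<Rightarrow> real" and p \<epsilon> R1 R2 :: real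
  assumes p: "p \<in> {1<..<2} \<union> {2<..}"
    and R12: "R2 > R1" and R1: "R1 > 0"
    and f_cont: "continuous_on (closure (annulus c R1 R2)) f"
    and f_radial: "radially_symmetric_on (closure (annulus c R1 R2)) c f"
    and f_Sgn: "Sgn_on (closure (annulus c R1 R2)) f = 1 \<or> Sgn_on (closure (annulus c R1 R2)) f = - 1"
    and \<epsilon>: "\<epsilon> > 0"
begin

abbreviation \<Omega> :: "'a set" where "\<Omega> \<equiv> annulus c R1 R2"

definition s :: real where "s = Sgn_on (closure \<Omega>) f"

definition h :: "real \<Rightarrow> real" where "h = radial_profile (closure \<Omega>) c f"

lemmas closure_\<Omega> = closure_annulus[OF R1 R12, of c]

lemma ex_dist_eq:
  assumes "r \<ge> 0"
  shows "\<exists>x::'a. dist x c = r"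
proof -
  have "dist (c + r *\<^sub>R (SOME b. b \<in> Basis)) c = r"
    using assms by (simp add: dist_norm SOME_Basis)
  then show ?thesis ..
qed

lemma s_cases: "s = 1 \<or> s = - 1"
  using f_Sgn by (simp add: s_def)

lemma s_sq [simp]: "s * s = 1" "s * (s * x) = x"
  using s_cases by auto

lemma sf_pos: "x \<in> closure \<Omega> \<Longrightarrow> s * f x > 0"
  using f_Sgn unfolding s_def Sgn_on_def by (auto split: if_splits)

text \<open>The point chosen in \<open>radial_profile\<close> is immaterial by radial
  symmetry.\<close>

lemma h_dist:
  assumes "x \<in> closure \<Omega>"
  shows "h (dist x c) = f x"
proof -
  obtain g where g: "\<And>x. x \<in> closure \<Omega> \<Longrightarrow> f x = g (dist x c)"
    using f_radial by (auto simp: radially_symmetric_on_def)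
  let ?y = "SOME y. y \<in> closure \<Omega> \<and> dist y c = dist x c"
  have "?y \<in> closure \<Omega> \<and> dist ?y c = dist x c"
    by (rule someI[of _ x]) (use assms in simp)
  then show ?thesis using g assms by (simp add: h_def radial_profile_def)
qed

lemma sh_pos:
  assumes "r \<in> {R1..R2}"
  shows "s * h r > 0"
proof -
  obtain x :: 'a where "dist x c = r" using ex_dist_eq[of r] assms R1 by auto
  then show ?thesis using sf_pos[of x] h_dist[of x] assms by (auto simp: closure_\<Omega>)
qed

lemma h_cont: "continuous_on {R1..R2} h"
proof -
  \<comment> \<open>A unit vector: continuity of the profile is read off from \<open>f\<close> along
    a single ray.\<close>
  define b :: 'a where "b = (SOME b. b \<in> Basis)"
  have b: "norm b = 1" by (simp add: b_def SOME_Basis)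
  have dist: "dist (c + r *\<^sub>R b) c = r" if "r \<in> {R1..R2}" for r
    using that R1 b by (simp add: dist_norm)
  have "continuous_on {R1..R2} (\<lambda>r. f (c + r *\<^sub>R b))"
    using dist by (intro continuous_on_compose2[OF f_cont] continuous_intros) (auto simp: closure_\<Omega>)
  also have "continuous_on {R1..R2} (\<lambda>r. f (c + r *\<^sub>R b)) \<longleftrightarrow> continuous_on {R1..R2} h"
  proof (intro continuous_on_cong refl)
    show "f (c + r *\<^sub>R b) = h r" if "r \<in> {R1..R2}" for r
      using h_dist[of "c + r *\<^sub>R b"] dist[OF that] that by (simp add: closure_\<Omega>)
  qed
  finally show ?thesis .
qed

section \<open>The normalized primitive of the source term\<close>

text \<open>The factor \<open>s\<close> makes the integrand positive for either sign of
  \<open>f\<close>, so that \<open>H\<close> is strictly increasing.\<close>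

definition H :: "real \<Rightarrow> real" where
  "H r = integral {R1..r} (\<lambda>\<rho>. s * h \<rho> * \<rho> ^ (DIM('a) - 1))"

lemma sh_weight_cont: "continuous_on {R1..R2} (\<lambda>\<rho>. s * h \<rho> * \<rho> ^ (DIM('a) - 1))"
  by (intro continuous_intros h_cont)

lemma H_R1 [simp]: "H R1 = 0"
  by (simp add: H_def)

lemma H_deriv:
  assumes "r \<in> {R1..R2}"
  shows "(H has_real_derivative s * h r * r ^ (DIM('a) - 1)) (at r within {R1..R2})"
  unfolding H_def by (rule integral_has_real_derivative[OF sh_weight_cont assms])

lemma H_cont: "continuous_on {R1..R2} H"
  by (rule DERIV_continuous_on[OF H_deriv])

lemma H_less:
  assumes "R1 \<le> r" "r < r'" "r' \<le> R2"
  shows "H r < H r'"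
proof -
  have cont: "continuous_on {a..b} (\<lambda>\<rho>. s * h \<rho> * \<rho> ^ (DIM('a) - 1))" if "R1 \<le> a" "b \<le> R2" for a b
    using that by (intro continuous_on_subset[OF sh_weight_cont]) auto
  have pos: "s * h \<rho> * \<rho> ^ (DIM('a) - 1) > 0" if "\<rho> \<in> {r..r'}" for \<rho>
    using that assms R1 by (intro mult_pos_pos[OF sh_pos] zero_less_power) auto
  have "H r + integral {r..r'} (\<lambda>\<rho>. s * h \<rho> * \<rho> ^ (DIM('a) - 1)) = H r'"
    unfolding H_def using assms
    by (intro Henstock_Kurzweil_Integration.integral_combine integrable_continuous_interval cont) auto
  moreover have "integral {r..r'} (\<lambda>\<rho>. s * h \<rho> * \<rho> ^ (DIM('a) - 1)) > 0"
    using assms pos[of r] pos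
    by (intro integral_pos_if_continuous[where ?t0.0 = r] cont) (auto simp: less_imp_le)
  ultimately show ?thesis by simp
qed

lemma weighted_integral_eq:
  assumes "r \<in> {R1..R2}"
  shows "weighted_integral c R1 R2 f r = - s * H r"
proof -
  have cont: "continuous_on {R1..r} (\<lambda>\<rho>. h \<rho> * \<rho> ^ (DIM('a) - 1))"
    using assms by (intro continuous_intros continuous_on_subset[OF h_cont]) auto
  have "weighted_integral c R1 R2 f r = - (LBINT \<rho>=R1..r. h \<rho> * \<rho> ^ (DIM('a) - 1))"
    unfolding weighted_integral_def h_def by (rule interval_integral_endpoints_reverse)
  also have "(LBINT \<rho>=R1..r. h \<rho> * \<rho> ^ (DIM('a) - 1)) = integral {R1..r} (\<lambda>\<rho>. h \<rho> * \<rho> ^ (DIM('a) - 1))"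
    using assms by (intro interval_integral_eq_integral borel_integrable_atLeastAtMost' cont) auto
  also have "\<dots> = s * H r"
    by (simp add: H_def mult.assoc)
  finally show ?thesis by simp
qed

text \<open>Up to the sign \<open>s\<close> this is G / r^(n - 1), the radial component of the flux
  when \<open>y\<close> takes the place of the constant C.\<close>

definition q :: "real \<Rightarrow> real \<Rightarrow> real" where
  "q y r = (y * R1 ^ DIM('a) - H r) / r ^ (DIM('a) - 1)"

lemma G_fun_eq: "r \<in> {R1..R2} \<Longrightarrow> G_fun c R1 R2 f r y = s * (y * R1 ^ DIM('a) - H r)"
  by (simp add: G_fun_def weighted_integral_eq s_def[symmetric] algebra_simps)

lemma slope_s: "slope p \<epsilon> (s * x) = s * slope p \<epsilon> x"
  using s_cases by (auto simp: slope_minus)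

text \<open>Squaring removes \<open>s\<close> in the argument of \<open>E_inv\<close>, so \<mu> is
  \<open>slope\<close> at s q; as \<open>slope\<close> is odd, the sign comes out in front.\<close>

lemma mu_fun_eq:
  assumes "r \<in> {R1..R2}"
  shows "mu_fun p \<epsilon> c R1 R2 f r y = s * slope p \<epsilon> (q y r)"
proof -
  have "(G_fun c R1 R2 f r y)\<^sup>2 / r ^ (2 * DIM('a) - 2) = (s * q y r)\<^sup>2"
    by (simp add: G_fun_eq[OF assms] q_def power_divide diff_mult_distrib2 mult.commute flip: power_mult)
  then have "mu_fun p \<epsilon> c R1 R2 f r y = slope p \<epsilon> (s * q y r)"
    by (simp add: mu_fun_def lambda_fun_def slope_def G_fun_eq[OF assms] q_def)
  then show ?thesis by (simp add: slope_s)
qed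

lemma q_cont: "continuous_on {R1..R2} (q y)"
  unfolding q_def using R1 by (intro continuous_intros H_cont) auto

lemma slope_q_cont: "continuous_on {R1..R2} (\<lambda>r. slope p \<epsilon> (q y r))"
  by (rule continuous_on_compose2[OF continuous_on_slope[OF p \<epsilon>] q_cont]) auto

section \<open>Existence and uniqueness of the constant C\<close>

definition K :: "real \<Rightarrow> real" where
  "K y = integral {R1..R2} (\<lambda>r. slope p \<epsilon> (q y r))"

lemma M_fun_eq: "M_fun p \<epsilon> c R1 R2 f y = s * K y"
proof -
  have "continuous_on {R1..R2} (\<lambda>r. mu_fun p \<epsilon> c R1 R2 f r y) \<longleftrightarrow>
      continuous_on {R1..R2} (\<lambda>r. s * slope p \<epsilon> (q y r))"
    by (intro continuous_on_cong refl mu_fun_eq)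
  then have "continuous_on {R1..R2} (\<lambda>r. mu_fun p \<epsilon> c R1 R2 f r y)"
    by (simp add: continuous_intros slope_q_cont)
  then have "M_fun p \<epsilon> c R1 R2 f y = integral {R1..R2} (\<lambda>r. mu_fun p \<epsilon> c R1 R2 f r y)"
    unfolding M_fun_def using R12
    by (intro interval_integral_eq_integral borel_integrable_atLeastAtMost') auto
  also have "\<dots> = integral {R1..R2} (\<lambda>r. s * slope p \<epsilon> (q y r))"
    by (intro Henstock_Kurzweil_Integration.integral_cong mu_fun_eq)
  finally show ?thesis by (simp add: K_def)
qed

lemma slope_less: "x < y \<Longrightarrow> slope p \<epsilon> x < slope p \<epsilon> y"
  using strict_mono_slope[OF p \<epsilon>] by (simp add: strict_mono_def)

lemma slope_le: "x \<le> y \<Longrightarrow> slope p \<epsilon> x \<le> slope p \<epsilon> y"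
  using strict_mono_less_eq[OF strict_mono_slope[OF p \<epsilon>]] by blast

lemma K_less:
  assumes "y < y'"
  shows "K y < K y'"
proof -
  have lt: "slope p \<epsilon> (q y r) < slope p \<epsilon> (q y' r)" if "r \<in> {R1..R2}" for r
    using assms that R1 unfolding q_def
    by (intro slope_less divide_strict_right_mono) auto
  have "0 < integral {R1..R2} (\<lambda>r. slope p \<epsilon> (q y' r) - slope p \<epsilon> (q y r))"
    using lt[of R1] lt R12
    by (intro integral_pos_if_continuous[where ?t0.0 = R1] continuous_intros slope_q_cont)
      (auto simp: less_imp_le)
  also have "\<dots> = K y' - K y"
    unfolding K_def by (intro Henstock_Kurzweil_Integration.integral_diff integrable_continuous_interval slope_q_cont)
  finally show ?thesis by simp
qed

text \<open>For y = 0 the numerator of \<open>q\<close> is - H, which is nonpositive throughout and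
  negative at \<open>R2\<close>.\<close>

lemma K_0: "K 0 < 0"
proof -
  have "slope p \<epsilon> (q 0 r) \<le> 0" if "r \<in> {R1..R2}" for r
  proof -
    have "H R1 \<le> H r" using H_less[of R1 r] that by (cases "r = R1") auto
    then have "q 0 r \<le> 0" using that R1 by (simp add: q_def divide_nonneg_nonneg)
    then show ?thesis using slope_le[of "q 0 r" 0] by simp
  qed
  moreover have "slope p \<epsilon> (q 0 R2) < 0"
  proof -
    have "q 0 R2 < 0" using H_less[of R1 R2] R12 R1 by (simp add: q_def)
    then show ?thesis using slope_less[of "q 0 R2" 0] by simp
  qed
  ultimately have "0 < integral {R1..R2} (\<lambda>r. - slope p \<epsilon> (q 0 r))"
    using R12 by (intro integral_pos_if_continuous[where ?t0.0 = R2] continuous_intros slope_q_cont) auto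
  then show ?thesis by (simp add: K_def)
qed

text \<open>This value of y makes the numerator of \<open>q\<close> equal to H R2 - H r, which is
  nonnegative throughout and positive at \<open>R1\<close>.\<close>

lemma K_pos: "K (H R2 / R1 ^ DIM('a)) > 0"
proof -
  let ?y = "H R2 / R1 ^ DIM('a)"
  have q: "q ?y r = (H R2 - H r) / r ^ (DIM('a) - 1)" for r using R1 by (simp add: q_def)
  have "slope p \<epsilon> (q ?y r) \<ge> 0" if "r \<in> {R1..R2}" for r
  proof -
    have "H r \<le> H R2" using H_less[of r R2] that by (cases "r = R2") auto
    then have "q ?y r \<ge> 0" unfolding q using that R1 by (simp add: divide_nonneg_nonneg)
    then show ?thesis using slope_le[of 0 "q ?y r"] by simp
  qed
  moreover have "slope p \<epsilon> (q ?y R1) > 0"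
  proof -
    have "q ?y R1 > 0" unfolding q using H_less[of R1 R2] R12 R1 by simp
    then show ?thesis using slope_less[of 0 "q ?y R1"] by simp
  qed
  ultimately show ?thesis unfolding K_def
    using R12 by (intro integral_pos_if_continuous[where ?t0.0 = R1] slope_q_cont) auto
qed

lemma K_cont: "continuous_on UNIV K"
proof -
  have "continuous_on (UNIV \<times> cbox R1 R2) (\<lambda>(y, r). slope p \<epsilon> (q y r))"
    unfolding case_prod_beta q_def using R1
    by (intro continuous_on_compose2[OF continuous_on_slope[OF p \<epsilon>, of UNIV]] continuous_intros
        continuous_on_compose2[OF H_cont]) auto
  from integral_continuous_on_param[OF this] show ?thesis
    by (simp add: K_def[abs_def])
qed

lemma ex1_C: "\<exists>!C. C > 0 \<and> M_fun p \<epsilon> c R1 R2 f C = 0"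
proof -
  have M0: "M_fun p \<epsilon> c R1 R2 f y = 0 \<longleftrightarrow> K y = 0" for y
    using s_cases by (auto simp: M_fun_eq)
  have "0 \<le> H R2 / R1 ^ DIM('a)" using H_less[of R1 R2] R12 R1 by simp
  then obtain C where C: "0 \<le> C" "K C = 0"
    using IVT'[of K 0 0 "H R2 / R1 ^ DIM('a)"] K_0 K_pos continuous_on_subset[OF K_cont]
    by (auto simp: less_imp_le)
  have "C \<noteq> 0" using C(2) K_0 by auto
  show ?thesis unfolding M0
  proof (rule ex1I[of _ C])
    show "C > 0 \<and> K C = 0" using C \<open>C \<noteq> 0\<close> by simp
    show "C' = C" if "C' > 0 \<and> K C' = 0" for C'
      using that C(2) K_less[of C C'] K_less[of C' C] by (cases C C' rule: linorder_cases) auto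
  qed
qed

definition C :: real where "C = C_const p \<epsilon> c R1 R2 f"

lemma K_C: "K C = 0"
proof -
  have "M_fun p \<epsilon> c R1 R2 f C = 0"
    unfolding C_def C_const_def using theI'[OF ex1_C] by blast
  then show ?thesis using s_cases by (auto simp: M_fun_eq)
qed

section \<open>The profile of the solution and its explicit formula\<close>

definition U :: "real \<Rightarrow> real" where
  "U r = integral {R1..r} (\<lambda>\<rho>. s * slope p \<epsilon> (q C \<rho>))"

lemma U_R1: "U R1 = 0"
  by (simp add: U_def)

text \<open>The outer boundary condition is the equation that defines \<open>C\<close>.\<close>

lemma U_R2: "U R2 = 0"
  using K_C by (simp add: U_def K_def)

lemma su_slope_cont: "continuous_on {R1..R2} (\<lambda>r. s * slope p \<epsilon> (q C r))"
  by (intro continuous_intros slope_q_cont)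

lemma U_deriv_within:
  "r \<in> {R1..R2} \<Longrightarrow> (U has_real_derivative s * slope p \<epsilon> (q C r)) (at r within {R1..R2})"
  unfolding U_def by (rule integral_has_real_derivative[OF su_slope_cont])

lemma U_cont: "continuous_on {R1..R2} U"
  by (rule DERIV_continuous_on[OF U_deriv_within])

lemma u_bar_eq:
  assumes "r \<in> {R1..R2}"
  shows "u_bar p \<epsilon> c R1 R2 f r = U r"
proof -
  have eq: "F_fun p \<epsilon> c R1 R2 f \<rho> * \<rho> / E_inv \<epsilon> p ((F_fun p \<epsilon> c R1 R2 f \<rho>)\<^sup>2 * \<rho>\<^sup>2) =
      s * slope p \<epsilon> (q C \<rho>)" if "\<rho> \<in> {R1..R2}" for \<rho>
  proof -
    \<comment> \<open>The denominators of \<open>F_fun\<close> and \<open>q\<close> differ by one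
      factor \<rho>. Hence F \<rho> = s q, and the integrand is the same slope as in \<mu>.\<close>
    have "\<rho> ^ DIM('a) = \<rho> ^ (DIM('a) - 1) * \<rho>" by (metis DIM_positive power_minus_mult)
    then have "F_fun p \<epsilon> c R1 R2 f \<rho> * \<rho> = s * q C \<rho>"
      using that R1
      by (simp add: F_fun_def weighted_integral_eq C_def s_def[symmetric] q_def field_simps)
    then show ?thesis
      using slope_s[of "q C \<rho>"] by (simp add: slope_def flip: power_mult_distrib)
  qed
  have "continuous_on {R1..r} (\<lambda>\<rho>. F_fun p \<epsilon> c R1 R2 f \<rho> * \<rho> /
      E_inv \<epsilon> p ((F_fun p \<epsilon> c R1 R2 f \<rho>)\<^sup>2 * \<rho>\<^sup>2)) \<longleftrightarrow>
      continuous_on {R1..r} (\<lambda>\<rho>. s * slope p \<epsilon> (q C \<rho>))"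
    by (intro continuous_on_cong refl eq) (use assms in auto)
  then have "continuous_on {R1..r} (\<lambda>\<rho>. F_fun p \<epsilon> c R1 R2 f \<rho> * \<rho> /
      E_inv \<epsilon> p ((F_fun p \<epsilon> c R1 R2 f \<rho>)\<^sup>2 * \<rho>\<^sup>2))"
    using continuous_on_subset[OF su_slope_cont, of "{R1..r}"] assms by auto
  then have "u_bar p \<epsilon> c R1 R2 f r = integral {R1..r} (\<lambda>\<rho>. F_fun p \<epsilon> c R1 R2 f \<rho> * \<rho> /
      E_inv \<epsilon> p ((F_fun p \<epsilon> c R1 R2 f \<rho>)\<^sup>2 * \<rho>\<^sup>2))"
    unfolding u_bar_def using assms
    by (intro interval_integral_eq_integral borel_integrable_atLeastAtMost') auto
  also have "\<dots> = U r"
    unfolding U_def by (intro Henstock_Kurzweil_Integration.integral_cong eq) (use assms in auto)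
  finally show ?thesis .
qed

end

section \<open>The Euler--Lagrange problem\<close>

lemma Ck_on_1I:
  assumes "\<And>x. x \<in> S \<Longrightarrow> (f has_derivative f' x) (at x)"
    and "\<And>b. b \<in> Basis \<Longrightarrow> continuous_on S (\<lambda>x. f' x b)"
  shows "Ck_on 1 S f"
proof -
  have fd: "frechet_derivative f (at x) = f' x" if "x \<in> S" for x
    using frechet_derivative_at[OF assms(1)[OF that]] by simp
  have "continuous_on S (\<lambda>x. frechet_derivative f (at x) b)" if "b \<in> Basis" for b
    using assms(2)[OF that] fd by (simp cong: continuous_on_cong)
  then show ?thesis using assms(1) by (auto simp: differentiable_def)
qed

lemma grad_eq:
  assumes "(u has_derivative (\<lambda>y. v \<bullet> y)) (at x)"
  shows "grad u x = v"
  using frechet_derivative_at[OF assms, symmetric]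
  by (simp add: grad_def euclidean_representation)

lemma radial_has_derivative:
  fixes c :: "'a::euclidean_space"
  assumes "(g has_real_derivative g') (at (dist x c))" "x \<noteq> c"
  shows "((\<lambda>x. g (dist x c)) has_derivative (\<lambda>y. (g' / dist x c) *\<^sub>R (x - c) \<bullet> y)) (at x)"
proof -
  have d: "((\<lambda>x. x - c) has_derivative (\<lambda>y. y)) (at x)"
    by (auto intro!: derivative_eq_intros)
  have "((\<lambda>x. norm (x - c)) has_derivative (\<lambda>y. y \<bullet> sgn (x - c))) (at x)"
    using assms(2) by (intro has_derivative_compose[OF d has_derivative_norm]) simp
  then have "((\<lambda>x. dist x c) has_derivative (\<lambda>y. sgn (x - c) \<bullet> y)) (at x)"
    by (simp add: dist_norm inner_commute)
  from has_derivative_compose[OF this assms(1)[unfolded has_field_derivative_def]]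
  show ?thesis
    by (rule has_derivative_eq_rhs) (simp add: fun_eq_iff sgn_div_norm dist_norm divide_inverse mult.assoc)
qed

context annulus_problem
begin

definition u :: "'a \<Rightarrow> real" where "u x = U (dist x c)"

definition w :: "real \<Rightarrow> real" where "w r = s * slope p \<epsilon> (q C r)"

text \<open>On the interval this is \<open>F_fun\<close>. Compared with \<open>q\<close> there is
  one more factor 1/r, which normalizes x - c to a unit vector.\<close>

definition k :: "real \<Rightarrow> real" where "k r = s * (C * R1 ^ DIM('a) - H r) / r ^ DIM('a)"

lemma w_cont: "continuous_on {R1..R2} w"
  using su_slope_cont by (simp add: w_def[abs_def])

lemma k_cont: "continuous_on {R1..R2} k"
  unfolding k_def using R1 by (intro continuous_intros H_cont) auto

lemma dist_in: "x \<in> \<Omega> \<Longrightarrow> R1 < dist x c \<and> dist x c < R2 \<and> 0 < dist x c \<and> x \<noteq> c"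
  using R1 by (auto simp: annulus_eq)

lemma continuous_on_dist_compose:
  "continuous_on {R1..R2} g \<Longrightarrow> continuous_on \<Omega> (\<lambda>x. g (dist x c))"
  by (erule continuous_on_compose2) (auto intro!: continuous_intros simp: annulus_eq)

lemma DERIV_interior:
  fixes g :: "real \<Rightarrow> real"
  assumes "(g has_real_derivative g') (at r within {R1..R2})" "R1 < r" "r < R2"
  shows "(g has_real_derivative g') (at r)"
  using assms at_within_Icc_at[of R1 r R2] by simp

lemma U_deriv: "R1 < r \<Longrightarrow> r < R2 \<Longrightarrow> (U has_real_derivative w r) (at r)"
  unfolding w_def by (intro DERIV_interior U_deriv_within) auto

text \<open>Written so that r k' + n k = - h can be read off. The left side is the divergence of
  k(|x - c|) (x - c), so this is the radial form of the equation.\<close>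

lemma k_deriv:
  assumes "R1 < r" "r < R2"
  shows "(k has_real_derivative (- h r - DIM('a) * k r) / r) (at r)"
proof -
  obtain m where m: "DIM('a) = Suc m" using DIM_positive[where 'a = 'a] by (cases "DIM('a)") auto
  have r: "r > 0" using assms R1 by simp
  have "(H has_real_derivative s * h r * r ^ m) (at r)"
    using H_deriv[of r] assms m by (intro DERIV_interior) auto
  then have "((\<lambda>r. s * (C * R1 ^ Suc m - H r) / r ^ Suc m) has_real_derivative
      (s * (0 - s * h r * r ^ m) * r ^ Suc m - s * (C * R1 ^ Suc m - H r) * (Suc m * r ^ m)) /
      (r ^ Suc m * r ^ Suc m)) (at r)"
    using r by (auto intro!: derivative_eq_intros simp del: power_Suc)
  also have "(s * (0 - s * h r * r ^ m) * r ^ Suc m - s * (C * R1 ^ Suc m - H r) * (Suc m * r ^ m)) /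
      (r ^ Suc m * r ^ Suc m) = (- h r - DIM('a) * k r) / r"
  proof -
    have "s * (0 - s * h r * r ^ m) = - h r * r ^ m" by (simp add: mult.assoc)
    then show ?thesis using r by (simp add: k_def m field_simps)
  qed
  finally show ?thesis by (simp add: k_def[abs_def] m)
qed

lemma u_has_derivative:
  assumes "x \<in> \<Omega>"
  shows "(u has_derivative (\<lambda>y. (w (dist x c) / dist x c) *\<^sub>R (x - c) \<bullet> y)) (at x)"
  unfolding u_def using dist_in[OF assms] by (intro radial_has_derivative U_deriv) auto

lemma grad_u: "x \<in> \<Omega> \<Longrightarrow> grad u x = (w (dist x c) / dist x c) *\<^sub>R (x - c)"
  by (rule grad_eq[OF u_has_derivative])

text \<open>The gradient has signed length w = slope (s q), and the weight undoes
  \<open>slope\<close>. What remains involves only \<open>H\<close> and powers of r, so the flux is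
  C^1 even at radii where \<open>slope\<close> is not differentiable.\<close>

lemma flux_u:
  assumes "x \<in> \<Omega>"
  shows "flux p \<epsilon> u x = k (dist x c) *\<^sub>R (x - c)"
proof -
  let ?r = "dist x c"
  have r: "?r > 0" "?r \<in> {R1..R2}" using dist_in[OF assms] by auto
  have "norm (grad u x) = \<bar>w ?r\<bar>"
    using r(1) by (simp add: grad_u[OF assms]) (simp add: dist_norm)
  then have "flux p \<epsilon> u x = (weight p \<epsilon> (w ?r) * w ?r / ?r) *\<^sub>R (x - c)"
    by (simp add: flux_def weight_def grad_u[OF assms])
  also have "weight p \<epsilon> (w ?r) * w ?r = s * q C ?r"
    using weight_slope[OF p \<epsilon>, of "s * q C ?r"] by (simp add: w_def slope_s)
  also have "s * q C ?r / ?r = k ?r"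
  proof -
    have "?r ^ DIM('a) = ?r ^ (DIM('a) - 1) * ?r" by (metis DIM_positive power_minus_mult)
    then show ?thesis by (simp add: q_def k_def)
  qed
  finally show ?thesis .
qed

lemma flux_u_has_derivative:
  assumes "x \<in> \<Omega>"
  defines "r \<equiv> dist x c"
  shows "(flux p \<epsilon> u has_derivative
    (\<lambda>y. k r *\<^sub>R y + (((- h r - DIM('a) * k r) / r / r) *\<^sub>R (x - c) \<bullet> y) *\<^sub>R (x - c))) (at x)"
proof -
  have "((\<lambda>x. k (dist x c)) has_derivative
      (\<lambda>y. ((- h r - DIM('a) * k r) / r / r) *\<^sub>R (x - c) \<bullet> y)) (at x)"
    using dist_in[OF assms(1)] unfolding r_def by (intro radial_has_derivative k_deriv) auto
  moreover have "((\<lambda>x. x - c) has_derivative (\<lambda>y. y)) (at x)"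
    by (auto intro!: derivative_eq_intros)
  ultimately have "((\<lambda>x. k (dist x c) *\<^sub>R (x - c)) has_derivative
    (\<lambda>y. k r *\<^sub>R y + (((- h r - DIM('a) * k r) / r / r) *\<^sub>R (x - c) \<bullet> y) *\<^sub>R (x - c))) (at x)"
    unfolding r_def by (rule has_derivative_scaleR)
  then show ?thesis
    by (rule has_derivative_transform_within_open[OF _ open_annulus assms(1)]) (simp add: flux_u)
qed

lemma divergence_flux_u:
  assumes "x \<in> \<Omega>"
  shows "divergence (flux p \<epsilon> u) x + f x = 0"
proof -
  let ?r = "dist x c"
  let ?d = "(- h ?r - DIM('a) * k ?r) / ?r / ?r"
  have r: "?r > 0" using dist_in[OF assms] by auto
  have "frechet_derivative (flux p \<epsilon> u) (at x) =
      (\<lambda>y. k ?r *\<^sub>R y + (?d *\<^sub>R (x - c) \<bullet> y) *\<^sub>R (x - c))"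
    using frechet_derivative_at[OF flux_u_has_derivative[OF assms]] by simp
  then have "divergence (flux p \<epsilon> u) x =
      (\<Sum>b\<in>Basis. k ?r * (b \<bullet> b) + ?d * (((x - c) \<bullet> b) * ((x - c) \<bullet> b)))"
    unfolding divergence_def
    by (intro sum.cong refl) (simp only: inner_add_left inner_scaleR_left mult.assoc)
  also have "\<dots> = DIM('a) * k ?r + ?d * ((x - c) \<bullet> (x - c))"
    by (simp only: sum.distrib sum_distrib_left[symmetric] euclidean_inner[of "x - c" "x - c", symmetric]) simp
  also have "(x - c) \<bullet> (x - c) = ?r * ?r"
    by (simp add: dist_norm power2_norm_eq_inner[symmetric] power2_eq_square)
  also have "DIM('a) * k ?r + ?d * (?r * ?r) = - h ?r"
    using r by simp
  also have "h ?r = f x" using assms closure_subset by (intro h_dist) blast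
  finally show ?thesis by simp
qed

lemma Ck_on_u: "Ck_on 1 \<Omega> u"
  by (rule Ck_on_1I[OF u_has_derivative])
    (use dist_in in \<open>auto intro!: continuous_intros continuous_on_dist_compose w_cont\<close>)

lemma Ck_on_flux_u: "Ck_on 1 \<Omega> (flux p \<epsilon> u)"
proof (rule Ck_on_1I[OF flux_u_has_derivative])
  have [continuous_intros]: "continuous_on \<Omega> (\<lambda>x. k (dist x c))" "continuous_on \<Omega> (\<lambda>x. h (dist x c))"
    by (intro continuous_on_dist_compose k_cont h_cont)+
  show "continuous_on \<Omega> (\<lambda>x. k (dist x c) *\<^sub>R b + (((- h (dist x c) - DIM('a) * k (dist x c)) /
      dist x c / dist x c) *\<^sub>R (x - c) \<bullet> b) *\<^sub>R (x - c))" for b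
    using dist_in by (intro continuous_intros) auto
qed

lemma u_cont: "continuous_on (closure \<Omega>) u"
  unfolding u_def
  by (rule continuous_on_compose2[OF U_cont]) (auto intro!: continuous_intros simp: closure_\<Omega>)

lemma solves_u: "solves_Euler_Lagrange p \<epsilon> \<Omega> f u"
  unfolding solves_Euler_Lagrange_def
  using u_cont Ck_on_u Ck_on_flux_u divergence_flux_u U_R1 U_R2
  by (auto simp: frontier_annulus[OF R1 R12] u_def)

end

section \<open>The weak equation in Sobolev spaces\<close>

lemma powr_add_le:
  fixes a b r :: real
  assumes "a \<ge> 0" "b \<ge> 0" "r \<ge> 0"
  shows "(a + b) powr r \<le> 2 powr r * (a powr r + b powr r)"
proof -
  have "(a + b) powr r \<le> (2 * max a b) powr r"
    using assms by (intro powr_mono2) auto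
  also have "\<dots> = 2 powr r * max a b powr r" by (rule powr_mult)
  also have "\<dots> \<le> 2 powr r * (a powr r + b powr r)"
    by (intro mult_left_mono) (auto simp: max_def)
  finally show ?thesis .
qed

lemma integrable_norm_diff_powr:
  fixes a b :: "'x \<Rightarrow> 'b::euclidean_space"
  assumes [measurable]: "a \<in> borel_measurable M" "b \<in> borel_measurable M"
    and "integrable M (\<lambda>x. norm (a x) powr r)" "integrable M (\<lambda>x. norm (b x) powr r)" "r \<ge> 0"
  shows "integrable M (\<lambda>x. norm (a x - b x) powr r)"
proof (rule Bochner_Integration.integrable_bound)
  show "integrable M (\<lambda>x. 2 powr r * (norm (a x) powr r + norm (b x) powr r))"
    using assms(3,4) by (intro integrable_mult_right Bochner_Integration.integrable_add)
  have "norm (a x - b x) powr r \<le> 2 powr r * (norm (a x) powr r + norm (b x) powr r)" for x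
    by (rule order_trans[OF powr_mono2[OF assms(5) norm_ge_zero norm_triangle_ineq4] powr_add_le])
      (use assms(5) in auto)
  then show "AE x in M. norm (norm (a x - b x) powr r) \<le>
      norm (2 powr r * (norm (a x) powr r + norm (b x) powr r))"
    by (intro AE_I2) simp
qed measurable

text \<open>Above \<delta> the factor t^(1 - r) is at most \<delta>^(1 - r). Over a finite measure,
  \<delta> = 1 gives integrability from integrability of the r-th power, and small \<delta> gives
  convergence in L^1.\<close>

lemma norm_le_add_powr:
  fixes t \<delta> r :: real
  assumes "t \<ge> 0" "\<delta> > 0" "r \<ge> 1"
  shows "t \<le> \<delta> + \<delta> powr (1 - r) * t powr r"
proof (cases "t \<le> \<delta>")
  case False
  have "t = t powr (1 - r) * t powr r"
    using False assms by (simp flip: powr_add)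
  also have "\<dots> \<le> \<delta> powr (1 - r) * t powr r"
    using False assms by (intro mult_right_mono powr_mono2') auto
  finally show ?thesis using assms(2) by linarith
qed (simp add: add_increasing2)

lemma integrable_if_powr_integrable:
  fixes a :: "'x \<Rightarrow> 'b::euclidean_space"
  assumes "finite_measure M" "a \<in> borel_measurable M" "integrable M (\<lambda>x. norm (a x) powr r)" "r \<ge> 1"
  shows "integrable M a"
proof (rule Bochner_Integration.integrable_bound[OF _ assms(2)])
  interpret finite_measure M by fact
  show "integrable M (\<lambda>x. 1 + norm (a x) powr r)"
    using assms(3) by simp
  have "norm (a x) \<le> 1 + norm (a x) powr r" for x
    using norm_le_add_powr[of "norm (a x)" 1 r] assms(4) by simp
  then show "AE x in M. norm (a x) \<le> norm (1 + norm (a x) powr r)"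
    by (intro AE_I2) simp
qed

lemma L1_tendsto_0_if_Lp_tendsto_0:
  fixes a :: "nat \<Rightarrow> 'x \<Rightarrow> 'b::euclidean_space"
  assumes "finite_measure M" and meas: "\<And>k. a k \<in> borel_measurable M"
    and int: "\<And>k. integrable M (\<lambda>x. norm (a k x) powr r)" and r: "r \<ge> 1"
    and lim: "(\<lambda>k. LINT x|M. norm (a k x) powr r) \<longlonglongrightarrow> 0"
  shows "(\<lambda>k. LINT x|M. norm (a k x)) \<longlonglongrightarrow> 0"
proof (rule LIMSEQ_I)
  interpret finite_measure M by fact
  fix e :: real assume "e > 0"
  define \<mu> where "\<mu> = measure M (space M)"
  \<comment> \<open>Half of \<open>e\<close> pays for \<delta> times the total measure; adding 1 to
    \<mu> avoids division by zero for a null space.\<close>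
  define \<delta> where "\<delta> = e / (2 * (\<mu> + 1))"
  have "\<mu> \<ge> 0" by (simp add: \<mu>_def)
  then have \<delta>: "\<delta> > 0" "\<delta> * \<mu> < e / 2" using \<open>e > 0\<close> by (auto simp: \<delta>_def field_simps)
  have "(\<lambda>k. \<delta> powr (1 - r) * (LINT x|M. norm (a k x) powr r)) \<longlonglongrightarrow> \<delta> powr (1 - r) * 0"
    by (intro tendsto_intros lim)
  from LIMSEQ_D[OF this, of "e / 2"] \<open>e > 0\<close>
  obtain N where N: "\<And>k. k \<ge> N \<Longrightarrow> \<bar>\<delta> powr (1 - r) * (LINT x|M. norm (a k x) powr r)\<bar> < e / 2"
    by auto
  show "\<exists>N. \<forall>k\<ge>N. norm ((LINT x|M. norm (a k x)) - 0) < e"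
  proof (intro exI allI impI)
    fix k assume "k \<ge> N"
    have "(LINT x|M. norm (a k x)) \<le> (LINT x|M. \<delta> + \<delta> powr (1 - r) * norm (a k x) powr r)"
    proof (rule integral_mono)
      show "integrable M (\<lambda>x. norm (a k x))"
        using integrable_if_powr_integrable[OF assms(1) meas int r] by simp
      show "integrable M (\<lambda>x. \<delta> + \<delta> powr (1 - r) * norm (a k x) powr r)"
        using int by simp
    qed (intro norm_le_add_powr norm_ge_zero \<delta> r)
    also have "\<dots> = \<delta> * \<mu> + \<delta> powr (1 - r) * (LINT x|M. norm (a k x) powr r)"
      using int by (simp add: \<mu>_def mult.commute)
    also have "\<dots> < e" using \<delta>(2) N[OF \<open>k \<ge> N\<close>] by linarith
    finally show "norm ((LINT x|M. norm (a k x)) - 0) < e" by simp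
  qed
qed

lemma in_Lp_bounded:
  assumes "\<Omega> \<in> lmeasurable" "v \<in> borel_measurable (lebesgue_on \<Omega>)" "\<And>x. x \<in> \<Omega> \<Longrightarrow> norm (v x) \<le> B" "r \<ge> 0"
  shows "in_Lp r \<Omega> v"
proof -
  interpret finite_measure "lebesgue_on \<Omega>" using assms(1) by (rule finite_measure_lebesgue_on)
  have [measurable]: "v \<in> borel_measurable (lebesgue_on \<Omega>)" by fact
  have "norm (v x) powr r \<le> B powr r" if "x \<in> \<Omega>" for x
    by (rule powr_mono2[OF assms(4) norm_ge_zero assms(3)[OF that]])
  then have "integrable (lebesgue_on \<Omega>) (\<lambda>x. norm (v x) powr r)"
    by (intro integrable_const_bound[of _ "B powr r"] AE_I2) (auto simp: space_restrict_space)
  with assms(2) show ?thesis by (simp add: in_Lp_def)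
qed

lemma in_Lp_continuous:
  fixes v :: "'a::euclidean_space \<Rightarrow> 'b::euclidean_space"
  assumes "open \<Omega>" "bounded \<Omega>" "continuous_on (closure \<Omega>) v" "r \<ge> 0"
  shows "in_Lp r \<Omega> v"
proof -
  have "bounded (v ` closure \<Omega>)"
    using assms(2,3) by (intro compact_imp_bounded compact_continuous_image) auto
  then obtain B where B: "\<forall>x\<in>closure \<Omega>. norm (v x) \<le> B"
    by (auto simp: bounded_iff)
  have "v \<in> borel_measurable (lebesgue_on \<Omega>)"
    using assms(1) closure_subset
    by (intro continuous_imp_measurable_on_sets_lebesgue continuous_on_subset[OF assms(3)]) auto
  moreover have "norm (v x) \<le> B" if "x \<in> \<Omega>" for x
    using B that closure_subset[of \<Omega>] by blast
  ultimately show ?thesis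
    using assms(1,2,4) by (intro in_Lp_bounded lmeasurable_open)
qed

lemma integrable_in_Lp:
  assumes "\<Omega> \<in> lmeasurable" "in_Lp r \<Omega> v" "r \<ge> 1"
  shows "integrable (lebesgue_on \<Omega>) v"
  by (rule integrable_if_powr_integrable[OF finite_measure_lebesgue_on[OF assms(1)] _ _ assms(3)])
    (use assms(2) in \<open>simp_all add: in_Lp_def\<close>)

text \<open>Membership in \<open>W1p\<close> provides some weak gradient in L^r, with which the
  chosen one agrees almost everywhere. Measurability is inherited because Lebesgue measure is
  complete, after extension by zero to the whole space.\<close>

lemma weak_grad_in_Lp:
  assumes "open \<Omega>" "u \<in> W1p r \<Omega>"
  shows "in_Lp r \<Omega> (weak_grad \<Omega> u)"
proof -
  obtain g where g: "has_weak_gradient \<Omega> u g" "in_Lp r \<Omega> g"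
    using assms(2) unfolding W1p_def by blast
  have S: "\<Omega> \<in> sets lebesgue" using assms(1) by auto
  have ae: "AE x in lebesgue_on \<Omega>. weak_grad \<Omega> u x = g x"
    by (rule weak_grad_AE_eq[OF assms(1) g(1)])
  have g_meas: "g \<in> borel_measurable (lebesgue_on \<Omega>)" using g(2) by (simp add: in_Lp_def)
  have "(\<lambda>x. if x \<in> \<Omega> then weak_grad \<Omega> u x else 0) \<in> borel_measurable lebesgue"
  proof (rule borel_measurable_AE)
    show "(\<lambda>x. if x \<in> \<Omega> then g x else 0) \<in> borel_measurable lebesgue"
      by (rule borel_measurable_if_I[OF g_meas S])
    have "AE x in lebesgue. x \<in> \<Omega> \<longrightarrow> weak_grad \<Omega> u x = g x"
      using ae S by (simp add: AE_restrict_space_iff)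
    then show "AE x in lebesgue. (if x \<in> \<Omega> then g x else 0) = (if x \<in> \<Omega> then weak_grad \<Omega> u x else 0)"
      by (rule eventually_mono) auto
  qed
  then have meas: "weak_grad \<Omega> u \<in> borel_measurable (lebesgue_on \<Omega>)"
    by (rule borel_measurable_if_D)
  moreover have "integrable (lebesgue_on \<Omega>) (\<lambda>x. norm (weak_grad \<Omega> u x) powr r)"
  proof (subst integrable_cong_AE)
    show "AE x in lebesgue_on \<Omega>. norm (weak_grad \<Omega> u x) powr r = norm (g x) powr r"
      using ae by (rule eventually_mono) simp
    show "integrable (lebesgue_on \<Omega>) (\<lambda>x. norm (g x) powr r)" using g(2) by (simp add: in_Lp_def)
  qed (use meas g_meas in measurable)
  ultimately show ?thesis by (simp add: in_Lp_def)
qed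

lemma test_function_in_Lp:
  assumes "open \<Omega>" "bounded \<Omega>" "\<phi> \<in> test_functions \<Omega>" "r \<ge> 0"
  shows "in_Lp r \<Omega> \<phi>" "in_Lp r \<Omega> (grad \<phi>)"
  by (intro in_Lp_continuous assms test_function_continuous_on[OF assms(3)]
      test_function_grad_continuous_on[OF assms(3)])+

section \<open>Testing the equation\<close>

lemma divergence_theorem_test_function:
  fixes V :: "'a::euclidean_space \<Rightarrow> 'a"
  assumes \<Omega>: "open \<Omega>" and \<phi>: "\<phi> \<in> test_functions \<Omega>" and V: "Ck_on 1 \<Omega> V"
  shows "(LINT x|lebesgue_on \<Omega>. V x \<bullet> grad \<phi> x) = - (LINT x|lebesgue_on \<Omega>. divergence V x * \<phi> x)"
proof -
  have V': "(V has_derivative frechet_derivative V (at x)) (at x)" if "x \<in> \<Omega>" for x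
    using V that by (auto simp: frechet_derivative_works)
  have comp: "((\<lambda>x. V x \<bullet> b) has_derivative (\<lambda>y. frechet_derivative V (at x) y \<bullet> b)) (at x)"
    if "x \<in> \<Omega>" for x b
    by (rule has_derivative_inner_left[OF V'[OF that]])
  have fd: "frechet_derivative (\<lambda>x. V x \<bullet> b) (at x) y = frechet_derivative V (at x) y \<bullet> b" if "x \<in> \<Omega>" for x b y
    using frechet_derivative_at[OF comp[OF that]] by metis
  have "continuous_on \<Omega> (\<lambda>x. frechet_derivative V (at x) b \<bullet> b)" if "b \<in> Basis" for b
    using V that by (intro continuous_intros) simp
  then have cont: "continuous_on \<Omega> (\<lambda>x. frechet_derivative (\<lambda>x. V x \<bullet> b) (at x) b)" if "b \<in> Basis" for b
    using that fd by (simp cong: continuous_on_cong)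
  have diff: "(\<lambda>x. V x \<bullet> b) differentiable at x" if "x \<in> \<Omega>" for x b
    using comp[OF that] by (auto simp: differentiable_def)
  have parts: "(LINT x|lebesgue_on \<Omega>. (V x \<bullet> b) * (grad \<phi> x \<bullet> b)) =
      - (LINT x|lebesgue_on \<Omega>. frechet_derivative (\<lambda>x. V x \<bullet> b) (at x) b * \<phi> x)"
    "integrable (lebesgue_on \<Omega>) (\<lambda>x. (V x \<bullet> b) * (grad \<phi> x \<bullet> b))"
    "integrable (lebesgue_on \<Omega>) (\<lambda>x. frechet_derivative (\<lambda>x. V x \<bullet> b) (at x) b * \<phi> x)"
    if "b \<in> Basis" for b
    using integral_by_parts_test_function[OF \<Omega> \<phi> that diff cont[OF that]] by simp_all
  have "(LINT x|lebesgue_on \<Omega>. V x \<bullet> grad \<phi> x) =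
      (LINT x|lebesgue_on \<Omega>. (\<Sum>b\<in>Basis. (V x \<bullet> b) * (grad \<phi> x \<bullet> b)))"
    by (intro Bochner_Integration.integral_cong refl euclidean_inner)
  also have "\<dots> = (\<Sum>b\<in>Basis. LINT x|lebesgue_on \<Omega>. (V x \<bullet> b) * (grad \<phi> x \<bullet> b))"
    by (intro Bochner_Integration.integral_sum parts(2))
  also have "\<dots> = (\<Sum>b\<in>Basis. - (LINT x|lebesgue_on \<Omega>. frechet_derivative (\<lambda>x. V x \<bullet> b) (at x) b * \<phi> x))"
    by (intro sum.cong refl parts(1))
  also have "\<dots> = - (LINT x|lebesgue_on \<Omega>. (\<Sum>b\<in>Basis. frechet_derivative (\<lambda>x. V x \<bullet> b) (at x) b * \<phi> x))"
    unfolding sum_negf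
    by (rule arg_cong[where f = uminus], rule Bochner_Integration.integral_sum[symmetric], rule parts(3))
  also have "(LINT x|lebesgue_on \<Omega>. (\<Sum>b\<in>Basis. frechet_derivative (\<lambda>x. V x \<bullet> b) (at x) b * \<phi> x)) =
      (LINT x|lebesgue_on \<Omega>. divergence V x * \<phi> x)"
    by (intro Bochner_Integration.integral_cong refl)
      (simp add: space_restrict_space fd divergence_def sum_distrib_right)
  finally show ?thesis .
qed

text \<open>For test functions this is the divergence theorem. Since \<open>V\<close> and
  \<open>f\<close> are bounded, both sides are continuous with respect to L^1 convergence of the
  function and of its gradient, and on a bounded set that follows from convergence in L^r.\<close>

lemma W1p_0_weak_equation:
  fixes V :: "'a::euclidean_space \<Rightarrow> 'a"
  assumes \<Omega>: "open \<Omega>" "bounded \<Omega>" and r: "r \<ge> 1" and v: "v \<in> W1p_0 r \<Omega>"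
    and V: "Ck_on 1 \<Omega> V" and V_bound: "\<And>x. x \<in> \<Omega> \<Longrightarrow> norm (V x) \<le> B"
    and f: "continuous_on \<Omega> f" and f_bound: "\<And>x. x \<in> \<Omega> \<Longrightarrow> \<bar>f x\<bar> \<le> B"
    and div: "\<And>x. x \<in> \<Omega> \<Longrightarrow> divergence V x + f x = 0"
  shows "integrable (lebesgue_on \<Omega>) (\<lambda>x. V x \<bullet> weak_grad \<Omega> v x)"
    and "integrable (lebesgue_on \<Omega>) (\<lambda>x. f x * v x)"
    and "(LINT x|lebesgue_on \<Omega>. V x \<bullet> weak_grad \<Omega> v x) = (LINT x|lebesgue_on \<Omega>. f x * v x)"
proof -
  let ?M = "lebesgue_on \<Omega>"
  have lm: "\<Omega> \<in> lmeasurable" and S: "\<Omega> \<in> sets lebesgue" using \<Omega> by (auto simp: lmeasurable_open)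
  have fin: "finite_measure ?M" using lm by (rule finite_measure_lebesgue_on)
  have r0: "r \<ge> 0" using r by simp
  have v1: "v \<in> W1p r \<Omega>" using v by (simp add: W1p_0_def)
  have vL: "in_Lp r \<Omega> v" using v1 by (simp add: W1p_def)
  have gL: "in_Lp r \<Omega> (weak_grad \<Omega> v)" by (rule weak_grad_in_Lp[OF \<Omega>(1) v1])
  have V_cont: "continuous_on \<Omega> V" by (rule Ck_on_imp_continuous_on[OF V])
  have V_meas [measurable]: "V \<in> borel_measurable ?M"
    by (rule continuous_imp_measurable_on_sets_lebesgue[OF V_cont S])
  have f_meas [measurable]: "f \<in> borel_measurable ?M"
    by (rule continuous_imp_measurable_on_sets_lebesgue[OF f S])
  have V_int: "integrable ?M (\<lambda>x. V x \<bullet> a x)"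
    and V_le: "\<bar>LINT x|?M. V x \<bullet> a x\<bar> \<le> B * (LINT x|?M. norm (a x))" if a: "integrable ?M a" for a
  proof -
    have [measurable]: "a \<in> borel_measurable ?M" using a by simp
    have "\<bar>V x \<bullet> a x\<bar> \<le> B * norm (a x)" if "x \<in> \<Omega>" for x
      by (rule order_trans[OF Cauchy_Schwarz_ineq2 mult_right_mono[OF V_bound[OF that]]]) simp
    then have ae: "AE x in ?M. norm (V x \<bullet> a x) \<le> B * norm (a x)"
      by (intro AE_I2) (simp add: space_restrict_space)
    have aint: "integrable ?M (\<lambda>x. B * norm (a x))" using a by simp
    show int: "integrable ?M (\<lambda>x. V x \<bullet> a x)"
      using ae by (intro Bochner_Integration.integrable_bound[OF aint]) (auto elim!: eventually_mono)
    have "norm (LINT x|?M. V x \<bullet> a x) \<le> (LINT x|?M. norm (V x \<bullet> a x))"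
      by (rule integral_norm_bound)
    also have "\<dots> \<le> (LINT x|?M. B * norm (a x))"
      by (rule integral_mono_AE[OF integrable_norm[OF int] aint ae])
    finally show "\<bar>LINT x|?M. V x \<bullet> a x\<bar> \<le> B * (LINT x|?M. norm (a x))" by simp
  qed
  have f_int: "integrable ?M (\<lambda>x. f x * a x)"
    and f_le: "\<bar>LINT x|?M. f x * a x\<bar> \<le> B * (LINT x|?M. norm (a x))" if a: "integrable ?M a"
    for a :: "'a \<Rightarrow> real"
  proof -
    have [measurable]: "a \<in> borel_measurable ?M" using a by simp
    have "\<bar>f x * a x\<bar> \<le> B * norm (a x)" if "x \<in> \<Omega>" for x
      using f_bound[OF that] by (auto simp: abs_mult intro: mult_right_mono)
    then have ae: "AE x in ?M. norm (f x * a x) \<le> B * norm (a x)"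
      by (intro AE_I2) (simp add: space_restrict_space)
    have aint: "integrable ?M (\<lambda>x. B * norm (a x))" using a by simp
    show int: "integrable ?M (\<lambda>x. f x * a x)"
      using ae by (intro Bochner_Integration.integrable_bound[OF aint]) (auto elim!: eventually_mono)
    have "norm (LINT x|?M. f x * a x) \<le> (LINT x|?M. norm (f x * a x))"
      by (rule integral_norm_bound)
    also have "\<dots> \<le> (LINT x|?M. B * norm (a x))"
      by (rule integral_mono_AE[OF integrable_norm[OF int] aint ae])
    finally show "\<bar>LINT x|?M. f x * a x\<bar> \<le> B * (LINT x|?M. norm (a x))" by simp
  qed
  have vi: "integrable ?M v" and gi: "integrable ?M (weak_grad \<Omega> v)"
    using integrable_in_Lp[OF lm _ r] vL gL by blast+
  show "integrable ?M (\<lambda>x. V x \<bullet> weak_grad \<Omega> v x)" "integrable ?M (\<lambda>x. f x * v x)"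
    by (intro V_int f_int vi gi)+
  obtain \<phi> where \<phi>: "\<And>k. \<phi> k \<in> test_functions \<Omega>"
    and lim: "(\<lambda>k. (LINT x|?M. \<bar>\<phi> k x - v x\<bar> powr r) +
             (LINT x|?M. norm (grad (\<phi> k) x - weak_grad \<Omega> v x) powr r)) \<longlonglongrightarrow> 0"
    using v unfolding W1p_0_def by blast
  note \<phi>L = test_function_in_Lp[OF \<Omega> \<phi> r0]
  have \<phi>i: "integrable ?M (\<phi> k)" "integrable ?M (grad (\<phi> k))" for k
    using integrable_in_Lp[OF lm _ r] \<phi>L by blast+
  \<comment> \<open>A sum of two nonnegative sequences tends to 0, so each of them does.\<close>
  have lim1: "(\<lambda>k. LINT x|?M. norm (\<phi> k x - v x) powr r) \<longlonglongrightarrow> 0"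
    by (rule tendsto_sandwich[OF _ _ tendsto_const lim]) (auto intro!: always_eventually integral_nonneg_AE)
  have lim2: "(\<lambda>k. LINT x|?M. norm (grad (\<phi> k) x - weak_grad \<Omega> v x) powr r) \<longlonglongrightarrow> 0"
    by (rule tendsto_sandwich[OF _ _ tendsto_const lim]) (auto intro!: always_eventually integral_nonneg_AE)
  have L1: "(\<lambda>k. LINT x|?M. norm (\<phi> k x - v x)) \<longlonglongrightarrow> 0"
    using \<phi>L vL unfolding in_Lp_def
    by (intro L1_tendsto_0_if_Lp_tendsto_0[OF fin _ _ r lim1] integrable_norm_diff_powr
        borel_measurable_diff r0) auto
  have L2: "(\<lambda>k. LINT x|?M. norm (grad (\<phi> k) x - weak_grad \<Omega> v x)) \<longlonglongrightarrow> 0"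
    using \<phi>L gL unfolding in_Lp_def
    by (intro L1_tendsto_0_if_Lp_tendsto_0[OF fin _ _ r lim2] integrable_norm_diff_powr
        borel_measurable_diff r0) auto
  have "(\<lambda>k. (LINT x|?M. V x \<bullet> grad (\<phi> k) x) - (LINT x|?M. V x \<bullet> weak_grad \<Omega> v x)) \<longlonglongrightarrow> 0"
  proof (rule Lim_null_comparison)
    show "(\<lambda>k. B * (LINT x|?M. norm (grad (\<phi> k) x - weak_grad \<Omega> v x))) \<longlonglongrightarrow> 0"
      using tendsto_mult_right_zero[OF L2] .
    have "(LINT x|?M. V x \<bullet> grad (\<phi> k) x) - (LINT x|?M. V x \<bullet> weak_grad \<Omega> v x) =
        (LINT x|?M. V x \<bullet> (grad (\<phi> k) x - weak_grad \<Omega> v x))" for k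
      using V_int[OF \<phi>i(2)] V_int[OF gi] by (simp add: inner_diff_right)
    then show "\<forall>\<^sub>F k in sequentially. norm ((LINT x|?M. V x \<bullet> grad (\<phi> k) x) - (LINT x|?M. V x \<bullet> weak_grad \<Omega> v x))
        \<le> B * (LINT x|?M. norm (grad (\<phi> k) x - weak_grad \<Omega> v x))"
      using V_le[OF Bochner_Integration.integrable_diff[OF \<phi>i(2) gi]]
      by (intro always_eventually allI) simp
  qed
  moreover have "(\<lambda>k. (LINT x|?M. f x * \<phi> k x) - (LINT x|?M. f x * v x)) \<longlonglongrightarrow> 0"
  proof (rule Lim_null_comparison)
    show "(\<lambda>k. B * (LINT x|?M. norm (\<phi> k x - v x))) \<longlonglongrightarrow> 0"
      using tendsto_mult_right_zero[OF L1] .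
    have "(LINT x|?M. f x * \<phi> k x) - (LINT x|?M. f x * v x) = (LINT x|?M. f x * (\<phi> k x - v x))" for k
      using f_int[OF \<phi>i(1)] f_int[OF vi] by (simp add: right_diff_distrib)
    then show "\<forall>\<^sub>F k in sequentially. norm ((LINT x|?M. f x * \<phi> k x) - (LINT x|?M. f x * v x))
        \<le> B * (LINT x|?M. norm (\<phi> k x - v x))"
      using f_le[OF Bochner_Integration.integrable_diff[OF \<phi>i(1) vi]]
      by (intro always_eventually allI) simp
  qed
  moreover have "(LINT x|?M. V x \<bullet> grad (\<phi> k) x) = (LINT x|?M. f x * \<phi> k x)" for k
  proof -
    have "- (LINT x|?M. divergence V x * \<phi> k x) = (LINT x|?M. - (divergence V x * \<phi> k x))" by simp
    also have "\<dots> = (LINT x|?M. f x * \<phi> k x)"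
    proof (intro Bochner_Integration.integral_cong refl)
      fix x assume "x \<in> space ?M"
      then have "f x = - divergence V x" using div[of x] by (simp add: space_restrict_space)
      then show "- (divergence V x * \<phi> k x) = f x * \<phi> k x" by simp
    qed
    finally show ?thesis using divergence_theorem_test_function[OF \<Omega>(1) \<phi> V] by simp
  qed
  \<comment> \<open>Both sequences have the same varying term; their difference is constant, hence
    equal to its limit 0.\<close>
  ultimately have "(\<lambda>k. (LINT x|?M. f x * \<phi> k x) - (LINT x|?M. V x \<bullet> weak_grad \<Omega> v x)) \<longlonglongrightarrow> 0"
    and "(\<lambda>k. (LINT x|?M. f x * \<phi> k x) - (LINT x|?M. f x * v x)) \<longlonglongrightarrow> 0" by simp_all
  from tendsto_diff[OF this]
  show "(LINT x|?M. V x \<bullet> weak_grad \<Omega> v x) = (LINT x|?M. f x * v x)"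
    by (simp add: LIMSEQ_const_iff)
qed

section \<open>Minimality\<close>

lemma powr_mult_le_Young:
  fixes A B p :: real
  assumes "p > 1" "A \<ge> 0" "B \<ge> 0"
  shows "p * (A powr (p - 1) * B) \<le> (p - 1) * A powr p + B powr p"
proof -
  have "A powr (p - 1) * B \<le> (A powr (p - 1)) powr (p / (p - 1)) / (p / (p - 1)) + B powr p / p"
    using assms by (intro Youngs_inequality) (auto simp: field_simps)
  also have "(A powr (p - 1)) powr (p / (p - 1)) = A powr p"
    using assms by (simp add: powr_powr)
  finally show ?thesis using assms by (simp add: field_simps)
qed

text \<open>With \<open>A = sqrt (|\<xi>|\<^sup>2 + \<kappa>)\<close> and \<open>B = sqrt (|\<eta>|\<^sup>2 + \<kappa>)\<close>, Cauchy--Schwarz in one more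
  dimension gives \<open>\<xi> \<bullet> \<eta> + \<kappa> \<le> A * B\<close>, and then Young's inequality applies.\<close>

lemma energy_density_convex:
  fixes \<xi> \<eta> :: "'a::real_inner"
  assumes p: "p > 1" and \<kappa>: "\<kappa> \<ge> 0"
  shows "1 / p * ((norm \<xi>)\<^sup>2 + \<kappa>) powr (p / 2) +
      (((norm \<xi>)\<^sup>2 + \<kappa>) powr ((p - 2) / 2) *\<^sub>R \<xi>) \<bullet> (\<eta> - \<xi>)
    \<le> 1 / p * ((norm \<eta>)\<^sup>2 + \<kappa>) powr (p / 2)"
proof -
  define A where "A = sqrt ((norm \<xi>)\<^sup>2 + \<kappa>)"
  define B where "B = sqrt ((norm \<eta>)\<^sup>2 + \<kappa>)"
  have AB: "A \<ge> 0" "B \<ge> 0" "(norm \<xi>)\<^sup>2 + \<kappa> = A\<^sup>2" "(norm \<eta>)\<^sup>2 + \<kappa> = B\<^sup>2"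
    using \<kappa> by (auto simp: A_def B_def)
  have "\<xi> \<bullet> \<eta> + \<kappa> \<le> norm \<xi> * norm \<eta> + \<kappa>"
    using norm_cauchy_schwarz by simp
  also have "\<dots> \<le> A * B"
  proof (rule power2_le_imp_le)
    have "2 * (norm \<xi> * norm \<eta>) \<le> (norm \<xi>)\<^sup>2 + (norm \<eta>)\<^sup>2"
      using sum_squares_bound[of "norm \<xi>" "norm \<eta>"] by (simp add: mult.assoc)
    from mult_left_mono[OF this \<kappa>]
    have "(norm \<xi> * norm \<eta> + \<kappa>)\<^sup>2 \<le> ((norm \<xi>)\<^sup>2 + \<kappa>) * ((norm \<eta>)\<^sup>2 + \<kappa>)"
      by (simp add: power2_eq_square algebra_simps)
    then show "(norm \<xi> * norm \<eta> + \<kappa>)\<^sup>2 \<le> (A * B)\<^sup>2"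
      by (simp only: AB power_mult_distrib)
  qed (use AB in auto)
  finally have cs: "\<xi> \<bullet> \<eta> + \<kappa> \<le> A * B" .
  show ?thesis
  \<comment> \<open>If A = 0, then \<xi> and \<kappa> vanish and every power of A reads as 0, also
    one with negative exponent, so the left side is 0.\<close>
  proof (cases "A = 0")
    case True
    then show ?thesis using p by (simp add: AB)
  next
    case False
    then have A: "A > 0" using AB by simp
    \<comment> \<open>Adding and subtracting \<kappa> replaces |\<xi>|^2 by A^2 and brings in the
      quantity bounded by A B.\<close>
    have "(((norm \<xi>)\<^sup>2 + \<kappa>) powr ((p - 2) / 2) *\<^sub>R \<xi>) \<bullet> (\<eta> - \<xi>) =
        A powr (p - 2) * ((\<xi> \<bullet> \<eta> + \<kappa>) - A\<^sup>2)"
      unfolding AB(3)[symmetric] power2_powr_half[OF AB(1), symmetric]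
      by (simp add: AB(3)[symmetric] inner_diff_right right_diff_distrib power2_norm_eq_inner)
    also have "\<dots> \<le> A powr (p - 2) * (A * B - A\<^sup>2)"
      using cs by (intro mult_left_mono) auto
    also have "\<dots> = A powr (p - 1) * B - A powr p"
    proof -
      have "A powr (p - 2) * A = A powr (p - 1)" "A powr (p - 2) * A\<^sup>2 = A powr p"
        using A powr_add[of A "p - 2" 1] powr_add[of A "p - 2" 2] by simp_all
      then show ?thesis by (simp add: right_diff_distrib flip: mult.assoc)
    qed
    finally have "p * ((((norm \<xi>)\<^sup>2 + \<kappa>) powr ((p - 2) / 2) *\<^sub>R \<xi>) \<bullet> (\<eta> - \<xi>)) \<le>
        p * (A powr (p - 1) * B - A powr p)"
      using p by (intro mult_left_mono) auto
    also have "\<dots> \<le> B powr p - A powr p"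
      using powr_mult_le_Young[OF p AB(1,2)] by (simp add: algebra_simps)
    finally have "(((norm \<xi>)\<^sup>2 + \<kappa>) powr ((p - 2) / 2) *\<^sub>R \<xi>) \<bullet> (\<eta> - \<xi>) \<le> (B powr p - A powr p) / p"
      using p by (simp add: field_simps)
    then show ?thesis
      unfolding AB(3,4) power2_powr_half[OF AB(1)] power2_powr_half[OF AB(2)]
      by (simp add: diff_divide_distrib)
  qed
qed

lemma energy_density_integrable:
  assumes "\<Omega> \<in> lmeasurable" "in_Lp p \<Omega> g" "p \<ge> 0" "\<kappa> \<ge> 0"
  shows "integrable (lebesgue_on \<Omega>) (\<lambda>x. ((norm (g x))\<^sup>2 + \<kappa>) powr (p / 2))"
proof (rule Bochner_Integration.integrable_bound)
  interpret finite_measure "lebesgue_on \<Omega>" using assms(1) by (rule finite_measure_lebesgue_on)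
  have [measurable]: "g \<in> borel_measurable (lebesgue_on \<Omega>)" using assms(2) by (simp add: in_Lp_def)
  show "(\<lambda>x. ((norm (g x))\<^sup>2 + \<kappa>) powr (p / 2)) \<in> borel_measurable (lebesgue_on \<Omega>)" by measurable
  show "integrable (lebesgue_on \<Omega>) (\<lambda>x. 2 powr (p / 2) * (norm (g x) powr p + \<kappa> powr (p / 2)))"
    using assms(2) by (simp add: in_Lp_def)
  have "((norm (g x))\<^sup>2 + \<kappa>) powr (p / 2) \<le> 2 powr (p / 2) * (norm (g x) powr p + \<kappa> powr (p / 2))" for x
    using powr_add_le[of "(norm (g x))\<^sup>2" \<kappa> "p / 2"] assms(3,4) power2_powr_half[of "norm (g x)" p]
    by simp
  then show "AE x in lebesgue_on \<Omega>. norm (((norm (g x))\<^sup>2 + \<kappa>) powr (p / 2)) \<le>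
      norm (2 powr (p / 2) * (norm (g x) powr p + \<kappa> powr (p / 2)))"
    by (intro AE_I2) simp
qed

lemma Lp_tendsto_0_if_bounded:
  fixes a :: "nat \<Rightarrow> 'a::euclidean_space \<Rightarrow> 'b::euclidean_space"
  assumes "\<Omega> \<in> lmeasurable" "\<And>k. a k \<in> borel_measurable (lebesgue_on \<Omega>)"
    and bound: "\<And>k x. x \<in> \<Omega> \<Longrightarrow> norm (a k x) \<le> B"
    and lim: "\<And>x. x \<in> \<Omega> \<Longrightarrow> (\<lambda>k. a k x) \<longlonglongrightarrow> 0" and r: "r > 0"
  shows "(\<lambda>k. LINT x|lebesgue_on \<Omega>. norm (a k x) powr r) \<longlonglongrightarrow> 0"
proof -
  interpret finite_measure "lebesgue_on \<Omega>" using assms(1) by (rule finite_measure_lebesgue_on)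
  note [measurable] = assms(2)
  have "(\<lambda>k. LINT x|lebesgue_on \<Omega>. norm (a k x) powr r) \<longlonglongrightarrow> (LINT x|lebesgue_on \<Omega>. (0::real))"
  proof (rule integral_dominated_convergence)
    show "integrable (lebesgue_on \<Omega>) (\<lambda>x. B powr r)" by simp
    show "AE x in lebesgue_on \<Omega>. norm (norm (a k x) powr r) \<le> B powr r" for k
      using powr_mono2[OF less_imp_le[OF r] norm_ge_zero bound]
      by (intro AE_I2) (simp add: space_restrict_space)
    show "AE x in lebesgue_on \<Omega>. (\<lambda>k. norm (a k x) powr r) \<longlonglongrightarrow> 0"
    proof (intro AE_I2)
      fix x assume "x \<in> space (lebesgue_on \<Omega>)"
      then have "(\<lambda>k. norm (a k x)) \<longlonglongrightarrow> 0"
        by (intro tendsto_norm_zero lim) (simp add: space_restrict_space)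
      from tendsto_powr'[OF this tendsto_const, of r] r
      show "(\<lambda>k. norm (a k x) powr r) \<longlonglongrightarrow> 0" by simp
    qed
  qed measurable
  then show ?thesis by simp
qed

lemma absolutely_integrable_on_compact:
  fixes g :: "'a::euclidean_space \<Rightarrow> 'b::euclidean_space"
  assumes "compact K" "continuous_on K g"
  shows "g absolutely_integrable_on K"
proof -
  have "integrable lborel (\<lambda>x. indicator K x *\<^sub>R g x)"
    by (rule borel_integrable_compact[OF assms])
  then show ?thesis
    unfolding set_integrable_def by (subst integrable_completion) auto
qed

lemma has_weak_gradient_C1:
  assumes "open \<Omega>" "Ck_on 1 \<Omega> u"
  shows "has_weak_gradient \<Omega> u (grad u)"
  unfolding has_weak_gradient_def
proof (intro conjI ballI)
  have cont: "continuous_on \<Omega> u" by (rule Ck_on_imp_continuous_on[OF assms(2)])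
  have fd: "continuous_on \<Omega> (\<lambda>x. frechet_derivative u (at x) b)" if "b \<in> Basis" for b
    using assms(2) that by simp
  then have "continuous_on \<Omega> (grad u)"
    unfolding grad_def by (intro continuous_intros) auto
  with cont show "locally_integrable \<Omega> u" "locally_integrable \<Omega> (grad u)"
    unfolding locally_integrable_def
    by (auto intro!: absolutely_integrable_on_compact intro: continuous_on_subset)
  fix \<phi> b assume "\<phi> \<in> test_functions \<Omega>" and b: "b \<in> (Basis :: 'a set)"
  then show "(LINT x|lebesgue_on \<Omega>. u x * (grad \<phi> x \<bullet> b)) =
      - (LINT x|lebesgue_on \<Omega>. (grad u x \<bullet> b) * \<phi> x)"
    using integral_by_parts_test_function(1)[OF assms(1) _ b _ fd[OF b]] assms(2)
    unfolding grad_inner[OF b] by simp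
qed

context annulus_problem
begin

lemma lmeasurable_\<Omega>: "\<Omega> \<in> lmeasurable"
  by (intro lmeasurable_open bounded_annulus open_annulus)

lemma sets_\<Omega>: "\<Omega> \<in> sets lebesgue"
  by (rule fmeasurableD[OF lmeasurable_\<Omega>])

lemma p_gt_1: "p > 1"
  using p by auto

lemma bounded_on_interval:
  fixes g :: "real \<Rightarrow> real"
  assumes "continuous_on {R1..R2} g"
  obtains B where "B \<ge> 0" "\<And>x. x \<in> \<Omega> \<Longrightarrow> \<bar>g (dist x c)\<bar> \<le> B"
proof -
  have "bounded (g ` {R1..R2})"
    by (intro compact_imp_bounded compact_continuous_image assms) simp
  then obtain B where "\<forall>r\<in>{R1..R2}. \<bar>g r\<bar> \<le> B" by (auto simp: bounded_iff)
  then have "\<bar>g (dist x c)\<bar> \<le> max B 0" if "x \<in> \<Omega>" for x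
    using dist_in[OF that] by (simp add: le_max_iff_disj)
  then show ?thesis by (intro that[of "max B 0"]) auto
qed

section \<open>Membership of \<open>u\<close> in the Sobolev spaces\<close>

lemma weak_grad_u: "AE x in lebesgue_on \<Omega>. weak_grad \<Omega> u x = grad u x"
  by (intro weak_grad_AE_eq open_annulus has_weak_gradient_C1 Ck_on_u)

lemma norm_grad_u:
  assumes "x \<in> \<Omega>"
  shows "norm (grad u x) = \<bar>w (dist x c)\<bar>"
proof -
  have "norm (x - c) = dist x c" by (simp add: dist_norm)
  then show ?thesis using dist_in[OF assms] by (simp add: grad_u[OF assms])
qed

lemma grad_u_measurable: "grad u \<in> borel_measurable (lebesgue_on \<Omega>)"
proof (rule continuous_imp_measurable_on_sets_lebesgue)
  have [continuous_intros]: "continuous_on \<Omega> (\<lambda>x. w (dist x c))"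
    by (intro continuous_on_dist_compose w_cont)
  have "continuous_on \<Omega> (\<lambda>x. (w (dist x c) / dist x c) *\<^sub>R (x - c))"
    using dist_in by (intro continuous_intros) auto
  then show "continuous_on \<Omega> (grad u)" by (simp add: grad_u cong: continuous_on_cong)
qed (rule sets_\<Omega>)

lemma u_measurable: "u \<in> borel_measurable (lebesgue_on \<Omega>)"
  by (intro continuous_imp_measurable_on_sets_lebesgue continuous_on_subset[OF u_cont]
      closure_subset sets_\<Omega>)

lemma u_in_W1p: "u \<in> W1p p \<Omega>"
proof -
  obtain B where "B \<ge> 0" "\<And>x. x \<in> \<Omega> \<Longrightarrow> \<bar>w (dist x c)\<bar> \<le> B"
    using bounded_on_interval[OF w_cont] by metis
  then have "in_Lp p \<Omega> (grad u)"
    using p_gt_1 by (intro in_Lp_bounded[of _ _ B] lmeasurable_\<Omega> grad_u_measurable) (auto simp: norm_grad_u)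
  moreover have "in_Lp p \<Omega> u"
    using p_gt_1 by (intro in_Lp_continuous open_annulus bounded_annulus u_cont) auto
  moreover have "has_weak_gradient \<Omega> u (grad u)"
    by (intro has_weak_gradient_C1 open_annulus Ck_on_u)
  ultimately show ?thesis unfolding W1p_def by blast
qed

lemma norm_square_in:
  assumes "x \<in> \<Omega>"
  shows "(norm (x - c))\<^sup>2 \<in> {R1\<^sup>2<..<R2\<^sup>2}"
  using dist_in[OF assms] R1 by (auto simp: dist_norm intro!: power_strict_mono)

lemma radial_test_function:
  assumes "\<And>m. Ck_on m UNIV \<Phi>" "\<delta> > 0" "\<And>t. t \<notin> {R1\<^sup>2 + \<delta>..R2\<^sup>2 - \<delta>} \<Longrightarrow> \<Phi> t = 0"
  shows "(\<lambda>x. \<Phi> ((norm (x - c))\<^sup>2)) \<in> test_functions \<Omega>"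
proof -
  let ?K = "{x. R1\<^sup>2 + \<delta> \<le> (norm (x - c))\<^sup>2 \<and> (norm (x - c))\<^sup>2 \<le> R2\<^sup>2 - \<delta>}"
  have K: "?K \<subseteq> \<Omega>"
  proof
    fix x assume "x \<in> ?K"
    then have "R1\<^sup>2 < (norm (x - c))\<^sup>2" "(norm (x - c))\<^sup>2 < R2\<^sup>2" using assms(2) by auto
    then have "R1 < norm (x - c)" "norm (x - c) < R2"
      using R1 R12 by (auto intro: power2_less_imp_less)
    then show "x \<in> \<Omega>" by (simp add: annulus_eq dist_norm)
  qed
  have "closed ?K"
    by (intro closed_Collect_conj closed_Collect_le continuous_intros)
  then have sub: "closure {x. \<Phi> ((norm (x - c))\<^sup>2) \<noteq> 0} \<subseteq> ?K"
  proof (rule closure_minimal[rotated])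
    show "{x. \<Phi> ((norm (x - c))\<^sup>2) \<noteq> 0} \<subseteq> ?K"
      using assms(3) unfolding atLeastAtMost_iff by blast
  qed
  then have "closure {x. \<Phi> ((norm (x - c))\<^sup>2) \<noteq> 0} \<subseteq> \<Omega>" using K by blast
  moreover from this have "compact (closure {x. \<Phi> ((norm (x - c))\<^sup>2) \<noteq> 0})"
    using bounded_subset[OF bounded_annulus] compact_eq_bounded_closed closed_closure by blast
  moreover have "Ck_on m UNIV (\<lambda>x. \<Phi> ((norm (x - c))\<^sup>2))" for m
    by (rule Ck_on_compose_real[OF assms(1) Ck_on_norm_square])
  ultimately show ?thesis by (simp add: test_functions_def)
qed

lemma grad_radial:
  assumes "\<And>t. (\<Phi> has_real_derivative \<Phi>' t) (at t)"
  shows "grad (\<lambda>x. \<Phi> ((norm (x - c))\<^sup>2)) x = (2 * \<Phi>' ((norm (x - c))\<^sup>2)) *\<^sub>R (x - c)"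
proof (rule grad_eq)
  have "((\<lambda>x. (x - c) \<bullet> (x - c)) has_derivative (\<lambda>y. 2 * ((x - c) \<bullet> y))) (at x)"
    by (auto intro!: derivative_eq_intros simp: inner_commute)
  then have "((\<lambda>x. (norm (x - c))\<^sup>2) has_derivative (\<lambda>y. 2 * ((x - c) \<bullet> y))) (at x)"
    by (simp add: power2_norm_eq_inner)
  from has_derivative_compose[OF this assms[unfolded has_field_derivative_def]]
  show "((\<lambda>x. \<Phi> ((norm (x - c))\<^sup>2)) has_derivative
      (\<lambda>y. ((2 * \<Phi>' ((norm (x - c))\<^sup>2)) *\<^sub>R (x - c)) \<bullet> y)) (at x)"
    by (rule has_derivative_eq_rhs) (simp add: fun_eq_iff)
qed

text \<open>The approximation is carried out in the variable \<open>t = |x - c|\<^sup>2\<close>, a polynomial in \<open>x\<close>.\<close>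

lemma u_in_W1p_0: "u \<in> W1p_0 p \<Omega>"
proof -
  define a where "a = R1\<^sup>2"
  define b where "b = R2\<^sup>2"
  \<comment> \<open>The derivative of U (sqrt t), chosen so that 2 W(|x - c|^2) (x - c) is the
    gradient of \<open>u\<close>. Its integral is U R2 - U R1 = 0.\<close>
  define W where "W t = w (sqrt t) / (2 * sqrt t)" for t
  have "R1\<^sup>2 < R2\<^sup>2" using R1 R12 by (intro power_strict_mono) simp_all
  then have ab: "a < b" "0 < a" using R1 by (simp_all add: a_def b_def)
  have sqrt_ab: "sqrt a = R1" "sqrt b = R2" using R1 R12 by (simp_all add: a_def b_def)
  have sqrt_in: "sqrt t \<in> {R1..R2}" if "t \<in> {a..b}" for t
    using that real_sqrt_le_mono[of a t] real_sqrt_le_mono[of t b] by (simp add: sqrt_ab)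
  have sqrt_in': "R1 < sqrt t" "sqrt t < R2" if "t \<in> {a<..<b}" for t
    using that real_sqrt_less_mono[of a t] real_sqrt_less_mono[of t b] by (simp_all add: sqrt_ab)
  have W_cont: "continuous_on {a..b} W"
    unfolding W_def using sqrt_in ab
    by (intro continuous_intros continuous_on_compose2[OF w_cont]) auto
  have W_int: "integral {a..t} W = U (sqrt t)" if t: "t \<in> {a..b}" for t
  proof -
    have "(W has_integral U (sqrt t) - U (sqrt a)) {a..t}"
    \<comment> \<open>\<open>U\<close> has a two-sided derivative only between the radii; continuity
      suffices at the endpoints.\<close>
    proof (rule fundamental_theorem_of_calculus_interior)
      show "continuous_on {a..t} (\<lambda>t. U (sqrt t))"
        using sqrt_in t by (intro continuous_on_compose2[OF U_cont] continuous_intros) auto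
      fix z assume "z \<in> {a<..<t}"
      then have z: "z \<in> {a<..<b}" "z > 0" using t ab by auto
      have "((\<lambda>t. U (sqrt t)) has_real_derivative w (sqrt z) * (inverse (sqrt z) / 2)) (at z)"
        by (rule DERIV_chain2[OF U_deriv[OF sqrt_in'[OF z(1)]] DERIV_real_sqrt[OF z(2)]])
      also have "w (sqrt z) * (inverse (sqrt z) / 2) = W z"
        by (simp add: W_def inverse_eq_divide)
      finally show "((\<lambda>t. U (sqrt t)) has_vector_derivative W z) (at z)"
        by (rule has_real_derivative_iff_has_vector_derivative[THEN iffD1])
    qed (use t in auto)
    then show ?thesis by (simp add: integral_unique sqrt_ab U_R1)
  qed
  have W0: "integral {a..b} W = 0" using W_int[of b] ab by (simp add: sqrt_ab U_R2)
  obtain \<Phi> \<Phi>' B where \<Phi>: "\<And>k m. Ck_on m UNIV (\<Phi> k)"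
    "\<And>k t. (\<Phi> k has_real_derivative \<Phi>' k t) (at t)"
    "\<And>k. \<exists>\<delta>>0. \<forall>t. t \<notin> {a + \<delta>..b - \<delta>} \<longrightarrow> \<Phi> k t = 0"
    "\<And>k t. \<bar>\<Phi> k t\<bar> \<le> B"
    "\<And>k t. \<bar>\<Phi>' k t\<bar> \<le> B"
    "\<And>t. t \<in> {a<..<b} \<Longrightarrow> (\<lambda>k. \<Phi> k t) \<longlonglongrightarrow> integral {a..t} W"
    "\<And>t. t \<in> {a<..<b} \<Longrightarrow> (\<lambda>k. \<Phi>' k t) \<longlonglongrightarrow> W t"
    by (rule smooth_compactly_supported_approximation[OF ab(1) W_cont W0], rule that) assumption+
  have B: "B \<ge> 0" by (rule order_trans[OF abs_ge_zero \<Phi>(4)])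
  define \<phi> where "\<phi> k x = \<Phi> k ((norm (x - c))\<^sup>2)" for k and x :: 'a
  have test: "\<phi> k \<in> test_functions \<Omega>" for k
  proof -
    obtain \<delta> where \<delta>: "\<delta> > 0" "\<And>t. t \<notin> {R1\<^sup>2 + \<delta>..R2\<^sup>2 - \<delta>} \<Longrightarrow> \<Phi> k t = 0"
      using \<Phi>(3)[of k] unfolding a_def b_def by blast
    show ?thesis unfolding \<phi>_def by (rule radial_test_function[OF \<Phi>(1) \<delta>])
  qed
  have grad_\<phi>: "grad (\<phi> k) x = (2 * \<Phi>' k ((norm (x - c))\<^sup>2)) *\<^sub>R (x - c)" for k x
    unfolding \<phi>_def[abs_def] by (rule grad_radial[OF \<Phi>(2)])
  have sq_in: "(norm (x - c))\<^sup>2 \<in> {a<..<b}" "sqrt ((norm (x - c))\<^sup>2) = dist x c" if "x \<in> \<Omega>" for x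
    using norm_square_in[OF that] by (auto simp: a_def b_def dist_norm)
  have lim_\<phi>: "(\<lambda>k. \<phi> k x) \<longlonglongrightarrow> u x" if "x \<in> \<Omega>" for x
    using \<Phi>(6)[OF sq_in(1)[OF that]] W_int[of "(norm (x - c))\<^sup>2"] sq_in[OF that]
    by (simp add: \<phi>_def u_def)
  have lim_grad: "(\<lambda>k. grad (\<phi> k) x) \<longlonglongrightarrow> grad u x" if "x \<in> \<Omega>" for x
  proof -
    have "(\<lambda>k. (2 * \<Phi>' k ((norm (x - c))\<^sup>2)) *\<^sub>R (x - c)) \<longlonglongrightarrow> (2 * W ((norm (x - c))\<^sup>2)) *\<^sub>R (x - c)"
      by (intro tendsto_intros \<Phi>(7) sq_in[OF that])
    moreover have "2 * W ((norm (x - c))\<^sup>2) = w (dist x c) / dist x c"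
      unfolding W_def sq_in(2)[OF that] by simp
    ultimately show ?thesis by (simp add: grad_\<phi> grad_u[OF that])
  qed
  obtain Bu where Bu: "\<And>x. x \<in> \<Omega> \<Longrightarrow> \<bar>U (dist x c)\<bar> \<le> Bu"
    using bounded_on_interval[OF U_cont] by metis
  obtain Bw where Bw: "\<And>x. x \<in> \<Omega> \<Longrightarrow> \<bar>w (dist x c)\<bar> \<le> Bw"
    using bounded_on_interval[OF w_cont] by metis
  have meas: "\<phi> k \<in> borel_measurable (lebesgue_on \<Omega>)" "grad (\<phi> k) \<in> borel_measurable (lebesgue_on \<Omega>)" for k
    by (intro continuous_imp_measurable_on_sets_lebesgue test_function_continuous_on[OF test]
        test_function_grad_continuous_on[OF test] sets_\<Omega>)+
  have "(\<lambda>k. LINT x|lebesgue_on \<Omega>. norm (\<phi> k x - u x) powr p) \<longlonglongrightarrow> 0"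
  proof (rule Lp_tendsto_0_if_bounded[where B = "B + Bu", OF lmeasurable_\<Omega>])
    show "norm (\<phi> k x - u x) \<le> B + Bu" if "x \<in> \<Omega>" for k x
      using \<Phi>(4)[of k "(norm (x - c))\<^sup>2"] Bu[OF that] unfolding \<phi>_def u_def real_norm_def by linarith
    show "(\<lambda>k. \<phi> k x - u x) \<longlonglongrightarrow> 0" if "x \<in> \<Omega>" for x
      using lim_\<phi>[OF that] by (simp add: LIM_zero)
  qed (use meas u_measurable p_gt_1 in auto)
  moreover have "(\<lambda>k. LINT x|lebesgue_on \<Omega>. norm (grad (\<phi> k) x - weak_grad \<Omega> u x) powr p) \<longlonglongrightarrow> 0"
  proof -
    have "(\<lambda>k. LINT x|lebesgue_on \<Omega>. norm (grad (\<phi> k) x - grad u x) powr p) \<longlonglongrightarrow> 0"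
    \<comment> \<open>The gradient of |x - c|^2 contributes 2 |x - c| \<le> 2 R2, multiplied by the
      bound \<open>B\<close> for the derivatives of \<open>\<Phi> k\<close>; \<open>Bw\<close>
      bounds grad u.\<close>
    proof (rule Lp_tendsto_0_if_bounded[where B = "2 * B * R2 + Bw", OF lmeasurable_\<Omega>])
      show "norm (grad (\<phi> k) x - grad u x) \<le> 2 * B * R2 + Bw" if "x \<in> \<Omega>" for k x
      proof -
        have "norm (grad (\<phi> k) x) = 2 * \<bar>\<Phi>' k ((norm (x - c))\<^sup>2)\<bar> * dist x c"
          by (simp add: grad_\<phi> abs_mult dist_norm)
        also have "\<dots> \<le> 2 * B * R2"
          using \<Phi>(5) dist_in[OF that] B by (intro mult_mono) auto
        finally show ?thesis
          using norm_triangle_ineq4[of "grad (\<phi> k) x" "grad u x"] Bw[OF that] norm_grad_u[OF that] by linarith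
      qed
      show "(\<lambda>k. grad (\<phi> k) x - grad u x) \<longlonglongrightarrow> 0" if "x \<in> \<Omega>" for x
        using lim_grad[OF that] by (simp add: LIM_zero)
    qed (use meas grad_u_measurable p_gt_1 in auto)
    moreover have "(LINT x|lebesgue_on \<Omega>. norm (grad (\<phi> k) x - weak_grad \<Omega> u x) powr p) =
        (LINT x|lebesgue_on \<Omega>. norm (grad (\<phi> k) x - grad u x) powr p)" for k
    proof (rule integral_cong_AE)
      have [measurable]: "weak_grad \<Omega> u \<in> borel_measurable (lebesgue_on \<Omega>)"
        using weak_grad_in_Lp[OF open_annulus u_in_W1p] by (simp add: in_Lp_def)
      note [measurable] = meas grad_u_measurable
      show "(\<lambda>x. norm (grad (\<phi> k) x - weak_grad \<Omega> u x) powr p) \<in> borel_measurable (lebesgue_on \<Omega>)"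
        "(\<lambda>x. norm (grad (\<phi> k) x - grad u x) powr p) \<in> borel_measurable (lebesgue_on \<Omega>)"
        by measurable
      show "AE x in lebesgue_on \<Omega>. norm (grad (\<phi> k) x - weak_grad \<Omega> u x) powr p =
          norm (grad (\<phi> k) x - grad u x) powr p"
        using weak_grad_u by (rule eventually_mono) simp
    qed
    ultimately show ?thesis by simp
  qed
  ultimately have "(\<lambda>k. (LINT x|lebesgue_on \<Omega>. norm (\<phi> k x - u x) powr p) +
      (LINT x|lebesgue_on \<Omega>. norm (grad (\<phi> k) x - weak_grad \<Omega> u x) powr p)) \<longlonglongrightarrow> 0"
    by (rule tendsto_add_zero)
  then show ?thesis
    using u_in_W1p test unfolding W1p_0_def real_norm_def by blast
qed

lemma u_feasible: "u \<in> feasible_space p c R1 R2"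
  using u_in_W1p_0 u_cont by (auto simp: feasible_space_def radially_symmetric_on_def u_def)

text \<open>The tangent inequality at \<xi> = grad u with \<eta> the weak gradient of v is
  integrated over \<open>\<Omega>\<close>. The weak equation, applied to v and to \<open>u\<close>
  itself, turns the linear term into the integral of f (v - u).\<close>

lemma energy_u_le:
  assumes "v \<in> W1p_0 p \<Omega>"
  shows "energy p \<epsilon> \<Omega> f u \<le> energy p \<epsilon> \<Omega> f v"
proof -
  let ?M = "lebesgue_on \<Omega>"
  define \<kappa> where "\<kappa> = chi p * \<epsilon>\<^sup>2"
  have \<kappa>: "\<kappa> \<ge> 0" by (simp add: \<kappa>_def chi_def)
  define J where "J v x = ((norm (weak_grad \<Omega> v x))\<^sup>2 + \<kappa>) powr (p / 2)" for v x
  let ?V = "flux p \<epsilon> u"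
  obtain Bk where Bk: "Bk \<ge> 0" "\<And>x. x \<in> \<Omega> \<Longrightarrow> \<bar>k (dist x c)\<bar> \<le> Bk"
    using bounded_on_interval[OF k_cont] by metis
  obtain Bh where Bh: "\<And>x. x \<in> \<Omega> \<Longrightarrow> \<bar>h (dist x c)\<bar> \<le> Bh"
    using bounded_on_interval[OF h_cont] by metis
  have V_bound: "norm (?V x) \<le> max (Bk * R2) Bh" if "x \<in> \<Omega>" for x
  proof -
    have "norm (?V x) = \<bar>k (dist x c)\<bar> * dist x c" by (simp add: flux_u[OF that] dist_norm)
    also have "\<dots> \<le> Bk * R2" using Bk(1) Bk(2)[OF that] dist_in[OF that] by (intro mult_mono) auto
    finally show ?thesis by simp
  qed
  have f_bound: "\<bar>f x\<bar> \<le> max (Bk * R2) Bh" if "x \<in> \<Omega>" for x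
  proof -
    have "x \<in> closure \<Omega>" using that closure_subset by blast
    then show ?thesis using Bh[OF that] h_dist[of x] by simp
  qed
  have f_cont': "continuous_on \<Omega> f" by (rule continuous_on_subset[OF f_cont closure_subset])
  have weak: "integrable ?M (\<lambda>x. ?V x \<bullet> weak_grad \<Omega> v x)" "integrable ?M (\<lambda>x. f x * v x)"
    "(LINT x|?M. ?V x \<bullet> weak_grad \<Omega> v x) = (LINT x|?M. f x * v x)" if "v \<in> W1p_0 p \<Omega>" for v
    using W1p_0_weak_equation[OF open_annulus bounded_annulus less_imp_le[OF p_gt_1] that
        Ck_on_flux_u V_bound f_cont' f_bound divergence_flux_u] by blast+
  note weak_u = weak[OF u_in_W1p_0] and weak_v = weak[OF assms]
  have J_int: "integrable ?M (J v)" if "v \<in> W1p_0 p \<Omega>" for v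
  proof -
    have "in_Lp p \<Omega> (weak_grad \<Omega> v)"
      using that by (intro weak_grad_in_Lp open_annulus) (simp add: W1p_0_def)
    then show ?thesis unfolding J_def[abs_def]
      using p_gt_1 \<kappa> by (intro energy_density_integrable lmeasurable_\<Omega>) auto
  qed
  have "(LINT x|?M. 1 / p * J u x + (?V x \<bullet> weak_grad \<Omega> v x - ?V x \<bullet> weak_grad \<Omega> u x)) \<le>
      (LINT x|?M. 1 / p * J v x)"
  proof (rule integral_mono_AE)
    show "AE x in ?M. 1 / p * J u x + (?V x \<bullet> weak_grad \<Omega> v x - ?V x \<bullet> weak_grad \<Omega> u x) \<le> 1 / p * J v x"
      using weak_grad_u
    proof (rule eventually_mono)
      fix x assume "weak_grad \<Omega> u x = grad u x"
      then show "1 / p * J u x + (?V x \<bullet> weak_grad \<Omega> v x - ?V x \<bullet> weak_grad \<Omega> u x) \<le> 1 / p * J v x"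
        using energy_density_convex[OF p_gt_1 \<kappa>, of "grad u x" "weak_grad \<Omega> v x"]
        by (simp add: J_def flux_def \<kappa>_def inner_diff_right)
    qed
  qed (use J_int[OF u_in_W1p_0] J_int[OF assms] weak_u weak_v in simp_all)
  also have "(LINT x|?M. 1 / p * J u x + (?V x \<bullet> weak_grad \<Omega> v x - ?V x \<bullet> weak_grad \<Omega> u x)) =
      1 / p * (LINT x|?M. J u x) + ((LINT x|?M. f x * v x) - (LINT x|?M. f x * u x))"
    using J_int[OF u_in_W1p_0] weak_u weak_v by simp
  finally show ?thesis
    unfolding energy_def \<kappa>_def[symmetric] J_def[symmetric] by simp
qed

lemma u_global_minimizer: "global_minimizer (energy p \<epsilon> \<Omega> f) (feasible_space p c R1 R2) u"
  using u_feasible energy_u_le by (auto simp: global_minimizer_def feasible_space_def)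

lemma u_eq_u_bar: "x \<in> closure \<Omega> \<Longrightarrow> u x = u_bar p \<epsilon> c R1 R2 f (dist x c)"
  by (simp add: u_def u_bar_eq closure_\<Omega>)

end

theorem theorem1p2:
  fixes c :: "'a::euclidean_space" and f :: "'a \<Rightarrow> real" and p \<epsilon> R1 R2 :: real
  assumes "DIM('a) \<ge> 2"
    and "p \<in> {1<..<2} \<union> {2<..}"
    and "R2 > R1" and "R1 > 0"
    and "continuous_on (closure (annulus c R1 R2)) f"
    and "radially_symmetric_on (closure (annulus c R1 R2)) c f"
    and "Sgn_on (closure (annulus c R1 R2)) f = 1 \<or> Sgn_on (closure (annulus c R1 R2)) f = - 1"
    and "\<epsilon> > 0"
  shows "(\<exists>!C. C > 0 \<and> M_fun p \<epsilon> c R1 R2 f C = 0) \<and>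
    (\<exists>u. global_minimizer (energy p \<epsilon> (annulus c R1 R2) f) (feasible_space p c R1 R2) u \<and>
         solves_Euler_Lagrange p \<epsilon> (annulus c R1 R2) f u \<and>
         (\<forall>x\<in>closure (annulus c R1 R2). u x = u_bar p \<epsilon> c R1 R2 f (dist x c)))"
proof -
  interpret annulus_problem c f p \<epsilon> R1 R2
    by unfold_locales (use assms in auto)
  show ?thesis
    by (intro conjI exI[of _ u] ex1_C u_global_minimizer solves_u ballI u_eq_u_bar)
qed

end
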